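(* Every $6$-edge-connected graph $G$ with $n\ge 2$ vertices has at least $2^{(n-2)/12}$ nowhere-zero $\mathbb{Z}_3$-flows. Moreover, if the maximum degree of $G$ is at most $7$, then for every vertex $v\in V(G)$, every orientation of the edges incident with $v$ satisfying $\deg^+(v)-\deg^-(v)\equiv 0\pmod 3$ extends to at least $2^{(n-2)/12}$ nowhere-zero $\mathbb{Z}_3$-flows in $G$.
   Context: Graphs are finite and may have loops and parallel edges. A nowhere-zero $\mathbb{Z}_3$-flow of $G$ is identified with an orientation of all edges of $G$ such that every vertex $u$ satisfies $\deg^+(u)-\deg^-(u)\equiv 0\pmod 3$, where $\deg^+(u)$ and $\deg^-(u)$ are the out- and in-degree of $u$ in the orientation. Distinct orientations count as distinct flows. An orientation of $G$ extends a given orientation of the edges incident with $v$ if it agrees with it on those edges. *)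

theory Defs
  imports
    Complex_Main
    "HOL-Library.FuncSet"
    "HOL-Number_Theory.Cong"
    "Graph_Theory.Digraph_Component"
begin

text \<open>
  A finite undirected multigraph (loops and parallel edges allowed) is represented by a
  \<^locale>\<open>fin_digraph\<close>: its edges are the arcs, and the given tail and head
  of an arc only name its two ends. All notions below are independent of this reference direction.
\<close>

definition incident_arcs :: "('v, 'e) pre_digraph \<Rightarrow> 'v \<Rightarrow> 'e set" where
  "incident_arcs G v = in_arcs G v \<union> out_arcs G v"

text \<open>A loop contributes 2 to the degree of its vertex.\<close>

definition degree :: "('v, 'e) pre_digraph \<Rightarrow> 'v \<Rightarrow> nat" where
  "degree G v = in_degree G v + out_degree G v"

definition max_degree :: "('v, 'e) pre_digraph \<Rightarrow> nat" where
  "max_degree G = Max (degree G ` verts G)"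

text \<open>
  \<^const>\<open>Digraph_Component.connected\<close> is connectedness of the underlying undirected graph.
\<close>

definition edge_connected :: "nat \<Rightarrow> ('v, 'e) pre_digraph \<Rightarrow> bool" where
  "edge_connected k G \<longleftrightarrow>
     (\<forall>F \<subseteq> arcs G. card F < k \<longrightarrow> Digraph_Component.connected (G\<lparr>arcs := arcs G - F\<rparr>))"

text \<open>
  An orientation of a set of edges is an extensional Boolean function on it: True keeps the
  reference direction of an edge, False reverses it. In particular, a loop has two orientations,
  corresponding to the two nonzero flow values it can carry.
\<close>

definition orientations :: "'e set \<Rightarrow> ('e \<Rightarrow> bool) set" where
  "orientations A = A \<rightarrow>\<^sub>E UNIV"

definition orient :: "('v, 'e) pre_digraph \<Rightarrow> ('e \<Rightarrow> bool) \<Rightarrow> ('v, 'e) pre_digraph" where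
  "orient G \<sigma> =
     G\<lparr>tail := \<lambda>e. if \<sigma> e then tail G e else head G e,
       head := \<lambda>e. if \<sigma> e then head G e else tail G e\<rparr>"

text \<open>
  This depends only on the values of \<open>\<sigma>\<close> on the edges incident with \<open>u\<close>, so it
  also makes sense for an orientation of just these edges.
\<close>

definition z3_conserved_at :: "('v, 'e) pre_digraph \<Rightarrow> ('e \<Rightarrow> bool) \<Rightarrow> 'v \<Rightarrow> bool" where
  "z3_conserved_at G \<sigma> u \<longleftrightarrow>
     [int (out_degree (orient G \<sigma>) u) - int (in_degree (orient G \<sigma>) u) = 0] (mod 3)"

definition nz_z3_flows :: "('v, 'e) pre_digraph \<Rightarrow> ('e \<Rightarrow> bool) set" where
  "nz_z3_flows G = {\<sigma> \<in> orientations (arcs G). \<forall>u \<in> verts G. z3_conserved_at G \<sigma> u}"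

definition extends_on :: "'e set \<Rightarrow> ('e \<Rightarrow> bool) \<Rightarrow> ('e \<Rightarrow> bool) \<Rightarrow> bool" where
  "extends_on A \<sigma> \<tau> \<longleftrightarrow> (\<forall>e \<in> A. \<sigma> e = \<tau> e)"

end

theory Submission
  imports Defs
begin

text \<open>
  Following Lovasz, Thomassen, Wu and Zhang, one orients a graph with prescribed residues
  (out-degree minus in-degree modulo 3) at all vertices, the edges at a root vertex being oriented in
  advance. The hypotheses bound the sizes of all cuts from below and the degree of the root from
  above. In a minimal counterexample every set with at least two vertices has a large cut, since
  otherwise one contracts it, and then its complement. Hence single edges can be deleted and pairs of
  edges lifted, until every vertex but the root has degree 5 or 6 and can afford to lose an outgoing
  (or, symmetrically, an incoming) edge. This last case is settled by merging a neighbour into the root.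

  For the count call a set free if its cut stays feasible after the deletion of one edge in
  either direction. If a set with at least two vertices is not free, then its cut can be the root of
  one side, and the numbers of orientations of the two contracted graphs multiply. Otherwise an edge
  between two free vertices may be deleted in both orientations, which doubles the count. When no such
  edge is left, the free vertices are independent and hardly outnumber the others.
\<close>

section \<open>Cuts, nets and rooted orientation problems\<close>

text \<open>Prescribing the edges at a root is what makes contraction usable: an orientation found
  outside a set fixes the edges of its cut, and the inside has to extend it. The bounds depend on
  residues because the net of a set has the parity of its cut and is prescribed modulo 3, so it is
  known modulo 6 and cut sizes count in steps of two. They are balanced so that a feasible set
  either has two edges to spare or has exactly the size that a root may have.

  The exponent comes from the choice of the root. With \<open>n\<close> vertices, an isolated extra
  root leaves all of them free and yields even \<open>(n + 5) / 12\<close>. A given root with 7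
  edges yields \<open>(n + 4) / 12\<close>. A root with 6 edges and demand 0 is too large for the
  induction, so one of its edges is deleted in its prescribed direction. The neighbour at the other
  end may then cease to be free, and \<open>5 + (n - 2) - 5 = n - 2\<close> remains.\<close>

definition crossing :: "'e set \<Rightarrow> ('e \<Rightarrow> 'v \<times> 'v) \<Rightarrow> 'v set \<Rightarrow> 'e set" where
  "crossing E g A = {e \<in> E. (fst (g e) \<in> A) \<noteq> (snd (g e) \<in> A)}"

definition cut_size :: "'e set \<Rightarrow> ('e \<Rightarrow> 'v \<times> 'v) \<Rightarrow> 'v set \<Rightarrow> nat" where
  "cut_size E g A = card (crossing E g A)"

text \<open>By the difference of the two indicators an edge inside \<open>A\<close>, in particular a
  loop, contributes 0. Hence the net of a set is the sum of the nets of its vertices.\<close>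

definition outflow :: "('e \<Rightarrow> 'v \<times> 'v) \<Rightarrow> ('e \<Rightarrow> bool) \<Rightarrow> 'v set \<Rightarrow> 'e \<Rightarrow> int" where
  "outflow g \<sigma> A e =
     (if \<sigma> e then 1 else -1) * (of_bool (fst (g e) \<in> A) - of_bool (snd (g e) \<in> A))"

definition net :: "'e set \<Rightarrow> ('e \<Rightarrow> 'v \<times> 'v) \<Rightarrow> ('e \<Rightarrow> bool) \<Rightarrow> 'v set \<Rightarrow> int" where
  "net E g \<sigma> A = sum (outflow g \<sigma> A) E"

definition meets :: "('e \<Rightarrow> 'v \<times> 'v) \<Rightarrow> 'v \<Rightarrow> 'e \<Rightarrow> bool" where
  "meets g z e \<longleftrightarrow> fst (g e) = z \<or> snd (g e) = z"

text \<open>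
  The edges at the root \<open>z\<close> are oriented in advance by \<open>\<sigma>0\<close>; every other value of \<open>\<sigma>0\<close> is irrelevant.
\<close>

definition sol :: "'v set \<Rightarrow> 'v \<Rightarrow> 'e set \<Rightarrow> ('e \<Rightarrow> 'v \<times> 'v) \<Rightarrow> ('v \<Rightarrow> int) \<Rightarrow> ('e \<Rightarrow> bool)
    \<Rightarrow> ('e \<Rightarrow> bool) set" where
  "sol V z E g \<beta> \<sigma>0 = {\<sigma> \<in> E \<rightarrow>\<^sub>E UNIV. (\<forall>e\<in>E. meets g z e \<longrightarrow> \<sigma> e = \<sigma>0 e) \<and>
     (\<forall>v\<in>V. 3 dvd net E g \<sigma> {v} - \<beta> v)}"

definition root_feasible :: "nat \<Rightarrow> int \<Rightarrow> bool" where
  "root_feasible d b \<longleftrightarrow> d \<le> 5 \<or> d = 6 \<and> \<not> 3 dvd b \<or> d = 7 \<and> 3 dvd b"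

text \<open>The lower bound is a parameter \<open>Q\<close> because existence uses
  \<open>feasible\<close> and counting uses \<open>feasible5\<close>, with the same mergings and
  contractions. It concerns proper subsets of \<open>V - {z}\<close>: the cut of
  \<open>V - {z}\<close> is that of the root and is bounded from above. Edges are names whose ends
  are given by \<open>g\<close>; contraction relabels the ends, so an orientation of a minor is an
  orientation of part of the same edge set.\<close>

definition admissible :: "(nat \<Rightarrow> int \<Rightarrow> bool) \<Rightarrow> 'v set \<Rightarrow> 'v \<Rightarrow> 'e set \<Rightarrow> ('e \<Rightarrow> 'v \<times> 'v)
    \<Rightarrow> ('v \<Rightarrow> int) \<Rightarrow> ('e \<Rightarrow> bool) \<Rightarrow> bool" where
  "admissible Q V z E g \<beta> \<sigma>0 \<longleftrightarrow> finite V \<and> z \<in> V \<and> 3 \<le> card V \<and> finite E \<and>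
     (\<forall>e\<in>E. fst (g e) \<in> V \<and> snd (g e) \<in> V) \<and> 3 dvd sum \<beta> V \<and>
     3 dvd net E g \<sigma>0 {z} - \<beta> z \<and> root_feasible (cut_size E g {z}) (\<beta> z) \<and>
     (\<forall>A. A \<noteq> {} \<longrightarrow> A \<subset> V - {z} \<longrightarrow> Q (cut_size E g A) (sum \<beta> A))"

text \<open>The edges at the root and the loops do not count for the root's own degree, so this
  measure drops even when an edge between two other vertices has one end moved to the root, which
  keeps the number of edges.\<close>

definition size_of :: "'v set \<Rightarrow> 'v \<Rightarrow> 'e set \<Rightarrow> ('e \<Rightarrow> 'v \<times> 'v) \<Rightarrow> nat" where
  "size_of V z E g = card V + (\<Sum>v\<in>V - {z}. cut_size E g {v})"

definition relabel :: "('v \<Rightarrow> 'v) \<Rightarrow> ('e \<Rightarrow> 'v \<times> 'v) \<Rightarrow> 'e \<Rightarrow> 'v \<times> 'v" where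
  "relabel \<phi> g e = (\<phi> (fst (g e)), \<phi> (snd (g e)))"

section \<open>Additivity of nets and of cut sizes\<close>

lemma finite_crossing [simp]: "finite E \<Longrightarrow> finite (crossing E g A)"
  by (simp add: crossing_def)

lemma outflow_eq_0_iff: "outflow g \<sigma> A e = 0 \<longleftrightarrow> (fst (g e) \<in> A) = (snd (g e) \<in> A)"
  by (auto simp: outflow_def)

lemma outflow_crossing: "e \<in> crossing E g A \<Longrightarrow> outflow g \<sigma> A e = 1 \<or> outflow g \<sigma> A e = -1"
  by (auto simp: outflow_def crossing_def)

lemma net_eq_sum_crossing: "finite E \<Longrightarrow> net E g \<sigma> A = sum (outflow g \<sigma> A) (crossing E g A)"
  unfolding net_def by (rule sum.mono_neutral_right) (auto simp: crossing_def outflow_def)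

lemma net_cong:
  assumes "finite E" "\<And>e. e \<in> crossing E g A \<Longrightarrow> \<sigma> e = \<sigma>' e"
  shows "net E g \<sigma> A = net E g \<sigma>' A"
  unfolding net_eq_sum_crossing[OF assms(1)]
  by (rule sum.cong) (auto simp: outflow_def assms(2))

lemma outflow_eq_sum: "finite A \<Longrightarrow> outflow g \<sigma> A e = (\<Sum>v\<in>A. outflow g \<sigma> {v} e)"
proof -
  assume A: "finite A"
  have *: "(of_bool (x \<in> A) :: int) = (\<Sum>v\<in>A. of_bool (x = v))" for x
    using A by (simp add: of_bool_def)
  show ?thesis
    unfolding outflow_def sum_distrib_left[symmetric] sum_subtractf * by simp
qed

lemma net_eq_sum: "finite A \<Longrightarrow> net E g \<sigma> A = (\<Sum>v\<in>A. net E g \<sigma> {v})"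
  unfolding net_def by (subst sum.swap) (rule sum.cong[OF refl], rule outflow_eq_sum)

lemma net_whole: "\<forall>e\<in>E. fst (g e) \<in> V \<and> snd (g e) \<in> V \<Longrightarrow> net E g \<sigma> V = 0"
  unfolding net_def by (rule sum.neutral) (auto simp: outflow_def)

lemma crossing_compl: "\<forall>e\<in>E. fst (g e) \<in> V \<and> snd (g e) \<in> V \<Longrightarrow> crossing E g (V - A) = crossing E g A"
  by (auto simp: crossing_def)

lemma cut_size_compl: "\<forall>e\<in>E. fst (g e) \<in> V \<and> snd (g e) \<in> V \<Longrightarrow> cut_size E g (V - A) = cut_size E g A"
  by (simp add: cut_size_def crossing_compl)

lemma net_compl:
  assumes "\<forall>e\<in>E. fst (g e) \<in> V \<and> snd (g e) \<in> V"
  shows "net E g \<sigma> (V - A) = - net E g \<sigma> A"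
proof -
  have "net E g \<sigma> (V - A) + net E g \<sigma> A = 0"
    unfolding net_def sum.distrib[symmetric] using assms
    by (intro sum.neutral) (auto simp: outflow_def)
  then show ?thesis by simp
qed

lemma net_diff: "finite E \<Longrightarrow> F \<subseteq> E \<Longrightarrow> net (E - F) g \<sigma> A = net E g \<sigma> A - net F g \<sigma> A"
  unfolding net_def by (rule sum_diff)

lemma cut_size_diff:
  assumes "finite E" "F \<subseteq> E"
  shows "cut_size E g A = cut_size (E - F) g A + cut_size F g A"
proof -
  have "crossing E g A = crossing (E - F) g A \<union> crossing F g A" using assms by (auto simp: crossing_def)
  moreover have "crossing (E - F) g A \<inter> crossing F g A = {}" by (auto simp: crossing_def)
  ultimately show ?thesis
    unfolding cut_size_def using assms finite_subset by (metis card_Un_disjoint finite_Diff finite_crossing)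
qed

lemma cut_size_empty [simp]: "cut_size {} g A = 0" and net_empty [simp]: "net {} g \<sigma> A = 0"
  by (auto simp: cut_size_def crossing_def net_def)

lemma cut_size_insert:
  "finite F \<Longrightarrow> e \<notin> F \<Longrightarrow>
    cut_size (insert e F) g A = cut_size F g A + of_bool ((fst (g e) \<in> A) \<noteq> (snd (g e) \<in> A))"
proof -
  assume F: "finite F" "e \<notin> F"
  have "crossing {e} g A = (if (fst (g e) \<in> A) \<noteq> (snd (g e) \<in> A) then {e} else {})"
    by (auto simp: crossing_def)
  then show ?thesis
    using cut_size_diff[of "insert e F" "{e}" g A] F by (simp add: cut_size_def)
qed

lemma net_insert:
  "finite F \<Longrightarrow> e \<notin> F \<Longrightarrow> net (insert e F) g \<sigma> A = net F g \<sigma> A + outflow g \<sigma> A e"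
  by (simp add: net_def)

lemma cut_size_Un:
  assumes "finite E" "A \<inter> B = {}"
  shows "cut_size E g A + cut_size E g B = cut_size E g (A \<union> B) + 2 * card (crossing E g A \<inter> crossing E g B)"
proof -
  have "crossing E g A \<union> crossing E g B =
      crossing E g (A \<union> B) \<union> (crossing E g A \<inter> crossing E g B)"
    using assms by (auto simp: crossing_def)
  moreover have "crossing E g (A \<union> B) \<inter> (crossing E g A \<inter> crossing E g B) = {}"
    using assms by (auto simp: crossing_def)
  ultimately have "card (crossing E g A \<union> crossing E g B) =
      card (crossing E g (A \<union> B)) + card (crossing E g A \<inter> crossing E g B)"
    using assms(1) by (simp add: card_Un_disjoint)
  then show ?thesis
    using card_Un_Int[of "crossing E g A" "crossing E g B"] assms(1) by (simp add: cut_size_def)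
qed

lemma cut_size_relabel:
  assumes "\<forall>e\<in>E. fst (g e) \<in> V \<and> snd (g e) \<in> V" "\<And>v. v \<in> V \<Longrightarrow> \<phi> v \<in> A' \<longleftrightarrow> v \<in> A"
  shows "cut_size E (relabel \<phi> g) A' = cut_size E g A"
  using assms by (auto simp: cut_size_def crossing_def relabel_def intro!: arg_cong[of _ _ card])

lemma net_relabel:
  assumes "\<forall>e\<in>E. fst (g e) \<in> V \<and> snd (g e) \<in> V" "\<And>v. v \<in> V \<Longrightarrow> \<phi> v \<in> A' \<longleftrightarrow> v \<in> A"
  shows "net E (relabel \<phi> g) \<sigma> A' = net E g \<sigma> A"
  using assms by (auto simp: net_def outflow_def relabel_def intro!: sum.cong)

lemma net_eq_0: "finite E \<Longrightarrow> cut_size E g A = 0 \<Longrightarrow> net E g \<sigma> A = 0"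
  by (simp add: net_eq_sum_crossing cut_size_def)

lemma admissibleD:
  assumes "admissible Q V z E g \<beta> \<sigma>0"
  shows "finite V" "z \<in> V" "3 \<le> card V" "finite E" "\<forall>e\<in>E. fst (g e) \<in> V \<and> snd (g e) \<in> V"
    "3 dvd sum \<beta> V" "3 dvd net E g \<sigma>0 {z} - \<beta> z" "root_feasible (cut_size E g {z}) (\<beta> z)"
    "\<And>A. A \<noteq> {} \<Longrightarrow> A \<subset> V - {z} \<Longrightarrow> Q (cut_size E g A) (sum \<beta> A)"
  using assms by (auto simp: admissible_def)

subsection \<open>Merging a set of vertices into the root\<close>

definition merge :: "'v set \<Rightarrow> 'v \<Rightarrow> 'v \<Rightarrow> 'v" where
  "merge C z v = (if v \<in> C then z else v)"

text \<open>
  The edges in \<open>F\<close> are deleted and, before that, the set \<open>C\<close> is merged into the root;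
  \<open>\<rho>\<close> fixes the orientation of the edges of \<open>F\<close> and of those incident with \<open>C\<close>.
\<close>

definition merged_demand :: "'v set \<Rightarrow> 'v \<Rightarrow> 'e set \<Rightarrow> ('e \<Rightarrow> 'v \<times> 'v) \<Rightarrow> ('v \<Rightarrow> int)
    \<Rightarrow> ('e \<Rightarrow> bool) \<Rightarrow> 'v \<Rightarrow> int" where
  "merged_demand C z F g \<beta> \<rho> v =
     (if v = z then sum \<beta> C - net F g \<rho> C else \<beta> v - net F g \<rho> {v})"

lemma sum_merged_demand:
  "finite A \<Longrightarrow> z \<notin> A \<Longrightarrow> sum (merged_demand C z F g \<beta> \<rho>) A = sum \<beta> A - net F g \<rho> A"
  by (subst net_eq_sum, assumption, subst sum_subtractf[symmetric])
    (auto simp: merged_demand_def intro!: sum.cong)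

text \<open>A set that avoids \<open>C\<close> has the same cut before and after the merging, so for
  such sets only the deletion of \<open>F\<close> matters. The prescription at the new root is
  consistent because \<open>\<rho>\<close> already meets the demands in \<open>C\<close>.\<close>

lemma admissible_merge:
  assumes V: "finite V" "finite E" "\<forall>e\<in>E. fst (g e) \<in> V \<and> snd (g e) \<in> V" "3 dvd sum \<beta> V"
    and C: "C \<subseteq> V" "z \<in> C" "2 \<le> card (V - C)" and F: "F \<subseteq> E"
    and \<rho>: "\<And>v. v \<in> C \<Longrightarrow> 3 dvd net E g \<rho> {v} - \<beta> v"
    and root: "root_feasible (cut_size (E - F) g C) (sum \<beta> C - net F g \<rho> C)"
    and Q: "\<And>A. A \<noteq> {} \<Longrightarrow> A \<subset> V - C \<Longrightarrow> Q (cut_size (E - F) g A) (sum \<beta> A - net F g \<rho> A)"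
  shows "admissible Q (insert z (V - C)) z (E - F) (relabel (merge C z) g)
    (merged_demand C z F g \<beta> \<rho>) \<rho>"
proof -
  have fC: "finite C" using C V by (meson finite_subset)
  have wf: "\<forall>e\<in>E - F. fst (g e) \<in> V \<and> snd (g e) \<in> V" using V by auto
  have wfF: "\<forall>e\<in>F. fst (g e) \<in> V \<and> snd (g e) \<in> V" using V F by auto
  have dgz: "cut_size (E - F) (relabel (merge C z) g) {z} = cut_size (E - F) g C"
    by (rule cut_size_relabel[OF wf]) (use C in \<open>auto simp: merge_def\<close>)
  have netz: "net (E - F) (relabel (merge C z) g) \<rho> {z} = net (E - F) g \<rho> C"
    by (rule net_relabel[OF wf]) (use C in \<open>auto simp: merge_def\<close>)
  have dgA: "cut_size (E - F) (relabel (merge C z) g) A = cut_size (E - F) g A" if "A \<subseteq> V - C" for A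
    by (rule cut_size_relabel[OF wf]) (use C that in \<open>auto simp: merge_def\<close>)
  have "3 dvd net E g \<rho> C - sum \<beta> C"
    unfolding net_eq_sum[OF fC] sum_subtractf[symmetric] using \<rho> by (auto intro!: dvd_sum)
  then have "3 dvd net (E - F) g \<rho> C - (sum \<beta> C - net F g \<rho> C)"
    using net_diff[OF V(2) F, of g \<rho> C] by (simp add: algebra_simps)
  moreover have "sum (merged_demand C z F g \<beta> \<rho>) (insert z (V - C)) = sum \<beta> V"
  proof -
    have "sum (merged_demand C z F g \<beta> \<rho>) (insert z (V - C)) =
      sum \<beta> C - net F g \<rho> C + (sum \<beta> (V - C) - net F g \<rho> (V - C))"
      using C V by (simp add: sum_merged_demand merged_demand_def[of C z F g \<beta> \<rho> z])
    also have "\<dots> = sum \<beta> V"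
      using net_compl[OF wfF, of \<rho> C] sum.subset_diff[OF C(1) V(1), of \<beta>] by simp
    finally show ?thesis .
  qed
  moreover have eq: "insert z (V - C) - {z} = V - C" using C by auto
  moreover have "Q (cut_size (E - F) (relabel (merge C z) g) A) (sum (merged_demand C z F g \<beta> \<rho>) A)"
    if A: "A \<noteq> {}" "A \<subset> insert z (V - C) - {z}" for A
  proof -
    have "A \<subseteq> V - C" "finite A" "z \<notin> A"
      using A C V finite_subset[of A V] unfolding eq by auto
    then show ?thesis using Q[OF A(1)] A(2) dgA[of A] unfolding eq by (simp add: sum_merged_demand)
  qed
  moreover have "3 \<le> card (insert z (V - C))" using C V by simp
  ultimately show ?thesis
    unfolding admissible_def dgz netz using V wf C(2) F root
    by (auto simp: relabel_def merge_def merged_demand_def[of C z F g \<beta> \<rho> z])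
qed

definition glue :: "'e set \<Rightarrow> ('e \<Rightarrow> bool) \<Rightarrow> ('e \<Rightarrow> bool) \<Rightarrow> 'e \<Rightarrow> bool" where
  "glue F \<rho> \<sigma> e = (if e \<in> F then \<rho> e else \<sigma> e)"

text \<open>Every remaining edge with an end in \<open>C\<close> becomes an edge at the root. A
  solution therefore agrees with \<open>\<rho>\<close> on it, and the vertices of \<open>C\<close>
  keep the nets that they have under \<open>\<rho>\<close>.\<close>

lemma sol_merge:
  assumes V: "finite V" "finite E" "\<forall>e\<in>E. fst (g e) \<in> V \<and> snd (g e) \<in> V"
    and C: "C \<subseteq> V" "z \<in> C" and F: "F \<subseteq> E"
    and \<rho>: "\<And>v. v \<in> C \<Longrightarrow> 3 dvd net E g \<rho> {v} - \<beta> v"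
    and \<rho>0: "\<And>e. e \<in> E \<Longrightarrow> meets g z e \<Longrightarrow> \<rho> e = \<sigma>0 e"
    and \<sigma>: "\<sigma> \<in> sol (insert z (V - C)) z (E - F) (relabel (merge C z) g)
      (merged_demand C z F g \<beta> \<rho>) \<rho>"
  shows "glue F \<rho> \<sigma> \<in> sol V z E g \<beta> \<sigma>0"
proof -
  have wf: "\<forall>e\<in>E - F. fst (g e) \<in> V \<and> snd (g e) \<in> V" using V by auto
  have root: "glue F \<rho> \<sigma> e = \<rho> e" if "e \<in> E" "fst (g e) \<in> C \<or> snd (g e) \<in> C" for e
    using \<sigma> that by (auto simp: sol_def glue_def meets_def relabel_def merge_def)
  have "3 dvd net E g (glue F \<rho> \<sigma>) {v} - \<beta> v" if v: "v \<in> V" for v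
  proof (cases "v \<in> C")
    case True
    have "net E g (glue F \<rho> \<sigma>) {v} = net E g \<rho> {v}"
      by (rule net_cong[OF V(2)]) (use True root in \<open>auto simp: crossing_def\<close>)
    then show ?thesis using \<rho> True by auto
  next
    case False
    then have "v \<noteq> z" using C by auto
    have "net (E - F) (relabel (merge C z) g) \<sigma> {v} = net (E - F) g \<sigma> {v}"
      by (rule net_relabel[OF wf]) (use C False in \<open>auto simp: merge_def\<close>)
    moreover have "3 dvd net (E - F) (relabel (merge C z) g) \<sigma> {v} - merged_demand C z F g \<beta> \<rho> v"
      using \<sigma> v False unfolding sol_def by blast
    moreover have "merged_demand C z F g \<beta> \<rho> v = \<beta> v - net F g \<rho> {v}"
      using \<open>v \<noteq> z\<close> by (simp add: merged_demand_def)
    moreover have "net (E - F) g (glue F \<rho> \<sigma>) {v} = net (E - F) g \<sigma> {v}"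
      by (rule net_cong) (use V in \<open>auto simp: crossing_def glue_def\<close>)
    moreover have "net F g (glue F \<rho> \<sigma>) {v} = net F g \<rho> {v}"
      by (rule net_cong) (use V F finite_subset in \<open>auto simp: crossing_def glue_def\<close>)
    ultimately show ?thesis using net_diff[OF V(2) F, of g "glue F \<rho> \<sigma>" "{v}"]
      by (simp add: algebra_simps)
  qed
  moreover have "glue F \<rho> \<sigma> \<in> E \<rightarrow>\<^sub>E UNIV"
    using \<sigma> F by (auto simp: sol_def glue_def PiE_def extensional_def)
  moreover have "glue F \<rho> \<sigma> e = \<sigma>0 e" if "e \<in> E" "meets g z e" for e
    using root[OF that(1)] \<rho>0[OF that] that C by (auto simp: meets_def)
  ultimately show ?thesis unfolding sol_def by auto
qed

lemma size_of_merge: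
  assumes "finite V" "finite E" "\<forall>e\<in>E. fst (g e) \<in> V \<and> snd (g e) \<in> V"
    and "C \<subseteq> V" "z \<in> C" "F \<subseteq> E"
    and "C \<noteq> {z} \<or> (\<exists>v\<in>V - {z}. cut_size F g {v} \<noteq> 0)"
  shows "size_of (insert z (V - C)) z (E - F) (relabel (merge C z) g) < size_of V z E g"
proof -
  let ?g = "relabel (merge C z) g"
  have wf: "\<forall>e\<in>E - F. fst (g e) \<in> V \<and> snd (g e) \<in> V" using assms by auto
  have eq: "insert z (V - C) - {z} = V - C" using assms by auto
  have dgv: "cut_size (E - F) ?g {v} = cut_size (E - F) g {v}" if "v \<in> V - C" for v
    by (rule cut_size_relabel[OF wf]) (use that assms in \<open>auto simp: merge_def\<close>)
  have le: "cut_size (E - F) g {v} \<le> cut_size E g {v}" for v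
    using cut_size_diff[of E F g "{v}"] assms by simp
  have s1: "(\<Sum>v\<in>insert z (V - C) - {z}. cut_size (E - F) ?g {v}) = (\<Sum>v\<in>V - C. cut_size (E - F) g {v})"
    unfolding eq by (rule sum.cong) (auto simp: dgv)
  also have "\<dots> \<le> (\<Sum>v\<in>V - C. cut_size E g {v})" by (rule sum_mono) (rule le)
  also have "\<dots> \<le> (\<Sum>v\<in>V - {z}. cut_size E g {v})"
    by (rule sum_mono2) (use assms in auto)
  finally have s2: "(\<Sum>v\<in>insert z (V - C) - {z}. cut_size (E - F) ?g {v}) \<le> (\<Sum>v\<in>V - {z}. cut_size E g {v})" .
  have c: "card (insert z (V - C)) \<le> card V"
    by (rule card_mono) (use assms in auto)
  show ?thesis
  proof (cases "C = {z}")
    case True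
    then obtain v where v: "v \<in> V - {z}" "cut_size F g {v} \<noteq> 0" using assms by auto
    have "(\<Sum>v\<in>V - {z}. cut_size (E - F) g {v}) < (\<Sum>v\<in>V - {z}. cut_size E g {v})"
    proof (rule sum_strict_mono_ex1)
      show "\<exists>a\<in>V - {z}. cut_size (E - F) g {a} < cut_size E g {a}"
        using v cut_size_diff[of E F g "{v}"] assms by (intro bexI[of _ v]) auto
    qed (use assms le in auto)
    then show ?thesis using s1 c True unfolding size_of_def by simp
  next
    case False
    then obtain c where "c \<in> C" "c \<noteq> z" using assms by auto
    then have "insert z (V - C) \<subset> V" using assms by auto
    then have "card (insert z (V - C)) < card V" using assms(1) by (rule psubset_card_mono[rotated])
    then show ?thesis using s2 unfolding size_of_def by simp
  qed
qed

subsection \<open>Contracting a set of vertices avoiding the root\<close>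

definition collapse :: "'v set \<Rightarrow> 'v \<Rightarrow> 'v \<Rightarrow> 'v" where
  "collapse A a v = (if v \<in> A then a else v)"

text \<open>Edges inside \<open>A\<close> are dropped rather than turned into loops, since a loop
  would be oriented arbitrarily while the edge is still undecided. Thus an orientation of all of
  \<open>E\<close> determines the one of the contraction, which the count relies on.\<close>

definition outer :: "'e set \<Rightarrow> ('e \<Rightarrow> 'v \<times> 'v) \<Rightarrow> 'v set \<Rightarrow> 'e set" where
  "outer E g A = {e \<in> E. \<not> (fst (g e) \<in> A \<and> snd (g e) \<in> A)}"

lemma cut_size_outer:
  assumes "\<forall>e\<in>E. fst (g e) \<in> V \<and> snd (g e) \<in> V" "A \<subseteq> V" "a \<in> A" "X \<subseteq> insert a (V - A)"
  shows "cut_size (outer E g A) (relabel (collapse A a) g) X = cut_size E g (if a \<in> X then X \<union> A else X)"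
  using assms
  by (auto simp: cut_size_def crossing_def relabel_def outer_def collapse_def intro!: arg_cong[of _ _ card])

lemma net_outer:
  assumes "finite E" "\<forall>e\<in>E. fst (g e) \<in> V \<and> snd (g e) \<in> V" "A \<subseteq> V" "a \<in> A"
    "X \<subseteq> insert a (V - A)"
  shows "net (outer E g A) (relabel (collapse A a) g) \<sigma> X = net E g \<sigma> (if a \<in> X then X \<union> A else X)"
proof -
  have "net E g \<sigma> (if a \<in> X then X \<union> A else X) =
      net (outer E g A) g \<sigma> (if a \<in> X then X \<union> A else X)"
    unfolding net_def
    by (rule sum.mono_neutral_right) (use assms in \<open>auto simp: outer_def outflow_def\<close>)
  also have "\<dots> = net (outer E g A) (relabel (collapse A a) g) \<sigma> X"
    unfolding net_def
    by (rule sum.cong) (use assms in \<open>auto simp: outflow_def relabel_def collapse_def outer_def\<close>)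
  finally show ?thesis ..
qed

lemma sum_collapse:
  assumes "finite V" "A \<subseteq> V" "a \<in> A" "X \<subseteq> insert a (V - A)"
  shows "sum (\<beta>(a := sum \<beta> A)) X = sum \<beta> (if a \<in> X then X \<union> A else X)"
proof (cases "a \<in> X")
  case True
  have fX: "finite X" "finite A" using assms finite_subset by (auto intro: finite_subset)
  have "sum (\<beta>(a := sum \<beta> A)) X = sum \<beta> A + sum (\<beta>(a := sum \<beta> A)) (X - {a})"
    using True fX by (simp add: sum.remove)
  also have "sum (\<beta>(a := sum \<beta> A)) (X - {a}) = sum \<beta> (X - {a})"
    by (rule sum.cong) auto
  also have "sum \<beta> A + sum \<beta> (X - {a}) = sum \<beta> (A \<union> (X - {a}))"
    by (rule sum.union_disjoint[symmetric]) (use assms fX in auto)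
  also have "A \<union> (X - {a}) = X \<union> A" using True assms by auto
  finally show ?thesis using True by simp
next
  case False
  then show ?thesis by (auto intro!: sum.cong)
qed

text \<open>Every cut of the contracted graph is a cut of the given one with the same demand, so the
  contraction itself is free of charge. A condition on \<open>A\<close> arises only when its
  complement becomes the root.\<close>

lemma admissible_collapse:
  assumes adm: "admissible Q V z E g \<beta> \<sigma>0"
    and A: "A \<subseteq> V - {z}" "a \<in> A" "2 \<le> card (V - A)"
  shows "admissible Q (insert a (V - A)) z (outer E g A) (relabel (collapse A a) g)
    (\<beta>(a := sum \<beta> A)) \<sigma>0"
proof -
  note D = admissibleD[OF adm]
  let ?V = "insert a (V - A)" and ?E = "outer E g A" and ?g = "relabel (collapse A a) g"
  have AV: "A \<subseteq> V" using A by auto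
  have az: "a \<noteq> z" using A by auto
  have zV: "{z} \<subseteq> ?V" using A D by auto
  have "sum (\<beta>(a := sum \<beta> A)) ?V = sum \<beta> V"
    using sum_collapse[OF D(1) AV A(2), of ?V \<beta>] AV A by (simp add: insert_absorb Un_absorb2 subsetD)
  moreover have "net ?E ?g \<sigma>0 {z} = net E g \<sigma>0 {z}"
    using net_outer[OF D(4,5) AV A(2) zV] az by simp
  moreover have "cut_size ?E ?g {z} = cut_size E g {z}"
    using cut_size_outer[OF D(5) AV A(2) zV] az by simp
  moreover have "card ?V = Suc (card (V - A))" using A D by simp
  moreover have "Q (cut_size ?E ?g X) (sum (\<beta>(a := sum \<beta> A)) X)" if X: "X \<noteq> {}" "X \<subset> ?V - {z}" for X
  proof -
    have X': "X \<subseteq> ?V" using X by auto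
    have "Q (cut_size E g (if a \<in> X then X \<union> A else X)) (sum \<beta> (if a \<in> X then X \<union> A else X))"
    proof (rule D(9))
      show "(if a \<in> X then X \<union> A else X) \<subset> V - {z}"
        using X A by auto
    qed (use X in auto)
    then show ?thesis
      using cut_size_outer[OF D(5) AV A(2) X'] sum_collapse[OF D(1) AV A(2) X', of \<beta>] by simp
  qed
  ultimately show ?thesis
    unfolding admissible_def using D A az
    by (auto simp: outer_def relabel_def collapse_def)
qed

lemma size_of_collapse:
  assumes "finite V" "finite E" "\<forall>e\<in>E. fst (g e) \<in> V \<and> snd (g e) \<in> V"
    and A: "A \<subseteq> V - {z}" "a \<in> A" "2 \<le> card A" "z \<in> V"
  shows "size_of (insert a (V - A)) z (outer E g A) (relabel (collapse A a) g) < size_of V z E g"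
proof -
  let ?E = "outer E g A" and ?g = "relabel (collapse A a) g"
  have AV: "A \<subseteq> V" and fA: "finite A" using A assms by (auto intro: finite_subset)
  have az: "a \<noteq> z" using A by auto
  have dA: "cut_size E g A \<le> (\<Sum>v\<in>A. cut_size E g {v})"
  proof -
    have "crossing E g A \<subseteq> (\<Union>v\<in>A. crossing E g {v})" by (auto simp: crossing_def)
    then have "cut_size E g A \<le> card (\<Union>v\<in>A. crossing E g {v})"
      unfolding cut_size_def using assms fA by (intro card_mono) auto
    also have "\<dots> \<le> (\<Sum>v\<in>A. cut_size E g {v})" unfolding cut_size_def by (rule card_UN_le[OF fA])
    finally show ?thesis .
  qed
  have eq: "insert a (V - A) - {z} = insert a (V - A - {z})" using az by auto
  have "(\<Sum>v\<in>insert a (V - A) - {z}. cut_size ?E ?g {v}) =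
      cut_size ?E ?g {a} + (\<Sum>v\<in>V - A - {z}. cut_size ?E ?g {v})"
    unfolding eq using assms by (subst sum.insert) auto
  also have "cut_size ?E ?g {a} = cut_size E g A"
    using cut_size_outer[OF assms(3) AV A(2), of "{a}"] A by (simp add: insert_absorb)
  also have "(\<Sum>v\<in>V - A - {z}. cut_size ?E ?g {v}) = (\<Sum>v\<in>V - A - {z}. cut_size E g {v})"
    by (rule sum.cong) (use cut_size_outer[OF assms(3) AV A(2)] A in auto)
  also have "cut_size E g A + \<dots> \<le> (\<Sum>v\<in>A. cut_size E g {v}) + (\<Sum>v\<in>V - A - {z}. cut_size E g {v})"
    using dA by simp
  also have "\<dots> = (\<Sum>v\<in>A \<union> (V - A - {z}). cut_size E g {v})"
    by (rule sum.union_disjoint[symmetric]) (use assms fA in auto)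
  also have "A \<union> (V - A - {z}) = V - {z}" using A by auto
  finally have "(\<Sum>v\<in>insert a (V - A) - {z}. cut_size ?E ?g {v}) \<le> (\<Sum>v\<in>V - {z}. cut_size E g {v})" .
  moreover have "card (insert a (V - A)) < card V"
  proof -
    obtain x where "x \<in> A" "x \<noteq> a" using A(3) fA
      by (metis card_le_Suc0_iff_eq not_less_eq_eq numeral_2_eq_2)
    then have "insert a (V - A) \<subset> V" using AV A by auto
    then show ?thesis using assms(1) by (rule psubset_card_mono[rotated])
  qed
  ultimately show ?thesis unfolding size_of_def by simp
qed

lemma net_collapse_sol:
  assumes adm: "finite V" "finite E" "\<forall>e\<in>E. fst (g e) \<in> V \<and> snd (g e) \<in> V"
    and A: "A \<subseteq> V - {z}" "a \<in> A"
    and \<sigma>: "\<sigma> \<in> sol (insert a (V - A)) z (outer E g A) (relabel (collapse A a) g)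
      (\<beta>(a := sum \<beta> A)) \<sigma>0"
  shows "\<And>v. v \<in> V - A \<Longrightarrow> 3 dvd net E g \<sigma> {v} - \<beta> v"
    and "\<And>e. e \<in> E \<Longrightarrow> meets g z e \<Longrightarrow> \<sigma> e = \<sigma>0 e"
proof -
  have AV: "A \<subseteq> V" using A by auto
  fix v assume v: "v \<in> V - A"
  then have "v \<noteq> a" using A by auto
  have "3 dvd net (outer E g A) (relabel (collapse A a) g) \<sigma> {v} - (\<beta>(a := sum \<beta> A)) v"
    using \<sigma> v unfolding sol_def by blast
  then show "3 dvd net E g \<sigma> {v} - \<beta> v"
    using net_outer[OF adm(2,3) AV A(2), of "{v}" \<sigma>] v \<open>v \<noteq> a\<close> by auto
next
  fix e assume e: "e \<in> E" "meets g z e"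
  then have "e \<in> outer E g A" "meets (relabel (collapse A a) g) z e"
    using A by (auto simp: outer_def meets_def relabel_def collapse_def)
  then show "\<sigma> e = \<sigma>0 e" using \<sigma> by (auto simp: sol_def)
qed

section \<open>Existence of orientations\<close>

text \<open>
  For a set of vertices with cut size \<open>d\<close> and demand \<open>b\<close> let \<open>\<tau>\<close> be the integer of least absolute value
  with \<open>\<tau> \<equiv> b\<close> modulo 3 and \<open>\<tau> \<equiv> d\<close> modulo 2. Then \<open>feasible\<close>, \<open>slack\<close> and \<open>root_feasible\<close> say
  \<open>d \<ge> 4 + \<bar>\<tau>\<bar>\<close>, \<open>d \<ge> 6 + \<bar>\<tau>\<bar>\<close> and \<open>d \<le> 4 + \<bar>\<tau>\<bar>\<close>.
\<close>

definition feasible :: "nat \<Rightarrow> int \<Rightarrow> bool" where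
  "feasible d b \<longleftrightarrow> 6 \<le> d \<or> d = 5 \<and> \<not> 3 dvd b \<or> d = 4 \<and> 3 dvd b"

definition slack :: "nat \<Rightarrow> int \<Rightarrow> bool" where
  "slack d b \<longleftrightarrow> 8 \<le> d \<or> d = 7 \<and> \<not> 3 dvd b \<or> d = 6 \<and> 3 dvd b"

section \<open>Arithmetic of cuts, the case of three vertices, and reductions by contraction and
  deletion\<close>

lemma slack_minus2: "slack (d + 2) b \<Longrightarrow> feasible d b"
  by (auto simp: slack_def feasible_def)

lemma slack_minus1: "slack (d + 1) b \<Longrightarrow> feasible d (b - 1) \<and> feasible d (b + 1)"
  unfolding slack_def feasible_def by presburger

lemma feasible_ge_4: "feasible d b \<Longrightarrow> 4 \<le> d" and root_feasible_le_7: "root_feasible d b \<Longrightarrow> d \<le> 7"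
  by (auto simp: feasible_def root_feasible_def)

text \<open>\<open>m\<close> counts the edges between the two vertices other than the root. For
  \<open>m \<le> 1\<close> only the sizes (4, 4, 6), (4, 5, 7) and (5, 4, 7) of \<open>dx\<close>,
  \<open>dy\<close>, \<open>dz\<close> survive; in each of them two demands are 0 modulo 3, hence
  also the third, which its size forbids.\<close>

lemma three_vertices_arith:
  assumes "feasible dx bx" "feasible dy by" "root_feasible dz bz" "dx + dy = dz + 2 * m" "3 dvd bz + bx + by"
  shows "2 \<le> m"
proof (rule ccontr)
  assume "\<not> 2 \<le> m"
  then have "dx + dy \<le> dz + 2" using assms(4) by simp
  then have "dx = 4 \<and> dy = 4 \<and> dz = 6 \<or> dx = 4 \<and> dy = 5 \<and> dz = 7 \<or>
      dx = 5 \<and> dy = 4 \<and> dz = 7"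
    using assms(4) feasible_ge_4[OF assms(1)] feasible_ge_4[OF assms(2)] root_feasible_le_7[OF assms(3)] by presburger
  then show False
    by (elim disjE conjE) (use assms(1,2,3,5) in \<open>simp_all add: feasible_def root_feasible_def, presburger+\<close>)
qed

text \<open>The common form of most reductions. With \<open>C = {z}\<close> the merging is the
  identity, and the lemma deletes the edges of \<open>F\<close> in the directions given by
  \<open>\<rho>\<close>; the last hypothesis then makes the measure drop through a deleted
  edge.\<close>

lemma sol_by_merge:
  fixes E :: "'e set"
  assumes IH: "\<And>V (E :: 'e set) g \<beta> \<sigma>0. admissible Q V z E g \<beta> \<sigma>0 \<Longrightarrow> size_of V z E g < n \<Longrightarrow>
      sol V z E g \<beta> \<sigma>0 \<noteq> {}"
    and V: "finite V" "finite E" "\<forall>e\<in>E. fst (g e) \<in> V \<and> snd (g e) \<in> V" "3 dvd sum \<beta> V"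
    and n: "size_of V z E g \<le> n"
    and C: "C \<subseteq> V" "z \<in> C" "2 \<le> card (V - C)" and F: "F \<subseteq> E"
    and \<rho>: "\<And>v. v \<in> C \<Longrightarrow> 3 dvd net E g \<rho> {v} - \<beta> v"
    and \<rho>0: "\<And>e. e \<in> E \<Longrightarrow> meets g z e \<Longrightarrow> \<rho> e = \<sigma>0 e"
    and root: "root_feasible (cut_size (E - F) g C) (sum \<beta> C - net F g \<rho> C)"
    and Q: "\<And>A. A \<noteq> {} \<Longrightarrow> A \<subset> V - C \<Longrightarrow> Q (cut_size (E - F) g A) (sum \<beta> A - net F g \<rho> A)"
    and less: "C \<noteq> {z} \<or> (\<exists>v\<in>V - {z}. cut_size F g {v} \<noteq> 0)"
  shows "sol V z E g \<beta> \<sigma>0 \<noteq> {}"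
proof -
  have "sol (insert z (V - C)) z (E - F) (relabel (merge C z) g)
      (merged_demand C z F g \<beta> \<rho>) \<rho> \<noteq> {}"
    using IH[OF admissible_merge[where Q = Q, OF V C F \<rho> root Q]] size_of_merge[OF V(1-3) C(1,2) F less] n
    by simp
  then show ?thesis using sol_merge[OF V(1-3) C(1,2) F \<rho> \<rho>0] by blast
qed

lemma card_compl_ge_2:
  assumes "A \<subset> V - {z}" "z \<in> V" "finite V"
  shows "2 \<le> card (V - A)"
proof -
  obtain x where x: "x \<in> V - {z}" "x \<notin> A" using assms by auto
  then have "{x, z} \<subseteq> V - A" using assms by auto
  then have "card {x, z} \<le> card (V - A)" using assms by (intro card_mono) auto
  then show ?thesis using x by simp
qed

lemma singleton_or_card_ge_2:
  assumes "finite A" "A \<noteq> {}"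
  obtains v where "A = {v}" | "2 \<le> card A"
proof -
  have "card A \<noteq> 0" using assms by simp
  then consider "card A = 1" | "2 \<le> card A" by linarith
  then show ?thesis using that card_1_singletonE by metis
qed

lemma sum_compl_dvd:
  "3 dvd sum \<beta> V \<Longrightarrow> A \<subseteq> V \<Longrightarrow> finite V \<Longrightarrow> 3 dvd sum \<beta> (V - A) + (sum \<beta> A :: int)"
  by (metis add.commute sum.subset_diff)

text \<open>Two edges \<open>e\<close> and \<open>f\<close> join the vertices other than the root.
  Their orientations contribute 2, 0 or -2 to \<open>x\<close>, which covers all residues modulo 3;
  \<open>y\<close> follows since the nets of the three vertices sum to 0.\<close>

lemma sol_nonempty_base:
  assumes adm: "admissible feasible V z E g \<beta> \<sigma>0" and V: "card V = 3"
  shows "sol V z E g \<beta> \<sigma>0 \<noteq> {}"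
proof -
  note D = admissibleD[OF adm]
  have "card (V - {z}) = 2" using D V by simp
  then obtain x y where xy: "V - {z} = {x, y}" "x \<noteq> y" by (auto simp: card_2_iff)
  then have Vz: "V = {z, x, y}" "x \<noteq> z" "y \<noteq> z" using D(2) by auto
  let ?M = "crossing E g {x} \<inter> crossing E g {y}"
  have "feasible (cut_size E g {x}) (\<beta> x)" "feasible (cut_size E g {y}) (\<beta> y)"
    using D(9)[of "{x}"] D(9)[of "{y}"] xy by auto
  moreover have "cut_size E g {x} + cut_size E g {y} = cut_size E g {z} + 2 * card ?M"
    using cut_size_Un[OF D(4), of "{x}" "{y}" g] cut_size_compl[OF D(5), of "{z}"] xy by (simp add: insert_commute)
  moreover have bsum: "3 dvd \<beta> z + \<beta> x + \<beta> y" using D(6) Vz xy(2) by (simp add: add.assoc)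
  ultimately have "2 \<le> card ?M" using D(8) by (intro three_vertices_arith)
  then have "\<not> card ?M \<le> Suc 0" by simp
  moreover have "finite ?M" using D(4) by simp
  ultimately obtain e f where ef: "e \<in> ?M" "f \<in> ?M" "e \<noteq> f"
    using card_le_Suc0_iff_eq by blast
  let ?\<sigma> = "\<lambda>b c h. if h = e then b else if h = f then c else if h \<in> E then \<sigma>0 h else undefined"
  define r where "r = net (E - {e, f}) g \<sigma>0 {x} - \<beta> x"
  have eqE: "E = insert e (insert f (E - {e, f}))" using ef by (auto simp: crossing_def)
  have netx: "net E g (?\<sigma> b c) {x} =
      net (E - {e, f}) g \<sigma>0 {x} + outflow g (\<lambda>_. c) {x} f + outflow g (\<lambda>_. b) {x} e" for b c
  proof -
    have "net E g (?\<sigma> b c) {x} = net (E - {e, f}) g (?\<sigma> b c) {x}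
        + outflow g (?\<sigma> b c) {x} f + outflow g (?\<sigma> b c) {x} e"
      using D(4) ef by (subst eqE) (simp add: net_insert)
    also have "net (E - {e, f}) g (?\<sigma> b c) {x} = net (E - {e, f}) g \<sigma>0 {x}"
      by (rule net_cong) (use D in \<open>auto simp: crossing_def\<close>)
    finally show ?thesis using ef by (simp add: outflow_def)
  qed
  have "\<exists>b c. 3 dvd r + outflow g (\<lambda>_. c) {x} f + outflow g (\<lambda>_. b) {x} e"
  proof -
    have "\<exists>s::int. s \<in> {1, -1} \<and> (\<forall>b. outflow g (\<lambda>_. b) {x} h = (if b then s else - s))"
      if "h \<in> crossing E g {x}" for h
      using that by (cases "fst (g h) = x") (auto simp: outflow_def crossing_def)
    from this[of e] this[of f] ef obtain s t :: int where st: "s \<in> {1, -1}" "t \<in> {1, -1}"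
      "\<And>b. outflow g (\<lambda>_. b) {x} e = (if b then s else - s)"
      "\<And>b. outflow g (\<lambda>_. b) {x} f = (if b then t else - t)" by auto
    have "3 dvd r + 1 + 1 \<or> 3 dvd r + 1 + -1 \<or> 3 dvd r + -1 + -1" by presburger
    then have "\<exists>b' c'. 3 dvd r + (if c' then 1 else -1) + (if b' then 1 else -1 :: int)"
      by (metis (full_types))
    then obtain b' c' where "3 dvd r + (if c' then 1 else -1) + (if b' then 1 else -1 :: int)"
      by blast
    then show ?thesis
      using st by (intro exI[of _ "b' = (s = 1)"] exI[of _ "c' = (t = 1)"]) (auto split: if_splits)
  qed
  then obtain b c where bc: "3 dvd r + outflow g (\<lambda>_. c) {x} f + outflow g (\<lambda>_. b) {x} e" by blast
  let ?s = "?\<sigma> b c"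
  have nx: "3 dvd net E g ?s {x} - \<beta> x"
    using bc unfolding netx r_def by (simp add: algebra_simps)
  have efz: "\<not> meets g z e" "\<not> meets g z f"
    using ef xy Vz by (auto simp: crossing_def meets_def)
  have nz: "3 dvd net E g ?s {z} - \<beta> z"
  proof -
    have "net E g ?s {z} = net E g \<sigma>0 {z}"
      by (rule net_cong) (use D efz in \<open>auto simp: crossing_def meets_def\<close>)
    then show ?thesis using D(7) by simp
  qed
  have "net E g ?s {z} + net E g ?s {x} + net E g ?s {y} = 0"
    using net_eq_sum[OF D(1), of E g ?s] net_whole[OF D(5), of ?s] Vz xy(2) by simp
  then have "3 dvd net E g ?s {y} - \<beta> y"
    using nx nz bsum by presburger
  then have "?s \<in> sol V z E g \<beta> \<sigma>0"
    using nx nz efz ef Vz by (auto simp: sol_def crossing_def)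
  then show ?thesis by blast
qed

text \<open>As \<open>d\<close> and \<open>\<tau>\<close> have the same parity,
  \<open>feasible\<close> without \<open>slack\<close> means
  \<open>d = 4 + \<bar>\<tau>\<bar>\<close>. The complement has the same cut and the opposite
  demand, so it meets the upper bound for a root with equality.\<close>

lemma sol_by_collapse:
  fixes E :: "'e set"
  assumes IH: "\<And>V (E :: 'e set) g \<beta> \<sigma>0. admissible feasible V z E g \<beta> \<sigma>0 \<Longrightarrow> size_of V z E g < n \<Longrightarrow>
      sol V z E g \<beta> \<sigma>0 \<noteq> {}"
    and adm: "admissible feasible V z E g \<beta> \<sigma>0" and n: "size_of V z E g \<le> n"
    and A: "A \<subset> V - {z}" "2 \<le> card A" "\<not> slack (cut_size E g A) (sum \<beta> A)"
  shows "sol V z E g \<beta> \<sigma>0 \<noteq> {}"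
proof -
  note D = admissibleD[OF adm]
  obtain a where a: "a \<in> A" using A(2) by fastforce
  have A': "A \<subseteq> V - {z}" "A \<subseteq> V" using A by auto
  have c: "2 \<le> card (V - A)" using card_compl_ge_2[OF A(1) D(2,1)] .
  have eq: "V - (V - A) = A" using A' by auto
  obtain \<sigma> where \<sigma>: "\<sigma> \<in> sol (insert a (V - A)) z (outer E g A) (relabel (collapse A a) g)
      (\<beta>(a := sum \<beta> A)) \<sigma>0"
    using IH[OF admissible_collapse[OF adm A'(1) a c]]
      size_of_collapse[OF D(1,4,5) A'(1) a A(2) D(2)] n by fastforce
  note N = net_collapse_sol[OF D(1,4,5) A'(1) a \<sigma>]
  show ?thesis
  proof (rule sol_by_merge[where Q = feasible and C = "V - A" and F = "{}" and \<rho> = \<sigma>, OF IH D(1,4,5,6) n])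
    have "feasible (cut_size E g A) (sum \<beta> A)" using D(9) A a by auto
    moreover have "3 dvd sum \<beta> (V - A) + sum \<beta> A" using sum_compl_dvd[OF D(6) A'(2) D(1)] .
    ultimately have "root_feasible (cut_size E g A) (sum \<beta> (V - A))"
      using A(3) unfolding feasible_def slack_def root_feasible_def by presburger
    then show "root_feasible (cut_size (E - {}) g (V - A)) (sum \<beta> (V - A) - net {} g \<sigma> (V - A))"
      using cut_size_compl[OF D(5)] by simp
    show "V - A \<noteq> {z} \<or> (\<exists>v\<in>V - {z}. cut_size {} g {v} \<noteq> 0)" using c by auto
    show "feasible (cut_size (E - {}) g B) (sum \<beta> B - net {} g \<sigma> B)" if "B \<noteq> {}" "B \<subset> V - (V - A)" for B
      using D(9)[of B] that A unfolding eq by auto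
  qed (use A c N D(2) in \<open>auto simp: eq\<close>)
qed

text \<open>The edge is deleted with the direction from \<open>x\<close> to \<open>y\<close>. Sets
  with at least two vertices are slack and can lose an edge in either direction, so only
  \<open>x\<close> and \<open>y\<close> themselves impose conditions.\<close>

lemma sol_by_deletion:
  fixes E :: "'e set"
  assumes IH: "\<And>V (E :: 'e set) g \<beta> \<sigma>0. admissible feasible V z E g \<beta> \<sigma>0 \<Longrightarrow> size_of V z E g < n \<Longrightarrow>
      sol V z E g \<beta> \<sigma>0 \<noteq> {}"
    and adm: "admissible feasible V z E g \<beta> \<sigma>0" and n: "size_of V z E g \<le> n"
    and slack: "\<And>A. A \<subset> V - {z} \<Longrightarrow> 2 \<le> card A \<Longrightarrow> slack (cut_size E g A) (sum \<beta> A)"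
    and e: "e \<in> E" "g e = (x, y) \<or> g e = (y, x)" "x \<noteq> y" "x \<noteq> z" "y \<noteq> z"
    and x: "feasible (cut_size E g {x} - 1) (\<beta> x - 1)" and y: "feasible (cut_size E g {y} - 1) (\<beta> y + 1)"
  shows "sol V z E g \<beta> \<sigma>0 \<noteq> {}"
proof -
  note D = admissibleD[OF adm]
  define \<rho> where "\<rho> = \<sigma>0(e := (g e = (x, y)))"
  have xyV: "x \<in> V" "y \<in> V" using e D(5) by auto
  have net: "net {e} g \<rho> A = of_bool (x \<in> A) - of_bool (y \<in> A)" for A
    using e by (auto simp: net_def outflow_def \<rho>_def)
  have dgA: "cut_size E g A = cut_size (E - {e}) g A + of_bool ((x \<in> A) \<noteq> (y \<in> A))" for A
    using cut_size_insert[of "E - {e}" e g A] e D(4) by (auto simp: insert_absorb)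
  have root: "\<not> meets g z e" using e by (auto simp: meets_def)
  have netz: "net E g \<rho> {z} = net E g \<sigma>0 {z}"
    by (rule net_cong[OF D(4)]) (use root in \<open>auto simp: crossing_def meets_def \<rho>_def\<close>)
  show ?thesis
  proof (rule sol_by_merge[where Q = feasible and C = "{z}" and F = "{e}" and \<rho> = \<rho>, OF IH D(1,4,5,6) n])
    show "root_feasible (cut_size (E - {e}) g {z}) (sum \<beta> {z} - net {e} g \<rho> {z})"
      using D(8) dgA[of "{z}"] e net[of "{z}"] by simp
    show "3 dvd net E g \<rho> {v} - \<beta> v" if "v \<in> {z}" for v using that netz D(7) by simp
    show "\<rho> h = \<sigma>0 h" if "meets g z h" for h using that root by (auto simp: \<rho>_def)
    show "{z} \<noteq> {z} \<or> (\<exists>v\<in>V - {z}. cut_size {e} g {v} \<noteq> 0)"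
      proof (intro disjI2 bexI[of _ x])
      have "fst (g e) = x \<and> snd (g e) = y \<or> fst (g e) = y \<and> snd (g e) = x" using e(2) by auto
      then have "crossing {e} g {x} = {e}" using e(3) by (auto simp: crossing_def)
      then show "cut_size {e} g {x} \<noteq> 0" by (simp add: cut_size_def)
    qed (use xyV e in auto)
    show "feasible (cut_size (E - {e}) g A) (sum \<beta> A - net {e} g \<rho> A)" if A: "A \<noteq> {}" "A \<subset> V - {z}" for A
    proof -
      have "finite A" using A D finite_subset by blast
      from this A(1) show ?thesis
      proof (rule singleton_or_card_ge_2)
        assume "2 \<le> card A"
        from slack[OF A(2) this] D(9)[OF A] show ?thesis
          using slack_minus1[of "cut_size (E - {e}) g A" "sum \<beta> A"] dgA[of A] net[of A]
          by (cases "x \<in> A"; cases "y \<in> A") auto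
      next
        fix v assume v: "A = {v}"
        have "feasible (cut_size E g {v}) (\<beta> v)" using D(9)[OF A] v by simp
        then show ?thesis
          using x y dgA[of "{v}"] net[of "{v}"] e(3) unfolding v
          by (cases "v = x"; cases "v = y") auto
      qed
    qed
  qed (use D(2,3,1) e(1) in \<open>auto\<close>)
qed

text \<open>\<open>S\<close> and its complement in \<open>V - {z}\<close> have at least 4 edges each
  in their cuts, but at most 7 edges go to the root.\<close>

lemma crossing_between:
  assumes adm: "admissible feasible V z E g \<beta> \<sigma>0"
    and S: "S \<subseteq> V - {z}" "S \<noteq> {}" "S \<noteq> V - {z}"
  obtains e where "e \<in> E"
    "fst (g e) \<in> S \<and> snd (g e) \<in> V - {z} - S \<or> snd (g e) \<in> S \<and> fst (g e) \<in> V - {z} - S"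
proof -
  note D = admissibleD[OF adm]
  let ?T = "V - {z} - S"
  have "4 \<le> cut_size E g S" "4 \<le> cut_size E g ?T"
    using D(9)[of S] D(9)[of ?T] S feasible_ge_4 by blast+
  moreover have "cut_size E g S + cut_size E g ?T = cut_size E g {z} + 2 * card (crossing E g S \<inter> crossing E g ?T)"
    using cut_size_Un[OF D(4), of S ?T g] cut_size_compl[OF D(5), of "{z}"] S by (simp add: Un_absorb1)
  ultimately have "card (crossing E g S \<inter> crossing E g ?T) \<noteq> 0"
    using root_feasible_le_7[OF D(8)] by linarith
  then obtain e where "e \<in> crossing E g S \<inter> crossing E g ?T"
    by (metis card.empty ex_in_conv)
  then show ?thesis using that by (auto simp: crossing_def)
qed

subsection \<open>Lifting two edges at a vertex\<close>

definition other :: "('e \<Rightarrow> 'v \<times> 'v) \<Rightarrow> 'v \<Rightarrow> 'e \<Rightarrow> 'v" where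
  "other g x e = (if fst (g e) = x then snd (g e) else fst (g e))"

definition move :: "('e \<Rightarrow> 'v \<times> 'v) \<Rightarrow> 'v \<Rightarrow> 'e \<Rightarrow> 'v \<Rightarrow> 'e \<Rightarrow> 'v \<times> 'v" where
  "move g x e w = g(e := if fst (g e) = x then (w, snd (g e)) else (fst (g e), w))"

text \<open>
  The lift of \<open>e\<close> and \<open>f\<close> at their common end \<open>x\<close> reuses \<open>e\<close> for the new edge and deletes \<open>f\<close>.
\<close>

abbreviation lift :: "('e \<Rightarrow> 'v \<times> 'v) \<Rightarrow> 'v \<Rightarrow> 'e \<Rightarrow> 'e \<Rightarrow> 'e \<Rightarrow> 'v \<times> 'v" where
  "lift g x e f \<equiv> move g x e (other g x f)"

lemma cut_size_move_others: "e \<notin> E \<Longrightarrow> cut_size E (move g x e w) A = cut_size E g A"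
  by (auto simp: cut_size_def crossing_def move_def intro!: arg_cong[of _ _ card])

lemma net_move_others: "e \<notin> E \<Longrightarrow> net E (move g x e w) \<sigma> A = net E g \<sigma> A"
  by (auto simp: net_def outflow_def move_def intro!: sum.cong)

lemma cut_size_lift:
  assumes "finite E" "e \<in> E" "f \<in> E" "e \<noteq> f" "meets g x e" "meets g x f"
    "other g x e \<noteq> x" "other g x f \<noteq> x"
  shows "cut_size E g A = cut_size (E - {f}) (lift g x e f) A +
    (if (other g x e \<in> A) = (other g x f \<in> A) \<and> (x \<in> A) \<noteq> (other g x e \<in> A) then 2 else 0)"
proof -
  have 1: "E = insert e (insert f (E - {e, f}))" "E - {f} = insert e (E - {e, f})"
    using assms by auto
  have "cut_size E g A = cut_size (E - {e, f}) g A
      + of_bool ((fst (g f) \<in> A) \<noteq> (snd (g f) \<in> A)) + of_bool ((fst (g e) \<in> A) \<noteq> (snd (g e) \<in> A))"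
    using assms by (subst 1(1)) (simp add: cut_size_insert)
  moreover have "cut_size (E - {f}) (lift g x e f) A = cut_size (E - {e, f}) g A
      + of_bool ((fst (lift g x e f e) \<in> A) \<noteq> (snd (lift g x e f e) \<in> A))"
    using assms by (subst 1(2)) (simp add: cut_size_insert cut_size_move_others)
  ultimately show ?thesis
    using assms by (auto simp: other_def meets_def move_def split: if_splits)
qed

text \<open>The condition on \<open>\<sigma> f\<close> says that one of \<open>e\<close>,
  \<open>f\<close> enters \<open>x\<close> and the other leaves it, so that together they act like
  the lifted edge.\<close>

lemma net_lift:
  assumes "finite E" "e \<in> E" "f \<in> E" "e \<noteq> f" "meets g x e" "meets g x f"
    "other g x e \<noteq> x" "other g x f \<noteq> x"
    and "\<sigma> f = (\<sigma> e = ((fst (g e) = x) \<noteq> (fst (g f) = x)))"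
  shows "net (E - {f}) (lift g x e f) \<sigma> A = net E g \<sigma> A"
proof -
  have 1: "E = insert e (insert f (E - {e, f}))" "E - {f} = insert e (E - {e, f})"
    using assms by auto
  have "net E g \<sigma> A = net (E - {e, f}) g \<sigma> A + outflow g \<sigma> A f + outflow g \<sigma> A e"
    using assms by (subst 1(1)) (simp add: net_insert)
  moreover have "net (E - {f}) (lift g x e f) \<sigma> A = net (E - {e, f}) g \<sigma> A + outflow (lift g x e f) \<sigma> A e"
    using assms by (subst 1(2)) (simp add: net_insert net_move_others)
  ultimately show ?thesis
    using assms by (auto simp: other_def meets_def move_def outflow_def split: if_splits)
qed

lemma net_lift_root:
  assumes "finite E" "e \<in> E" "f \<in> E" "e \<noteq> f" "meets g x e" "meets g x f"
    "other g x e \<noteq> x" "other g x f \<noteq> x" "x \<noteq> z" "other g x f \<noteq> z"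
  shows "net (E - {f}) (lift g x e f) \<sigma> {z} = net E g \<sigma> {z}"
proof -
  let ?\<sigma> = "\<sigma>(f := (\<sigma> e = ((fst (g e) = x) \<noteq> (fst (g f) = x))))"
  have "net (E - {f}) (lift g x e f) ?\<sigma> {z} = net E g ?\<sigma> {z}"
    by (rule net_lift) (use assms in auto)
  moreover have "net (E - {f}) (lift g x e f) ?\<sigma> {z} = net (E - {f}) (lift g x e f) \<sigma> {z}"
    by (rule net_cong) (use assms in \<open>auto simp: crossing_def\<close>)
  moreover have "net E g ?\<sigma> {z} = net E g \<sigma> {z}"
    by (rule net_cong)
      (use assms in \<open>auto simp: crossing_def other_def meets_def split: if_splits\<close>)
  ultimately show ?thesis by simp
qed

text \<open>The deleted edge \<open>f\<close> must not end at the root, as its prescribed direction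
  would be lost; \<open>e\<close> may, because it keeps its name. The second conclusion records that
  exactly one of the two edges leaves \<open>x\<close>.\<close>

lemma sol_lift:
  assumes "finite E" "e \<in> E" "f \<in> E" "e \<noteq> f" "meets g x e" "meets g x f"
    "other g x e \<noteq> x" "other g x f \<noteq> x" "x \<noteq> z" "other g x f \<noteq> z"
    and \<sigma>: "\<sigma> \<in> sol V z (E - {f}) (lift g x e f) \<beta> \<sigma>0"
  obtains \<sigma>' where "\<sigma>' \<in> sol V z E g \<beta> \<sigma>0" "outflow g \<sigma>' {x} e + outflow g \<sigma>' {x} f = 0"
proof
  define \<tau> where "\<tau> = \<sigma>(f := (\<sigma> e = ((fst (g e) = x) \<noteq> (fst (g f) = x))))"
  have net1: "net (E - {f}) (lift g x e f) \<tau> A = net E g \<tau> A" for A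
    by (rule net_lift) (use assms in \<open>auto simp: \<tau>_def\<close>)
  have "net (E - {f}) (lift g x e f) \<tau> A = net (E - {f}) (lift g x e f) \<sigma> A" for A
    by (rule net_cong) (use assms in \<open>auto simp: crossing_def \<tau>_def\<close>)
  then have net: "net E g \<tau> A = net (E - {f}) (lift g x e f) \<sigma> A" for A
    using net1 by simp
  have "\<tau> h = \<sigma>0 h" if h: "h \<in> E" "meets g z h" for h
  proof -
    have "h \<noteq> f" using h assms by (auto simp: meets_def other_def split: if_splits)
    moreover have "meets (lift g x e f) z h"
      using h assms by (auto simp: meets_def move_def)
    ultimately show ?thesis using \<sigma> h by (auto simp: sol_def \<tau>_def)
  qed
  moreover have "\<tau> \<in> E \<rightarrow>\<^sub>E UNIV"
    using \<sigma> assms(3) by (auto simp: sol_def PiE_def extensional_def \<tau>_def)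
  ultimately show "\<tau> \<in> sol V z E g \<beta> \<sigma>0"
    using \<sigma> by (auto simp: sol_def net)
  show "outflow g \<tau> {x} e + outflow g \<tau> {x} f = 0"
    using assms by (auto simp: \<tau>_def outflow_def meets_def other_def split: if_splits)
qed

text \<open>The pairs \<open>e1\<close>, \<open>e2\<close> and \<open>e3\<close>, \<open>e4\<close>
  are to be lifted. A pair with a common far end becomes a loop and costs that vertex two edges,
  which is tolerable only if a third edge goes there. If pairing \<open>a\<close> with
  \<open>b\<close> and \<open>c\<close> with \<open>d\<close> violates this, then pairing
  \<open>a\<close> with \<open>c\<close> and \<open>b\<close> with \<open>d\<close> creates no loop
  at all. A pair with both far ends at \<open>z\<close> would bring a third one there, so each pair
  has an edge avoiding \<open>z\<close> that can be the deleted one.\<close>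

lemma pairing_exists:
  fixes h :: "'e \<Rightarrow> 'v"
  assumes "card X = 4" "card {e \<in> X. h e = z} \<le> 2"
  obtains e1 e2 e3 e4 where "X = {e1, e2, e3, e4}" "distinct [e1, e2, e3, e4]"
    "h e2 \<noteq> z" "h e4 \<noteq> z"
    "h e1 = h e2 \<Longrightarrow> h e3 = h e1 \<or> h e4 = h e1" "h e3 = h e4 \<Longrightarrow> h e1 = h e3 \<or> h e2 = h e3"
proof -
  obtain a b c d where X: "X = {a, b, c, d}" "distinct [a, b, c, d]"
  proof -
    have "card X = Suc (Suc (Suc (Suc 0)))" using assms(1) by simp
    then show ?thesis using that unfolding card_Suc_eq by fastforce
  qed
  have three: "\<not> (h p = z \<and> h q = z \<and> h r = z)" if "distinct [p, q, r]" "{p, q, r} \<subseteq> X" for p q r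
  proof
    assume "h p = z \<and> h q = z \<and> h r = z"
    then have "{p, q, r} \<subseteq> {e \<in> X. h e = z}" using that by auto
    moreover have "finite X" using X by simp
    ultimately have "card {p, q, r} \<le> card {e \<in> X. h e = z}" by (intro card_mono) auto
    then show False using assms(2) that by simp
  qed
  have "\<exists>e1 e2 e3 e4. X = {e1, e2, e3, e4} \<and> distinct [e1, e2, e3, e4] \<and>
    (h e1 = h e2 \<longrightarrow> h e3 = h e1 \<or> h e4 = h e1) \<and> (h e3 = h e4 \<longrightarrow> h e1 = h e3 \<or> h e2 = h e3)"
  proof (cases "(h a = h b \<longrightarrow> h c = h a \<or> h d = h a) \<and> (h c = h d \<longrightarrow> h a = h c \<or> h b = h c)")
    case True
    then show ?thesis using X by blast
  next
    case False
    then have "h a \<noteq> h c" "h b \<noteq> h d" by metis+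
    moreover have "X = {a, c, b, d}" "distinct [a, c, b, d]" using X by auto
    ultimately show ?thesis by blast
  qed
  then obtain e1 e2 e3 e4 where e: "X = {e1, e2, e3, e4}" "distinct [e1, e2, e3, e4]"
    "h e1 = h e2 \<Longrightarrow> h e3 = h e1 \<or> h e4 = h e1" "h e3 = h e4 \<Longrightarrow> h e1 = h e3 \<or> h e2 = h e3"
    by blast
  have nz: "h e1 \<noteq> z \<or> h e2 \<noteq> z" "h e3 \<noteq> z \<or> h e4 \<noteq> z"
    using e three[of e1 e2 e3] three[of e1 e2 e4] three[of e3 e4 e1] three[of e3 e4 e2] by auto
  define p where "p = (if h e2 = z then (e2, e1) else (e1, e2))"
  define q where "q = (if h e4 = z then (e4, e3) else (e3, e4))"
  show ?thesis
    by (rule that[of "fst p" "snd p" "fst q" "snd q"])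
      (use e nz in \<open>auto simp: p_def q_def\<close>)
qed

lemma other_move: "e' \<noteq> e \<Longrightarrow> other (move g x e w) x e' = other g x e'"
  by (simp add: other_def move_def)

lemma meets_move: "e' \<noteq> e \<Longrightarrow> meets (move g x e w) y e' = meets g y e'"
  by (simp add: meets_def move_def)

lemma wf_lift:
  assumes "\<forall>e\<in>E. fst (g e) \<in> V \<and> snd (g e) \<in> V" "e \<in> E" "f \<in> E"
  shows "\<forall>e'\<in>E - {f}. fst (lift g x e f e') \<in> V \<and> snd (lift g x e f e') \<in> V"
  using assms by (auto simp: move_def other_def)

text \<open>Net 0 at \<open>x\<close> suits its demand, so its four edges may be lifted in pairs.
  This isolates \<open>x\<close>, which is then merged into the root to make the measure
  drop.\<close>

lemma sol_by_degree_4: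
  fixes E :: "'e set"
  assumes IH: "\<And>V (E :: 'e set) g \<beta> \<sigma>0. admissible feasible V z E g \<beta> \<sigma>0 \<Longrightarrow> size_of V z E g < n \<Longrightarrow>
      sol V z E g \<beta> \<sigma>0 \<noteq> {}"
    and adm: "admissible feasible V z E g \<beta> \<sigma>0" and n: "size_of V z E g \<le> n"
    and slack: "\<And>A. A \<subset> V - {z} \<Longrightarrow> 2 \<le> card A \<Longrightarrow> slack (cut_size E g A) (sum \<beta> A)"
    and V4: "card V \<noteq> 3" and x: "x \<in> V" "x \<noteq> z" "cut_size E g {x} = 4" "3 dvd \<beta> x"
  shows "sol V z E g \<beta> \<sigma>0 \<noteq> {}"
proof -
  note D = admissibleD[OF adm]
  let ?X = "crossing E g {x}" and ?h = "other g x"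
  have cX: "card ?X = 4" using x by (simp add: cut_size_def)
  have hX: "meets g x e" "?h e \<noteq> x" "e \<in> E" "?h e \<in> V" if "e \<in> ?X" for e
    using that D(5) by (auto simp: crossing_def meets_def other_def)
  have Un: "cut_size E g A + 4 = cut_size E g (insert x A) + 2 * card {e \<in> ?X. ?h e \<in> A}" if "x \<notin> A" for A
  proof -
    have "crossing E g A \<inter> ?X = {e \<in> ?X. ?h e \<in> A}"
      using that by (auto simp: crossing_def other_def)
    then show ?thesis using cut_size_Un[OF D(4), of A "{x}" g] that x by simp
  qed
  \<comment> \<open>The cut of \<open>{z, x}\<close> is that of a slack set, hence at least 6, while
    the root has at most 7 edges and \<open>x\<close> has 4.\<close>
  have "card {e \<in> ?X. ?h e = z} \<le> 2"
  proof -
    let ?B = "V - {z} - {x}"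
    have "card ?B \<noteq> 0" "card ?B \<noteq> 1" using D x V4 by auto
    then have "slack (cut_size E g ?B) (sum \<beta> ?B)" using x by (intro slack) auto
    moreover have "cut_size E g ?B = cut_size E g (insert x {z})"
      using cut_size_compl[OF D(5), of "{z, x}"] by (simp add: insert_commute Diff_insert2[symmetric])
    ultimately show ?thesis
      using Un[of "{z}"] x root_feasible_le_7[OF D(8)] by (auto simp: slack_def)
  qed
  then obtain e1 e2 e3 e4 where e: "?X = {e1, e2, e3, e4}" "distinct [e1, e2, e3, e4]"
    and h24: "?h e2 \<noteq> z" "?h e4 \<noteq> z"
    and eq12: "?h e1 = ?h e2 \<Longrightarrow> ?h e3 = ?h e1 \<or> ?h e4 = ?h e1"
    and eq34: "?h e3 = ?h e4 \<Longrightarrow> ?h e1 = ?h e3 \<or> ?h e2 = ?h e3"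
    using pairing_exists[OF cX, of ?h z] by blast
  have eX: "e1 \<in> ?X" "e2 \<in> ?X" "e3 \<in> ?X" "e4 \<in> ?X" using e by auto
  define g1 where "g1 = lift g x e1 e2"
  define E1 where "E1 = E - {e2}"
  define g2 where "g2 = lift g1 x e3 e4"
  define E2 where "E2 = E1 - {e4}"
  have h1: "other g1 x e3 = ?h e3" "other g1 x e4 = ?h e4" "meets g1 x e3" "meets g1 x e4"
    using e(2) hX(1)[OF eX(3)] hX(1)[OF eX(4)] by (auto simp: g1_def other_move meets_move)
  have l1: "finite E" "e1 \<in> E" "e2 \<in> E" "e1 \<noteq> e2" "meets g x e1" "meets g x e2" "?h e1 \<noteq> x" "?h e2 \<noteq> x"
    using hX eX e D by auto
  have l2: "finite E1" "e3 \<in> E1" "e4 \<in> E1" "e3 \<noteq> e4" "meets g1 x e3" "meets g1 x e4"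
    "other g1 x e3 \<noteq> x" "other g1 x e4 \<noteq> x"
    using hX eX e D h1 by (auto simp: E1_def)
  have dg1: "cut_size E g A = cut_size E1 g1 A +
    (if (?h e1 \<in> A) = (?h e2 \<in> A) \<and> (x \<in> A) \<noteq> (?h e1 \<in> A) then 2 else 0)" for A
    unfolding E1_def g1_def by (rule cut_size_lift[OF l1])
  have dg2: "cut_size E1 g1 A = cut_size E2 g2 A +
    (if (?h e3 \<in> A) = (?h e4 \<in> A) \<and> (x \<in> A) \<noteq> (?h e3 \<in> A) then 2 else 0)" for A
    using cut_size_lift[OF l2, of A] h1 unfolding E2_def g2_def by simp
  have wf1: "\<forall>e\<in>E1. fst (g1 e) \<in> V \<and> snd (g1 e) \<in> V"
    unfolding E1_def g1_def by (rule wf_lift) (use D l1 in auto)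
  have wf2: "\<forall>e\<in>E2. fst (g2 e) \<in> V \<and> snd (g2 e) \<in> V"
    unfolding E2_def g2_def by (rule wf_lift) (use wf1 l2 in auto)
  have netz: "net E2 g2 \<sigma>0 {z} = net E g \<sigma>0 {z}"
    using net_lift_root[OF l1 x(2) h24(1), of \<sigma>0] net_lift_root[OF l2 x(2), of \<sigma>0] h1 h24
    unfolding E1_def g1_def E2_def g2_def by simp
  have dgx: "cut_size E2 g2 {x} = 0" using dg1[of "{x}"] dg2[of "{x}"] hX eX x by auto
  have dgA: "cut_size E g A = cut_size E2 g2 A + (if ?h e1 \<in> A \<and> ?h e2 \<in> A then 2 else 0)
      + (if ?h e3 \<in> A \<and> ?h e4 \<in> A then 2 else 0)" if "x \<notin> A" for A
    using dg1[of A] dg2[of A] that by auto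
  have jA: "card {e \<in> ?X. ?h e \<in> A} = of_bool (?h e1 \<in> A) + of_bool (?h e2 \<in> A)
      + of_bool (?h e3 \<in> A) + of_bool (?h e4 \<in> A)" for A
  proof -
    have "card {e \<in> ?X. ?h e \<in> A} = (\<Sum>e\<in>?X. of_bool (?h e \<in> A))"
      using D(4) by (simp add: of_bool_def sum.If_cases Int_def)
    then show ?thesis unfolding e(1) using e(2) by (simp add: add.assoc)
  qed
  have mz: "(\<Sum>v\<in>V - {z}. cut_size E2 g2 {v}) \<le> (\<Sum>v\<in>V - {z}. cut_size E g {v})"
    by (rule sum_mono) (simp add: dg1 dg2)
  have finE2: "finite E2" using D by (simp add: E2_def E1_def)
  have "sol V z E2 g2 \<beta> \<sigma>0 \<noteq> {}"
  proof (rule sol_by_merge[where Q = feasible and C = "{z, x}" and F = "{}" and \<rho> = \<sigma>0,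
        OF IH D(1) finE2 wf2 D(6)])
    show "size_of V z E2 g2 \<le> n" using mz n by (simp add: size_of_def)
    have "card V \<ge> 4" using D(3) V4 by simp
    then show "2 \<le> card (V - {z, x})"
      using D x by (simp add: card_Diff_subset)
    show "3 dvd net E2 g2 \<sigma>0 {v} - \<beta> v" if "v \<in> {z, x}" for v
      using that D(7) netz net_eq_0[OF finE2 dgx] x(4) by auto
    have "cut_size E2 g2 {z, x} + 2 * card (crossing E2 g2 {z} \<inter> crossing E2 g2 {x}) = cut_size E2 g2 {z} + 0"
      using cut_size_Un[OF finE2, of "{z}" "{x}" g2] dgx x by (simp add: insert_commute)
    moreover have "crossing E2 g2 {x} = {}" using dgx finE2 by (simp add: cut_size_def)
    moreover have "cut_size E2 g2 {z} = cut_size E g {z}" using dgA[of "{z}"] h24 x by auto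
    ultimately have "cut_size E2 g2 {z, x} = cut_size E g {z}" by simp
    moreover have "root_feasible d (\<beta> z + \<beta> x) = root_feasible d (\<beta> z)" for d
      using x(4) by (simp add: root_feasible_def dvd_add_left_iff)
    ultimately show "root_feasible (cut_size (E2 - {}) g2 {z, x}) (sum \<beta> {z, x} - net {} g2 \<sigma>0 {z, x})"
      using D(8) x(2) by simp
    show "{z, x} \<noteq> {z} \<or> (\<exists>v\<in>V - {z}. cut_size {} g2 {v} \<noteq> 0)" using x by auto
    show "feasible (cut_size (E2 - {}) g2 A) (sum \<beta> A - net {} g2 \<sigma>0 A)"
      if A: "A \<noteq> {}" "A \<subset> V - {z, x}" for A
    proof -
      have A': "A \<subset> V - {z}" "x \<notin> A" "finite A" using A D(1) finite_subset[of A V] by auto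
      have okA: "feasible (cut_size E g A) (sum \<beta> A)" using D(9)[OF A(1) A'(1)] .
      have okxA: "feasible (cut_size E g (insert x A)) (sum \<beta> A)"
      proof -
        have "insert x A \<subset> V - {z}" using A x by auto
        then have "feasible (cut_size E g (insert x A)) (sum \<beta> (insert x A))" using D(9) by auto
        then show ?thesis
          using x(4) A' by (simp add: feasible_def dvd_add_right_iff)
      qed
      note U = Un[OF A'(2)] and dA = dgA[OF A'(2)]
      \<comment> \<open>If three or four edges of \<open>x\<close> go to \<open>A\<close>, the lifts
        leave exactly the cut of \<open>insert x A\<close>, whose demand is the same modulo 3.
        Otherwise at most one lifted edge falls inside \<open>A\<close>. Slackness covers this loss
        of two, and the choice of the pairs excludes it for a single vertex.\<close>
      show ?thesis
      proof (cases "3 \<le> card {e \<in> ?X. ?h e \<in> A}")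
        case True
        then have "cut_size E2 g2 A = cut_size E g (insert x A)"
          using U dA unfolding jA of_bool_def by (auto split: if_splits)
        then show ?thesis using okxA by simp
      next
        case False
        show ?thesis
        proof (cases "(?h e1 \<in> A \<and> ?h e2 \<in> A) \<or> (?h e3 \<in> A \<and> ?h e4 \<in> A)")
          case True
          then have "cut_size E g A = cut_size E2 g2 A + 2" using dA False unfolding jA by (auto split: if_splits)
          moreover have "2 \<le> card A"
          proof (rule singleton_or_card_ge_2[OF A'(3) A(1)])
            fix v assume "A = {v}"
            then show ?thesis using True False eq12 eq34 unfolding jA by (auto split: if_splits)
          qed
          then have "slack (cut_size E g A) (sum \<beta> A)" using slack A' by auto
          ultimately show ?thesis using slack_minus2 by simp
        next
          case False
          then have "cut_size E g A = cut_size E2 g2 A" using dA by simp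
          then show ?thesis using okA by simp
        qed
      qed
    qed
  qed (use D x in auto)
  then obtain \<sigma> where "\<sigma> \<in> sol V z E2 g2 \<beta> \<sigma>0" by blast
  then obtain \<sigma>' where "\<sigma>' \<in> sol V z E1 g1 \<beta> \<sigma>0"
    using sol_lift[OF l2 x(2), of \<sigma> V \<beta> \<sigma>0] h24 h1 unfolding E2_def g2_def by auto
  then show ?thesis
    using sol_lift[OF l1 x(2) h24(1), of \<sigma>' V \<beta> \<sigma>0] unfolding E1_def g1_def by auto
qed

subsection \<open>The case where every vertex can afford an outgoing edge\<close>

text \<open>This is \<open>d = 4 + \<tau>\<close> with \<open>\<tau>\<close> equal to 1 or 2: what
  remains for a vertex that cannot lose an incoming edge, once degree 4 with demand 0 is
  excluded.\<close>

definition out_type :: "nat \<Rightarrow> int \<Rightarrow> bool" where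
  "out_type d b \<longleftrightarrow> d = 5 \<and> 3 dvd b - 1 \<or> d = 6 \<and> 3 dvd b - 2"

lemma out_type_minus1: "out_type (d + 1) b \<Longrightarrow> feasible d (b - 1)"
  unfolding out_type_def feasible_def by presburger

lemma root_feasible_minus1: "root_feasible (d + 1) b \<Longrightarrow> root_feasible d (b + 1)"
  unfolding root_feasible_def by presburger

lemma almost_tight_root_feasible:
  "3 dvd c + b \<Longrightarrow> m = -1 \<Longrightarrow> d' = d + 1 \<Longrightarrow> d' = 6 \<and> 3 dvd b \<or> d' = 7 \<and> 3 dvd b - 2 \<Longrightarrow>
    root_feasible d (c - m)"
  unfolding root_feasible_def by presburger

text \<open>When all edges leave the root, its degree and demand agree modulo 3. Then 6 edges would
  come with demand 0 and 7 edges with demand 1, and neither is allowed.\<close>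

lemma root_feasible_out_le_5: "3 dvd int d - b \<Longrightarrow> root_feasible d b \<Longrightarrow> d \<le> 5"
  unfolding root_feasible_def by presburger

text \<open>A locale because the case occurs twice: when no vertex can lose an outgoing edge,
  negating the demands and reversing the prescribed directions leads back to it.\<close>

locale all_out =
  fixes V :: "'v set" and z :: 'v and E :: "'e set" and g \<beta> \<sigma>0 and n :: nat
  assumes IH: "\<And>V (E :: 'e set) g \<beta> \<sigma>0. admissible feasible V z E g \<beta> \<sigma>0 \<Longrightarrow>
      size_of V z E g < n \<Longrightarrow> sol V z E g \<beta> \<sigma>0 \<noteq> {}"
    and adm: "admissible feasible V z E g \<beta> \<sigma>0" and n: "size_of V z E g \<le> n"
    and slack: "\<And>A. A \<subset> V - {z} \<Longrightarrow> 2 \<le> card A \<Longrightarrow> slack (cut_size E g A) (sum \<beta> A)"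
    and card_V: "4 \<le> card V"
    and out: "\<And>v. v \<in> V - {z} \<Longrightarrow> out_type (cut_size E g {v}) (\<beta> v)"
begin

lemmas D = admissibleD[OF adm]

lemma finite_sub: "A \<subseteq> V \<Longrightarrow> finite A"
  using D(1) finite_subset by blast

text \<open>For a single vertex this comes from \<open>out_type\<close>, for larger sets from
  slackness. In deletions, care is then needed only for sets that a deleted edge enters or that lose
  two edges.\<close>

lemma feasible_minus1:
  assumes "A \<noteq> {}" "A \<subset> V - {z}" "cut_size E g A = d + 1"
  shows "feasible d (sum \<beta> A - 1)"
proof -
  have "finite A" using assms by (intro finite_sub) auto
  from this assms(1) show ?thesis
  proof (rule singleton_or_card_ge_2)
    fix v assume "A = {v}"
    then show ?thesis using out_type_minus1[of d "\<beta> v"] out[of v] assms by auto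
  next
    assume "2 \<le> card A"
    then show ?thesis using slack_minus1[of d] slack[OF assms(2)] assms(3) by auto
  qed
qed

text \<open>The edge leaves its other end \<open>x\<close>, and every set around \<open>x\<close>
  can afford that loss. The root loses an incoming edge, which keeps it feasible.\<close>

lemma sol_if_edge_into_root:
  assumes e: "e \<in> E" "outflow g \<sigma>0 {z} e = -1"
  shows "sol V z E g \<beta> \<sigma>0 \<noteq> {}"
proof -
  define x where "x = other g z e"
  have x: "x \<in> V - {z}" using e D(5) by (auto simp: x_def other_def outflow_def of_bool_def split: if_splits)
  have o: "outflow g \<sigma>0 A e = of_bool (x \<in> A) - of_bool (z \<in> A)" for A
    using e by (auto simp: x_def other_def outflow_def of_bool_def split: if_splits)
  have ends: "(fst (g e) \<in> A) \<noteq> (snd (g e) \<in> A) \<longleftrightarrow> (x \<in> A) \<noteq> (z \<in> A)" for A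
    using e by (auto simp: x_def other_def outflow_def of_bool_def split: if_splits)
  have net: "net {e} g \<sigma>0 A = of_bool (x \<in> A) - of_bool (z \<in> A)" for A by (simp add: net_def o)
  have dgA: "cut_size E g A = cut_size (E - {e}) g A + of_bool ((x \<in> A) \<noteq> (z \<in> A))" for A
  proof -
    have "cut_size E g A = cut_size (E - {e}) g A + of_bool ((fst (g e) \<in> A) \<noteq> (snd (g e) \<in> A))"
      using cut_size_insert[of "E - {e}" e g A] e D(4) by (simp add: insert_absorb)
    then show ?thesis unfolding ends .
  qed
  show ?thesis
  proof (rule sol_by_merge[where Q = feasible and C = "{z}" and F = "{e}" and \<rho> = \<sigma>0, OF IH D(1,4,5,6) n])
    show "root_feasible (cut_size (E - {e}) g {z}) (sum \<beta> {z} - net {e} g \<sigma>0 {z})"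
      using root_feasible_minus1[of "cut_size (E - {e}) g {z}" "\<beta> z"] D(8) dgA[of "{z}"] net[of "{z}"] x by simp
    show "{z} \<noteq> {z} \<or> (\<exists>v\<in>V - {z}. cut_size {e} g {v} \<noteq> 0)"
    proof (intro disjI2 bexI[of _ x])
      have "crossing {e} g {x} = {e}" using ends[of "{x}"] x by (auto simp: crossing_def)
      then show "cut_size {e} g {x} \<noteq> 0" by (simp add: cut_size_def)
    qed (use x in auto)
    show "feasible (cut_size (E - {e}) g A) (sum \<beta> A - net {e} g \<sigma>0 A)" if A: "A \<noteq> {}" "A \<subset> V - {z}" for A
      using feasible_minus1[OF A, of "cut_size (E - {e}) g A"] D(9)[OF A] dgA[of A] net[of A] A
      by (cases "x \<in> A") auto
  qed (use D(1,2,3,7) e(1) in auto)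
qed

lemma sol_if_small_root:
  assumes small: "cut_size E g {z} \<le> 4"
  shows "sol V z E g \<beta> \<sigma>0 \<noteq> {}"
  \<comment> \<open>some edge \<open>xy\<close> is directed from \<open>x\<close> to \<open>y\<close> by moving its end \<open>x\<close> to the root\<close>
proof -
  have "V - {z} \<noteq> {}"
  proof
    assume "V - {z} = {}"
    then have "V \<subseteq> {z}" by auto
    then have "card V \<le> 1" using card_mono[of "{z}" V] by simp
    then show False using card_V by simp
  qed
  then obtain x where x: "x \<in> V" "x \<noteq> z" by auto
  \<comment> \<open>The root has at most 4 edges and \<open>x\<close> at least 5, so some edge of
    \<open>x\<close> avoids the root.\<close>
  have "\<not> crossing E g {x} \<subseteq> crossing E g {z}"
  proof
    assume "crossing E g {x} \<subseteq> crossing E g {z}"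
    then have "cut_size E g {x} \<le> cut_size E g {z}" unfolding cut_size_def by (intro card_mono) (use D in auto)
    then show False using out[of x] x small by (auto simp: out_type_def)
  qed
  then obtain e where e0: "e \<in> crossing E g {x}" "e \<notin> crossing E g {z}" by auto
  define y where "y = other g x e"
  have e: "e \<in> E" "fst (g e) = x \<and> snd (g e) = y \<or> fst (g e) = y \<and> snd (g e) = x"
      "y \<in> V" "y \<noteq> x" "y \<noteq> z"
    using e0 D(5) x by (auto simp: crossing_def y_def other_def)
  define g' where "g' = move g x e z"
  define \<sigma>1 where "\<sigma>1 = \<sigma>0(e := (fst (g' e) = z))"
  \<comment> \<open>The moved edge leaves the root instead of \<open>x\<close>, which shifts one
    unit of demand from \<open>x\<close> to the root.\<close>
  define \<beta>' where "\<beta>' = (\<lambda>v. \<beta> v - of_bool (v = x) + of_bool (v = z))"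
  have E: "E = insert e (E - {e})" using e by auto
  have ends': "fst (g' e) = z \<and> snd (g' e) = y \<or> fst (g' e) = y \<and> snd (g' e) = z"
    using e by (auto simp: g'_def move_def)
  have dg': "cut_size E g' A = cut_size (E - {e}) g A + of_bool ((z \<in> A) \<noteq> (y \<in> A))" for A
  proof -
    have "cut_size E g' A = cut_size (E - {e}) g' A + of_bool ((fst (g' e) \<in> A) \<noteq> (snd (g' e) \<in> A))"
      by (subst E, rule cut_size_insert) (use D in auto)
    then show ?thesis using ends' by (auto simp: cut_size_move_others g'_def)
  qed
  have dgA: "cut_size E g A = cut_size (E - {e}) g A + of_bool ((x \<in> A) \<noteq> (y \<in> A))" for A
  proof -
    have "cut_size E g A = cut_size (E - {e}) g A + of_bool ((fst (g e) \<in> A) \<noteq> (snd (g e) \<in> A))"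
      by (subst E, rule cut_size_insert) (use D in auto)
    then show ?thesis using e by auto
  qed
  have net': "net E g' \<sigma> A = net E g \<sigma> A - of_bool (x \<in> A) + of_bool (z \<in> A)"
    if "\<sigma> e = (fst (g' e) = z)" for \<sigma> A
  proof -
    have "net E g' \<sigma> A = net (E - {e}) g' \<sigma> A + outflow g' \<sigma> A e"
      by (subst E, rule net_insert) (use D in auto)
    moreover have "net E g \<sigma> A = net (E - {e}) g \<sigma> A + outflow g \<sigma> A e"
      by (subst E, rule net_insert) (use D in auto)
    moreover have "outflow g' \<sigma> A e = of_bool (z \<in> A) - of_bool (y \<in> A)"
      using ends' that e by (auto simp: outflow_def)
    moreover have "outflow g \<sigma> A e = of_bool (x \<in> A) - of_bool (y \<in> A)"
      using ends' that e x by (auto simp: outflow_def g'_def move_def)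
    ultimately show ?thesis by (simp add: net_move_others g'_def)
  qed
  have \<sigma>1: "\<sigma>1 e = (fst (g' e) = z)" by (simp add: \<sigma>1_def)
  have netz: "net E g \<sigma>1 {z} = net E g \<sigma>0 {z}"
    by (rule net_cong) (use D e0 in \<open>auto simp: \<sigma>1_def\<close>)
  have sum': "sum \<beta>' A = sum \<beta> A - of_bool (x \<in> A) + of_bool (z \<in> A)" if "finite A" for A
    using that by (simp add: \<beta>'_def sum.distrib sum_subtractf of_bool_def sum.delta')
  have "admissible feasible V z E g' \<beta>' \<sigma>1"
    unfolding admissible_def
  proof (intro conjI allI impI)
    show "\<forall>e\<in>E. fst (g' e) \<in> V \<and> snd (g' e) \<in> V"
      using D by (auto simp: g'_def move_def)
    show "3 dvd sum \<beta>' V" using sum'[OF D(1)] D x by simp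
    show "3 dvd net E g' \<sigma>1 {z} - \<beta>' z"
      using net'[of \<sigma>1 "{z}", OF \<sigma>1] netz D(7) x by (simp add: \<beta>'_def)
    \<comment> \<open>The root gains one edge, and with up to 5 edges it is feasible for every
      demand.\<close>
    show "root_feasible (cut_size E g' {z}) (\<beta>' z)"
      using dg'[of "{z}"] dgA[of "{z}"] small by (simp add: root_feasible_def)
    fix A assume A: "A \<noteq> {}" "A \<subset> V - {z}"
    then have A': "finite A" "z \<notin> A" by (auto intro!: finite_sub)
    have okA: "feasible (cut_size E g A) (sum \<beta> A)" using D(9)[OF A] .
    show "feasible (cut_size E g' A) (sum \<beta>' A)"
    proof (cases "x \<in> A")
      case True
      show ?thesis
      proof (cases "y \<in> A")
        case y: True
        \<comment> \<open>The cut of a set containing both ends of \<open>e\<close> grows by one.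
          Being slack, the set already had at least 6 edges, so its changed residue does no
          harm.\<close>
        have "card {x, y} \<le> card A" using True y A' by (intro card_mono) auto
        then have "slack (cut_size E g A) (sum \<beta> A)" using slack[OF A(2)] e by simp
        then have "6 \<le> cut_size E g A" by (auto simp: slack_def)
        moreover have "cut_size E g' A = cut_size E g A + 1" using True y A'(2) by (simp add: dg' dgA)
        ultimately show ?thesis by (simp add: feasible_def)
      next
        case False
        then show ?thesis
          using True A' dg'[of A] dgA[of A] sum'[of A] feasible_minus1[OF A, of "cut_size E g' A"] by simp
      qed
    next
      case False
      then show ?thesis using A' dg'[of A] dgA[of A] sum'[of A] okA by auto
    qed
  qed (use D in auto)
  moreover have "size_of V z E g' < size_of V z E g"
  proof -
    have "(\<Sum>v\<in>V - {z}. cut_size E g' {v}) < (\<Sum>v\<in>V - {z}. cut_size E g {v})"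
    proof (rule sum_strict_mono_ex1)
      show "\<forall>v\<in>V - {z}. cut_size E g' {v} \<le> cut_size E g {v}"
        using e(4) by (auto simp add: dg' dgA of_bool_def)
      have "cut_size E g' {x} < cut_size E g {x}" using e(4,5) x by (simp add: dg' dgA)
      then show "\<exists>v\<in>V - {z}. cut_size E g' {v} < cut_size E g {v}" using x by blast
    qed (use D(1) in simp)
    then show ?thesis by (simp add: size_of_def)
  qed
  ultimately obtain \<sigma> where \<sigma>: "\<sigma> \<in> sol V z E g' \<beta>' \<sigma>1" using IH n by fastforce
  have "meets g' z e" using ends' by (auto simp: meets_def)
  then have \<sigma>e: "\<sigma> e = (fst (g' e) = z)" using \<sigma> e by (auto simp: sol_def \<sigma>1_def)
  have "\<sigma> h = \<sigma>0 h" if h: "h \<in> E" "meets g z h" for h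
  proof -
    have "h \<noteq> e" using h e x by (auto simp: meets_def)
    moreover have "meets g' z h" using h \<open>h \<noteq> e\<close> by (auto simp: meets_def g'_def move_def)
    ultimately show ?thesis using \<sigma> h by (auto simp: sol_def \<sigma>1_def)
  qed
  moreover have "3 dvd net E g \<sigma> {v} - \<beta> v" if "v \<in> V" for v
  proof -
    have "3 dvd net E g' \<sigma> {v} - \<beta>' v" using \<sigma> that by (auto simp: sol_def)
    moreover have "net E g' \<sigma> {v} - \<beta>' v = net E g \<sigma> {v} - \<beta> v"
      using net'[of \<sigma> "{v}", OF \<sigma>e] by (auto simp: \<beta>'_def)
    ultimately show ?thesis by simp
  qed
  ultimately have "\<sigma> \<in> sol V z E g \<beta> \<sigma>0" using \<sigma> by (auto simp: sol_def)
  then show ?thesis by blast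
qed

lemma sol_if_almost_tight:
  assumes p: "cut_size E g {z} = 5"
    and A: "A \<subset> V - {z}" "2 \<le> card A"
    and tight: "cut_size E g A = 6 \<and> 3 dvd sum \<beta> A \<or> cut_size E g A = 7 \<and> 3 dvd sum \<beta> A - 2"
  shows "sol V z E g \<beta> \<sigma>0 \<noteq> {}"
  \<comment> \<open>a lift at the contracted set forces an edge to leave \<open>A\<close>, and without this edge the
    complement of \<open>A\<close> may serve as the root\<close>
proof -
  obtain a where a: "a \<in> A" using A(2) by fastforce
  have A': "A \<subseteq> V - {z}" "A \<subseteq> V" "a \<noteq> z" "z \<notin> A" using A a by auto
  have c: "2 \<le> card (V - A)" using card_compl_ge_2[OF A(1) D(2,1)] .
  let ?E = "outer E g A" and ?g = "relabel (collapse A a) g" and ?V = "insert a (V - A)"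
  let ?\<beta> = "\<beta>(a := sum \<beta> A)" and ?X = "crossing E g A"
  note adm1 = admissible_collapse[OF adm A'(1) a c]
  note D1 = admissibleD[OF adm1]
  let ?h = "other ?g a"
  have X: "e \<in> ?E" "meets ?g a e" "?h e \<in> V - A" "?h e \<noteq> a" "e \<in> crossing E g {?h e}"
    if "e \<in> ?X" for e
    using that a D(5)
    by (auto simp: crossing_def outer_def meets_def relabel_def collapse_def other_def split: if_splits)
  \<comment> \<open>Different far ends keep the lift from becoming a loop that costs one vertex two
    edges. If the whole cut went to one vertex \<open>v\<close>, then \<open>v\<close> would not be
    the root, which has only 5 edges; it would have exactly 6 edges, all going to \<open>A\<close>,
    and \<open>A \<union> {v}\<close> would have an empty cut.\<close>
  obtain e0 f0 where ef0: "e0 \<in> ?X" "f0 \<in> ?X" "?h e0 \<noteq> ?h f0"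
  proof -
    have "?X \<noteq> {}" using tight by (auto simp: cut_size_def)
    then obtain e0 where e0: "e0 \<in> ?X" by blast
    define v where "v = ?h e0"
    have v: "v \<in> V - A" using X[OF e0] by (simp add: v_def)
    have "\<exists>f0\<in>?X. ?h f0 \<noteq> v"
    proof (rule ccontr)
      assume "\<not> ?thesis"
      then have sub: "?X \<subseteq> crossing E g {v}" using X by auto
      then have le: "cut_size E g A \<le> cut_size E g {v}" unfolding cut_size_def using D by (intro card_mono) auto
      then have "v \<noteq> z" using p tight by auto
      then have "cut_size E g {v} \<le> 6" using out[of v] v by (auto simp: out_type_def)
      then have "cut_size E g (A \<union> {v}) = 0"
        using cut_size_Un[OF D(4), of A "{v}" g] v sub le tight
        by (simp add: Int_absorb2) (simp add: cut_size_def)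
      moreover have "cut_size E g (V - {z}) \<noteq> 0"
        using cut_size_compl[OF D(5), of "{z}"] p by simp
      ultimately have "A \<union> {v} \<subset> V - {z}" using A' v \<open>v \<noteq> z\<close> by auto
      then show False using D(9)[of "A \<union> {v}"] \<open>cut_size E g (A \<union> {v}) = 0\<close> by (auto simp: feasible_def)
    qed
    then show ?thesis using that e0 by (auto simp: v_def)
  qed
  \<comment> \<open>The names are chosen so that \<open>f\<close>, which the lift deletes, does not
    end at the root.\<close>
  define e where "e = (if ?h f0 = z then f0 else e0)"
  define f where "f = (if ?h f0 = z then e0 else f0)"
  have ef: "e \<in> ?X" "f \<in> ?X" "?h e \<noteq> ?h f" "?h f \<noteq> z"
    using ef0 by (auto simp: e_def f_def)
  have l: "finite ?E" "e \<in> ?E" "f \<in> ?E" "e \<noteq> f" "meets ?g a e" "meets ?g a f" "?h e \<noteq> a" "?h f \<noteq> a"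
    using X[OF ef(1)] X[OF ef(2)] ef D1(4) by auto
  have "admissible feasible ?V z (?E - {f}) (lift ?g a e f) ?\<beta> \<sigma>0"
    unfolding admissible_def
  proof (intro conjI allI impI)
    show "\<forall>h\<in>?E - {f}. fst (lift ?g a e f h) \<in> ?V \<and> snd (lift ?g a e f h) \<in> ?V"
      by (rule wf_lift[OF D1(5) l(2,3)])
    show "3 dvd net (?E - {f}) (lift ?g a e f) \<sigma>0 {z} - ?\<beta> z"
      using net_lift_root[OF l A'(3) ef(4), of \<sigma>0] D1(7) by simp
    show "root_feasible (cut_size (?E - {f}) (lift ?g a e f) {z}) (?\<beta> z)"
      using cut_size_lift[OF l, of "{z}"] D1(8) ef A'(3) by auto
    fix B assume B: "B \<noteq> {}" "B \<subset> ?V - {z}"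
    let ?B = "if a \<in> B then B \<union> A else B"
    have B': "B \<subseteq> ?V" using B by auto
    have dB: "cut_size ?E ?g B = cut_size E g ?B" using cut_size_outer[OF D(5) A'(2) a B'] .
    have sB: "sum ?\<beta> B = sum \<beta> ?B" using sum_collapse[OF D(1) A'(2) a B'] .
    show "feasible (cut_size (?E - {f}) (lift ?g a e f) B) (sum ?\<beta> B)"
    proof (cases "(?h e \<in> B) = (?h f \<in> B) \<and> (a \<in> B) \<noteq> (?h e \<in> B)")
      case True
      then have "cut_size E g ?B = cut_size (?E - {f}) (lift ?g a e f) B + 2"
        using cut_size_lift[OF l, of B] unfolding dB by simp
      moreover have "slack (cut_size E g ?B) (sum \<beta> ?B)"
      proof (rule slack)
        show "?B \<subset> V - {z}" using B A' a by auto
        have "?B \<subseteq> V" using B A' a by auto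
        then have fin: "finite ?B" by (rule finite_sub)
        show "2 \<le> card ?B"
        proof (cases "a \<in> B")
          case True
          then have "card A \<le> card ?B" using fin by (intro card_mono) auto
          then show ?thesis using A(2) by simp
        next
          case False
          then have "card {?h e, ?h f} \<le> card ?B" using fin True by (intro card_mono) auto
          then show ?thesis using ef by simp
        qed
      qed
      ultimately show ?thesis using slack_minus2 unfolding sB by simp
    next
      case False
      then have "cut_size ?E ?g B = cut_size (?E - {f}) (lift ?g a e f) B"
        using cut_size_lift[OF l, of B] by auto
      then show ?thesis using D1(9)[OF B] by simp
    qed
  qed (use D1 in \<open>auto simp del: fun_upd_apply\<close>)
  moreover have "size_of ?V z (?E - {f}) (lift ?g a e f) < size_of V z E g"
  proof -
    have "(\<Sum>v\<in>?V - {z}. cut_size (?E - {f}) (lift ?g a e f) {v}) \<le> (\<Sum>v\<in>?V - {z}. cut_size ?E ?g {v})"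
      using cut_size_lift[OF l] by (intro sum_mono) auto
    then show ?thesis
      using size_of_collapse[OF D(1,4,5) A'(1) a A(2) D(2)] by (simp add: size_of_def)
  qed
  ultimately obtain \<sigma>2 where "\<sigma>2 \<in> sol ?V z (?E - {f}) (lift ?g a e f) ?\<beta> \<sigma>0"
    using IH n by (metis (no_types, lifting) ex_in_conv less_le_trans)
  then obtain \<sigma> where \<sigma>: "\<sigma> \<in> sol ?V z ?E ?g ?\<beta> \<sigma>0" "outflow ?g \<sigma> {a} e + outflow ?g \<sigma> {a} f = 0"
    using sol_lift[OF l A'(3) ef(4)] by blast
  note N = net_collapse_sol[OF D(1,4,5) A'(1) a \<sigma>(1)]
  have oA: "outflow ?g \<sigma> {a} h = outflow g \<sigma> A h" if "h \<in> ?X" for h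
    using that a D(5) by (auto simp: outflow_def relabel_def collapse_def crossing_def)
  have "outflow g \<sigma> A e = 1 \<or> outflow g \<sigma> A f = 1"
    using \<sigma>(2) oA[OF ef(1)] oA[OF ef(2)] outflow_crossing[OF ef(1), of \<sigma>] outflow_crossing[OF ef(2), of \<sigma>]
    by auto
  then obtain h where h: "h \<in> ?X" "outflow g \<sigma> A h = 1" using ef by blast
  define u where "u = (if fst (g h) \<in> A then fst (g h) else snd (g h))"
  define w where "w = (if fst (g h) \<in> A then snd (g h) else fst (g h))"
  have uw: "u \<in> A" "w \<notin> A" "w \<in> V" using h(1) D(5) by (auto simp: u_def w_def crossing_def)
  have oh: "outflow g \<sigma> B h = of_bool (u \<in> B) - of_bool (w \<in> B)" for B
    using h uw by (auto simp: outflow_def crossing_def u_def w_def split: if_splits)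
  have hE: "h \<in> E" using h by (auto simp: crossing_def)
  have neth: "net {h} g \<sigma> B = of_bool (u \<in> B) - of_bool (w \<in> B)" for B
    by (simp add: net_def oh)
  have dgh: "cut_size E g B = cut_size (E - {h}) g B + of_bool ((u \<in> B) \<noteq> (w \<in> B))" for B
  proof -
    have "cut_size E g B = cut_size (E - {h}) g B + of_bool ((fst (g h) \<in> B) \<noteq> (snd (g h) \<in> B))"
      using cut_size_insert[of "E - {h}" h g B] hE D(4) by (simp add: insert_absorb)
    then show ?thesis by (auto simp: u_def w_def)
  qed
  have eq: "V - (V - A) = A" using A' by auto
  show ?thesis
  proof (rule sol_by_merge[where Q = feasible and C = "V - A" and F = "{h}" and \<rho> = \<sigma>, OF IH D(1,4,5,6) n])
    \<comment> \<open>Without \<open>h\<close> the new root has 5 edges, or 6 edges and demand 2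
      modulo 3; both are allowed.\<close>
    have "3 dvd sum \<beta> (V - A) + sum \<beta> A" using sum_compl_dvd[OF D(6) A'(2) D(1)] .
    moreover have "net {h} g \<sigma> (V - A) = -1" using neth[of "V - A"] uw by simp
    moreover have "cut_size E g A = cut_size (E - {h}) g (V - A) + 1"
      using dgh[of "V - A"] uw cut_size_compl[OF D(5), of A] by simp
    ultimately show "root_feasible (cut_size (E - {h}) g (V - A)) (sum \<beta> (V - A) - net {h} g \<sigma> (V - A))"
      using tight by (intro almost_tight_root_feasible)
    show "V - A \<noteq> {z} \<or> (\<exists>v\<in>V - {z}. cut_size {h} g {v} \<noteq> 0)" using c by auto
    show "feasible (cut_size (E - {h}) g B) (sum \<beta> B - net {h} g \<sigma> B)" if B: "B \<noteq> {}" "B \<subset> V - (V - A)" for B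
    proof -
      have B': "B \<subset> V - {z}" using B A unfolding eq by auto
      have "w \<notin> B" using B uw unfolding eq by auto
      then show ?thesis
        using feasible_minus1[OF B(1) B', of "cut_size (E - {h}) g B"] D(9)[OF B(1) B'] dgh[of B] neth[of B]
        by (cases "u \<in> B") auto
    qed
  qed (use A c N D(2) hE in \<open>auto simp: eq\<close>)
qed

end

text \<open>\<open>c\<close> is the cut of two vertices joined by at least two edges. For
  \<open>d = 5\<close> it is at most 6 with demand 2 modulo 3; for \<open>d = 6\<close> it is odd
  and at most 7 with demand 0. Neither is slack.\<close>

lemma double_edge_arith:
  "slack c (b + b') \<Longrightarrow> c \<le> d + 1 \<Longrightarrow> even (d + d' + c) \<Longrightarrow> out_type d b \<Longrightarrow> d' = 5 \<Longrightarrow>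
    3 dvd b' - 1 \<Longrightarrow> False"
  unfolding slack_def out_type_def by presburger

text \<open>\<open>k\<close> counts the edges between the root and \<open>y\<close>. In the extreme
  case \<open>k = 1\<close> the new root has 6 edges and demand 2, or 7 edges and demand 0 modulo 3,
  which is just allowed; a larger \<open>k\<close> leaves at most 5 edges.\<close>

lemma merge_arith:
  assumes "out_type dy by" "5 + dy = c + 2 * k" "1 \<le> k" "c = d + 2" "3 dvd 5 - bz" "m = -2" "b = bz + by"
  shows "root_feasible d (b - m)"
  using assms unfolding root_feasible_def out_type_def by presburger

context all_out begin

lemma sol_if_no_almost_tight:
  assumes p: "cut_size E g {z} = 5"
    and root_out: "\<And>e. e \<in> crossing E g {z} \<Longrightarrow> outflow g \<sigma>0 {z} e = 1"
    and no_tight: "\<And>A. A \<subset> V - {z} \<Longrightarrow> 2 \<le> card A \<Longrightarrow> cut_size E g A \<noteq> 6 \<or> \<not> 3 dvd sum \<beta> A"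
      "\<And>A. A \<subset> V - {z} \<Longrightarrow> 2 \<le> card A \<Longrightarrow> cut_size E g A \<noteq> 7 \<or> \<not> 3 dvd sum \<beta> A - 2"
  shows "sol V z E g \<beta> \<sigma>0 \<noteq> {}"
  \<comment> \<open>a neighbour \<open>y\<close> of the root, with all edges but at most one directed into it, is merged into
    the root; deleting two of these edges brings the root back to a feasible size\<close>
proof -
  have "crossing E g {z} \<noteq> {}" using p by (auto simp: cut_size_def)
  then obtain e0 where e0: "e0 \<in> crossing E g {z}" by blast
  define y where "y = other g z e0"
  have y: "y \<in> V" "y \<noteq> z" "e0 \<in> crossing E g {y}"
    using e0 D(5) by (auto simp: y_def crossing_def other_def)
  define k where "k = card (crossing E g {z} \<inter> crossing E g {y})"
  have k: "1 \<le> k" unfolding k_def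
    using e0 y D(4) by (metis (no_types, lifting) IntI One_nat_def Suc_leI card_gt_0_iff empty_iff
        finite_Int finite_crossing)
  have dzy: "5 + cut_size E g {y} = cut_size E g {z, y} + 2 * k"
    using cut_size_Un[OF D(4), of "{z}" "{y}" g] y p by (simp add: k_def insert_commute)
  have oty: "out_type (cut_size E g {y}) (\<beta> y)" using out y by auto
  have "cut_size E g (V - {z, y}) = cut_size E g {z, y}" by (rule cut_size_compl[OF D(5)])
  moreover have "2 \<le> card (V - {z, y})" using card_V D y by (simp add: card_Diff_subset)
  then have "slack (cut_size E g (V - {z, y})) (sum \<beta> (V - {z, y}))"
    using y D by (intro slack) auto
  ultimately have dzy6: "6 \<le> cut_size E g {z, y}" by (auto simp: slack_def)
  define N where "N = crossing E g {y} - crossing E g {z}"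
  have finN: "finite N" using D by (simp add: N_def)
  have cN: "card N + k = cut_size E g {y}"
    using card_Diff_subset_Int[of "crossing E g {y}" "crossing E g {z}"] D(4)
      card_mono[of "crossing E g {y}" "crossing E g {z} \<inter> crossing E g {y}"]
    by (simp add: N_def k_def cut_size_def Int_commute)
  have cN': "cut_size E g {y} - 5 \<le> card N" using cN dzy dzy6 oty by (auto simp: out_type_def)
  \<comment> \<open>With \<open>cut_size E g {y} - 5\<close> outgoing edges, that is 0 or 1, and all
    others incoming, \<open>y\<close> has net -5 or -4, congruent to its demand 1 or 2. The edges
    from the root enter \<open>y\<close> anyway, so \<open>T\<close> is taken from the
    others.\<close>
  obtain T where T: "T \<subseteq> N" "card T = cut_size E g {y} - 5"
    using obtain_subset_with_card_n[OF cN'] by metis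
  have "2 \<le> card (N - T)"
    using card_Diff_subset[of T N] T finite_subset[OF T(1) finN] cN dzy dzy6 oty
    by (auto simp: out_type_def)
  then obtain f1 f2 where f: "f1 \<in> N - T" "f2 \<in> N - T" "f1 \<noteq> f2"
    using card_le_Suc0_iff_eq[of "N - T"] finN by fastforce
  define \<rho> where "\<rho> e = (if e \<in> N then (snd (g e) = y) \<noteq> (e \<in> T) else \<sigma>0 e)" for e
  have rout: "outflow g \<rho> {y} e = (if e \<in> T then 1 else -1)" if "e \<in> crossing E g {y}" for e
  proof (cases "e \<in> N")
    case True
    then show ?thesis using that by (auto simp: \<rho>_def outflow_def crossing_def)
  next
    case False
    then have e: "e \<in> crossing E g {z}" "e \<notin> T" using that T by (auto simp: N_def)
    have "outflow g \<rho> {y} e = - outflow g \<rho> {z} e"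
      using that e y by (auto simp: outflow_def crossing_def)
    also have "outflow g \<rho> {z} e = outflow g \<sigma>0 {z} e" using False by (simp add: outflow_def \<rho>_def)
    finally show ?thesis using root_out e by simp
  qed
  have nety: "net E g \<rho> {y} = 2 * int (cut_size E g {y} - 5) - int (cut_size E g {y})"
  proof -
    have "T \<subseteq> crossing E g {y}" using T by (auto simp: N_def)
    then have "(\<Sum>e\<in>crossing E g {y}. if e \<in> T then 2 else 0 :: int) = 2 * int (card T)"
      using D(4) by (simp add: sum.If_cases Int_absorb1)
    moreover have "net E g \<rho> {y} = (\<Sum>e\<in>crossing E g {y}. (if e \<in> T then 2 else 0) - 1)"
      unfolding net_eq_sum_crossing[OF D(4)] by (rule sum.cong) (auto simp: rout)
    ultimately show ?thesis using T by (simp add: sum_subtractf cut_size_def)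
  qed
  define w1 w2 where "w1 = other g y f1" and "w2 = other g y f2"
  have fN: "f1 \<in> N" "f2 \<in> N" "f1 \<notin> T" "f2 \<notin> T" using f by auto
  have w: "w1 \<in> V - {z, y}" "w2 \<in> V - {z, y}"
    using fN D(5) y by (auto simp: w1_def w2_def N_def crossing_def other_def)
  have ends: "(fst (g f1) \<in> A) \<noteq> (snd (g f1) \<in> A) \<longleftrightarrow> (w1 \<in> A) \<noteq> (y \<in> A)"
    "(fst (g f2) \<in> A) \<noteq> (snd (g f2) \<in> A) \<longleftrightarrow> (w2 \<in> A) \<noteq> (y \<in> A)" for A
    using fN by (auto simp: w1_def w2_def N_def crossing_def other_def)
  have o: "outflow g \<rho> A f1 = of_bool (w1 \<in> A) - of_bool (y \<in> A)"
    "outflow g \<rho> A f2 = of_bool (w2 \<in> A) - of_bool (y \<in> A)" for A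
    using fN by (auto simp: w1_def w2_def N_def crossing_def other_def outflow_def \<rho>_def)
  let ?F = "{f1, f2}"
  have FE: "?F \<subseteq> E" using fN by (auto simp: N_def crossing_def)
  have netF: "net ?F g \<rho> A = of_bool (w1 \<in> A) + of_bool (w2 \<in> A) - 2 * of_bool (y \<in> A)" for A
    using f by (simp add: net_def o)
  have dgF: "cut_size E g A = cut_size (E - ?F) g A + of_bool ((w1 \<in> A) \<noteq> (y \<in> A)) + of_bool ((w2 \<in> A) \<noteq> (y \<in> A))"
    for A
  proof -
    have "cut_size ?F g A = of_bool ((fst (g f1) \<in> A) \<noteq> (snd (g f1) \<in> A))
        + of_bool ((fst (g f2) \<in> A) \<noteq> (snd (g f2) \<in> A))"
      using f cut_size_insert[of "{f2}" f1 g A] cut_size_insert[of "{}" f2 g A] by simp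
    then show ?thesis using cut_size_diff[OF D(4) FE, of g A] unfolding ends by simp
  qed
  have netz: "net E g \<sigma>0 {z} = 5"
    unfolding net_eq_sum_crossing[OF D(4)] using root_out p by (simp add: cut_size_def)
  have \<rho>z: "net E g \<rho> {z} = net E g \<sigma>0 {z}"
    by (rule net_cong[OF D(4)]) (auto simp: \<rho>_def N_def)
  \<comment> \<open>A vertex with 6 edges and demand 2 that loses two outgoing edges keeps 4 edges
    and demand 0 modulo 3. With 5 edges it would keep only 3.\<close>
  have same_end: "cut_size E g {w1} = 6" if "w1 = w2"
  proof (rule ccontr)
    assume "cut_size E g {w1} \<noteq> 6"
    then have d5: "cut_size E g {w1} = 5" "3 dvd \<beta> w1 - 1"
      using out[of w1] w by (auto simp: out_type_def)
    have ne: "y \<noteq> w1" using w by auto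
    have sub: "{f1, f2} \<subseteq> crossing E g {y} \<inter> crossing E g {w1}"
      using fN ends[of "{w1}"] ne that[symmetric] by (auto simp: N_def crossing_def)
    have "card {f1, f2} \<le> card (crossing E g {y} \<inter> crossing E g {w1})"
      by (rule card_mono[OF _ sub]) (use D(4) in simp)
    then have "2 \<le> card (crossing E g {y} \<inter> crossing E g {w1})" using f by simp
    moreover have "cut_size E g {y} + cut_size E g {w1} =
        cut_size E g {y, w1} + 2 * card (crossing E g {y} \<inter> crossing E g {w1})"
      using cut_size_Un[OF D(4), of "{y}" "{w1}" g] ne by (simp add: insert_commute)
    ultimately have le: "cut_size E g {y, w1} \<le> cut_size E g {y} + 1"
      and ev: "even (cut_size E g {y} + cut_size E g {w1} + cut_size E g {y, w1})"
      using d5 by simp_all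
    have "{y, w1} \<subset> V - {z}"
    proof -
      have "\<not> V - {z} \<subseteq> {y, w1}"
      proof
        assume "V - {z} \<subseteq> {y, w1}"
        then have "card (V - {z}) \<le> card {y, w1}" by (intro card_mono) auto
        then show False using card_V D ne by simp
      qed
      then show ?thesis using y w by auto
    qed
    then have "slack (cut_size E g {y, w1}) (sum \<beta> {y, w1})" using ne by (intro slack) auto
    then have "slack (cut_size E g {y, w1}) (\<beta> y + \<beta> w1)" using ne by simp
    then show False using le ev oty d5 by (intro double_edge_arith)
  qed
  show ?thesis
  proof (rule sol_by_merge[where Q = feasible and C = "{z, y}" and F = ?F and \<rho> = \<rho>, OF IH D(1,4,5,6) n])
    show "2 \<le> card (V - {z, y})" by fact
    show "3 dvd net E g \<rho> {v} - \<beta> v" if v: "v \<in> {z, y}" for v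
    proof (cases "v = z")
      case True
      then show ?thesis using \<rho>z D(7) by simp
    next
      case False
      then have "v = y" using v by simp
      then show ?thesis using nety oty unfolding out_type_def by auto presburger+
    qed
    show "\<rho> e = \<sigma>0 e" if "e \<in> E" "meets g z e" for e
      using that y by (auto simp: \<rho>_def N_def crossing_def meets_def)
    have "cut_size E g {z, y} = cut_size (E - ?F) g {z, y} + 2" using dgF[of "{z, y}"] w by auto
    moreover have "net ?F g \<rho> {z, y} = -2" using netF[of "{z, y}"] w by auto
    moreover have "sum \<beta> {z, y} = \<beta> z + \<beta> y" using y by simp
    moreover have "3 dvd 5 - \<beta> z" using D(7) netz by simp
    ultimately show "root_feasible (cut_size (E - ?F) g {z, y}) (sum \<beta> {z, y} - net ?F g \<rho> {z, y})"
      using dzy k oty by (intro merge_arith)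
    show "{z, y} \<noteq> {z} \<or> (\<exists>v\<in>V - {z}. cut_size ?F g {v} \<noteq> 0)" using y by auto
    show "feasible (cut_size (E - ?F) g A) (sum \<beta> A - net ?F g \<rho> A)" if A: "A \<noteq> {}" "A \<subset> V - {z, y}" for A
    proof -
      have A': "A \<subset> V - {z}" "y \<notin> A" "finite A" using A by (auto intro: finite_sub)
      have dA: "cut_size E g A = cut_size (E - ?F) g A + of_bool (w1 \<in> A) + of_bool (w2 \<in> A)"
        using dgF[of A] A' by simp
      have nA: "net ?F g \<rho> A = of_bool (w1 \<in> A) + of_bool (w2 \<in> A)"
        using netF[of A] A' by simp
      show ?thesis
      proof (cases "w1 \<in> A \<and> w2 \<in> A")
        case True
        then have d2: "cut_size E g A = cut_size (E - ?F) g A + 2" "net ?F g \<rho> A = 2" using dA nA by auto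
        from A'(3) A(1) show ?thesis
        proof (rule singleton_or_card_ge_2)
          fix v assume v: "A = {v}"
          then have "cut_size E g {v} = 6" using same_end True by auto
          then show ?thesis using d2 out[of v] v A by (auto simp: feasible_def out_type_def)
        next
          assume c: "2 \<le> card A"
          \<comment> \<open>A set that loses two outgoing edges passes from size \<open>d\<close>
            and demand \<open>b\<close> to \<open>d - 2\<close> and \<open>b - 2\<close>. Among
            slack sets this fails exactly for size 6 with demand 0 and for size 7 with demand 2
            modulo 3, the two kinds that are excluded here and treated separately.\<close>
          show ?thesis
            using slack[OF A'(1) c] no_tight(1)[OF A'(1) c] no_tight(2)[OF A'(1) c] d2
            unfolding slack_def feasible_def by presburger
        qed
      next
        case False
        then consider "cut_size E g A = cut_size (E - ?F) g A + 1" "net ?F g \<rho> A = 1"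
          | "cut_size E g A = cut_size (E - ?F) g A" "net ?F g \<rho> A = 0"
          using dA nA by (cases "w1 \<in> A"; cases "w2 \<in> A") auto
        then show ?thesis
          using feasible_minus1[OF A(1) A'(1)] D(9)[OF A(1) A'(1)] by cases auto
      qed
    qed
  qed (use y D(2) FE in auto)
qed

lemma sol_nonempty: "sol V z E g \<beta> \<sigma>0 \<noteq> {}"
proof (cases "\<exists>e\<in>crossing E g {z}. outflow g \<sigma>0 {z} e \<noteq> 1")
  case True
  then obtain e where "e \<in> E" "outflow g \<sigma>0 {z} e = -1"
    using outflow_crossing[of _ E g "{z}" \<sigma>0] by (auto simp: crossing_def)
  then show ?thesis by (rule sol_if_edge_into_root)
next
  case False
  then have "net E g \<sigma>0 {z} = int (cut_size E g {z})"
    unfolding net_eq_sum_crossing[OF D(4)] by (simp add: cut_size_def)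
  then have "cut_size E g {z} \<le> 5"
    using D(7,8) root_feasible_out_le_5 by simp
  then consider "cut_size E g {z} \<le> 4" | "cut_size E g {z} = 5" by linarith
  then show ?thesis
  proof cases
    case 1
    then show ?thesis by (rule sol_if_small_root)
  next
    case 2
    show ?thesis
    proof (rule ccontr)
      assume "\<not> ?thesis"
      then show False
        using sol_if_almost_tight[OF 2] sol_if_no_almost_tight[OF 2] False by metis
    qed
  qed
qed

end

subsection \<open>The orientation theorem\<close>

lemma net_Not: "net E g (\<lambda>e. \<not> \<sigma> e) A = - net E g \<sigma> A"
  unfolding net_def sum_negf[symmetric] by (rule sum.cong) (auto simp: outflow_def)

lemma dvd_diff_minus: "(3::int) dvd - a - - b \<longleftrightarrow> 3 dvd a - b"
  by presburger

lemma feasible_minus: "feasible d (- b) = feasible d b" and slack_minus: "slack d (- b) = slack d b"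
  and root_feasible_minus: "root_feasible d (- b) = root_feasible d b"
  by (simp_all add: feasible_def slack_def root_feasible_def)

lemma admissible_minus:
  "admissible feasible V z E g \<beta> \<sigma>0 \<Longrightarrow> admissible feasible V z E g (\<lambda>v. - \<beta> v) (\<lambda>e. \<not> \<sigma>0 e)"
  unfolding admissible_def net_Not sum_negf feasible_minus root_feasible_minus dvd_diff_minus by simp

lemma sol_minus:
  assumes "\<sigma> \<in> sol V z E g (\<lambda>v. - \<beta> v) (\<lambda>e. \<not> \<sigma>0 e)" "finite E"
  shows "restrict (\<lambda>e. \<not> \<sigma> e) E \<in> sol V z E g \<beta> \<sigma>0"
proof -
  have "net E g (restrict (\<lambda>e. \<not> \<sigma> e) E) A = - net E g \<sigma> A" for A
    unfolding net_Not[symmetric]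
    by (rule net_cong[OF assms(2)]) (auto simp: crossing_def)
  then show ?thesis
    using assms(1) dvd_diff_minus[of "net E g \<sigma> _"] by (auto simp: sol_def minus_diff_commute
        diff_minus_eq_add)
qed

theorem sol_exists:
  fixes E :: "'e set"
  assumes "admissible feasible V z E g \<beta> \<sigma>0"
  shows "sol V z E g \<beta> \<sigma>0 \<noteq> {}"
  using assms
proof (induction "size_of V z E g" arbitrary: V E g \<beta> \<sigma>0 rule: less_induct)
  case less
  have IH: "sol V' z E' g' \<beta>' \<sigma>' \<noteq> {}"
    if "admissible feasible V' z E' g' \<beta>' \<sigma>'" "size_of V' z E' g' < size_of V z E g"
    for V' and E' :: "'e set" and g' \<beta>' \<sigma>'
    using less.hyps that by blast
  note adm = less.prems
  note D = admissibleD[OF adm]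
  show ?case
  proof (rule ccontr)
    assume none: "\<not> ?case"
    have V3: "card V \<noteq> 3" using sol_nonempty_base[OF adm] none by blast
    then have V4: "4 \<le> card V" using D by simp
    have slack: "slack (cut_size E g A) (sum \<beta> A)" if "A \<subset> V - {z}" "2 \<le> card A" for A
      using sol_by_collapse[OF IH adm order_refl that] none by blast
    let ?d = "\<lambda>v. cut_size E g {v}"
    define Out where "Out v \<longleftrightarrow> feasible (?d v - 1) (\<beta> v - 1)" for v
    define Inn where "Inn v \<longleftrightarrow> feasible (?d v - 1) (\<beta> v + 1)" for v
    have VB: "V - {z} \<noteq> {v}" for v
    proof
      assume "V - {z} = {v}"
      then have "card (V - {z}) = 1" by simp
      then show False using D V4 by simp
    qed
    have okv: "feasible (?d v) (\<beta> v)" if "v \<in> V - {z}" for v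
      using D(9)[of "{v}"] that VB[of v] by auto
    have no4: "?d v \<noteq> 4 \<or> \<not> 3 dvd \<beta> v" if "v \<in> V - {z}" for v
      using sol_by_degree_4[OF IH adm order_refl slack V3] none that by blast
    have types: "Out v \<or> Inn v" "\<not> Inn v \<Longrightarrow> out_type (?d v) (\<beta> v)"
      "\<not> Out v \<Longrightarrow> out_type (?d v) (- \<beta> v)" if "v \<in> V - {z}" for v
      using okv[OF that] no4[OF that] unfolding feasible_def Out_def Inn_def out_type_def
      by presburger+
    have edge: "\<not> (Out x \<and> Inn y)"
      if "e \<in> E" "g e = (x, y) \<or> g e = (y, x)" "x \<noteq> y" "x \<noteq> z" "y \<noteq> z" for e x y
      using sol_by_deletion[OF IH adm order_refl slack that] none unfolding Out_def Inn_def by blast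
    \<comment> \<open>The two parts of \<open>V - {z}\<close> are joined by an edge, but
      \<open>edge\<close> forbids one. Applied to the vertices with \<open>Out\<close>, to those
      with \<open>Inn\<close> and to a single vertex, this leaves only the case that one of the two
      properties fails everywhere.\<close>
    have split: False if S: "S \<subseteq> V - {z}" "S \<noteq> {}" "S \<noteq> V - {z}"
      "\<And>x y. x \<in> S \<Longrightarrow> y \<in> V - {z} - S \<Longrightarrow> Out x \<and> Inn y \<or> Out y \<and> Inn x" for S
    proof -
      obtain e where e: "e \<in> E"
        "fst (g e) \<in> S \<and> snd (g e) \<in> V - {z} - S \<or> snd (g e) \<in> S \<and> fst (g e) \<in> V - {z} - S"
        using crossing_between[OF adm S(1-3)] by blast
      obtain x y where xy: "x \<in> S" "y \<in> V - {z} - S" "g e = (x, y) \<or> g e = (y, x)"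
        using e(2) by (metis prod.collapse)
      then have "x \<noteq> y" "x \<noteq> z" "y \<noteq> z" using S(1) by auto
      then show False
        using S(4)[OF xy(1,2)] edge[OF e(1), of x y] edge[OF e(1), of y x] xy(3) by metis
    qed
    have "{v \<in> V - {z}. Out v} = {} \<or> {v \<in> V - {z}. Out v} = V - {z}"
      using split[of "{v \<in> V - {z}. Out v}"] types(1) by blast
    moreover have "{v \<in> V - {z}. Inn v} = {} \<or> {v \<in> V - {z}. Inn v} = V - {z}"
      using split[of "{v \<in> V - {z}. Inn v}"] types(1) by blast
    moreover have "\<not> (\<forall>v\<in>V - {z}. Out v \<and> Inn v)"
    proof
      assume all: "\<forall>v\<in>V - {z}. Out v \<and> Inn v"
      have "V - {z} \<noteq> {}"
        using V4 D card_Diff_singleton[OF D(2)] by (metis card.empty diff_is_0_eq not_numeral_le_zero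
            numeral_le_one_iff order_trans semiring_norm(69))
      then obtain x where "x \<in> V - {z}" by blast
      then show False using split[of "{x}"] VB[of x] all by auto
    qed
    ultimately consider "\<forall>v\<in>V - {z}. \<not> Inn v" | "\<forall>v\<in>V - {z}. \<not> Out v" by blast
    then show False
    proof cases
      case 1
      interpret all_out V z E g \<beta> \<sigma>0 "size_of V z E g"
        by unfold_locales (use IH adm slack V4 types(2) 1 in auto)
      show False using sol_nonempty none by blast
    next
      case 2
      interpret all_out V z E g "\<lambda>v. - \<beta> v" "\<lambda>e. \<not> \<sigma>0 e" "size_of V z E g"
        by unfold_locales
          (use IH admissible_minus[OF adm] slack V4 types(3) 2 in \<open>auto simp: sum_negf slack_minus\<close>)
      show False using sol_nonempty sol_minus[of _ V z E g \<beta> \<sigma>0] D(4) none by blast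
    qed
  qed
qed

section \<open>Counting orientations\<close>

text \<open>Size 4 is left out: deleting an edge between free vertices never produces it. A feasible
  set that is not free then has 5 or 6 edges and a demand that is nonzero modulo 3, and so its
  complement can be a root.\<close>

definition feasible5 :: "nat \<Rightarrow> int \<Rightarrow> bool" where
  "feasible5 d b \<longleftrightarrow> 6 \<le> d \<or> d = 5 \<and> \<not> 3 dvd b"

definition free :: "nat \<Rightarrow> int \<Rightarrow> bool" where
  "free d b \<longleftrightarrow> 7 \<le> d \<or> d = 6 \<and> 3 dvd b"

text \<open>
  Deleting an edge between two free vertices in both orientations doubles the number of solutions
  and costs at most \<open>2 * (1 + 5) = 12\<close> in weight. Splitting the problem at a cut creates one vertex
  that is not free, of weight \<open>-5\<close>, which the constant 5 of the additional problem pays for.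
\<close>

definition weight :: "'v set \<Rightarrow> 'v \<Rightarrow> 'e set \<Rightarrow> ('e \<Rightarrow> 'v \<times> 'v) \<Rightarrow> ('v \<Rightarrow> int) \<Rightarrow> real" where
  "weight V z E g \<beta> = 5 + (\<Sum>v\<in>V - {z}. if free (cut_size E g {v}) (\<beta> v) then 1 else -5)"

lemma free_minus1: "free (d + 1) b \<Longrightarrow> feasible5 d (b - 1) \<and> feasible5 d (b + 1)"
  unfolding free_def feasible5_def by presburger

lemma admissible_feasible5_imp_feasible: "admissible feasible5 V z E g \<beta> \<sigma>0 \<Longrightarrow> admissible feasible V z E g \<beta> \<sigma>0"
  unfolding admissible_def feasible5_def feasible_def by blast

lemma finite_sol: "finite E \<Longrightarrow> finite (sol V z E g \<beta> \<sigma>0)"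
  by (rule finite_subset[of _ "E \<rightarrow>\<^sub>E UNIV"]) (auto simp: sol_def intro: finite_PiE)

lemma glue_empty [simp]: "glue {} \<rho> \<sigma> = \<sigma>"
  by (auto simp: glue_def)

text \<open>Each solution of the contraction has at least a fixed number of extensions into
  \<open>A\<close>, and different solutions have disjoint sets of extensions, because a solution can
  be read off from the edges in \<open>outer E g A\<close>. Hence counts multiply while weights
  add.\<close>

lemma count_by_collapse:
  fixes E :: "'e set"
  assumes IH: "\<And>V (E :: 'e set) g \<beta> \<sigma>0. admissible feasible5 V z E g \<beta> \<sigma>0 \<Longrightarrow> size_of V z E g < n \<Longrightarrow>
      2 powr (weight V z E g \<beta> / 12) \<le> real (card (sol V z E g \<beta> \<sigma>0))"
    and adm: "admissible feasible5 V z E g \<beta> \<sigma>0" and n: "size_of V z E g \<le> n"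
    and A: "A \<subset> V - {z}" "2 \<le> card A" "\<not> free (cut_size E g A) (sum \<beta> A)"
  shows "2 powr (weight V z E g \<beta> / 12) \<le> real (card (sol V z E g \<beta> \<sigma>0))"
proof -
  note D = admissibleD[OF adm]
  obtain a where a: "a \<in> A" using A(2) by fastforce
  have A': "A \<subseteq> V - {z}" "A \<subseteq> V" "a \<noteq> z" "z \<notin> A" using A a by auto
  have c: "2 \<le> card (V - A)" using card_compl_ge_2[OF A(1) D(2,1)] .
  have eq: "V - (V - A) = A" using A' by auto
  have fA: "finite A" using A'(2) D(1) finite_subset by blast
  let ?V1 = "insert a (V - A)" and ?E1 = "outer E g A" and ?g1 = "relabel (collapse A a) g"
    and ?\<beta>1 = "\<beta>(a := sum \<beta> A)"
  let ?V2 = "insert z A" and ?g2 = "relabel (merge (V - A) z) g"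
    and ?\<beta>2 = "merged_demand (V - A) z {} g \<beta> undefined"
  let ?S1 = "sol ?V1 z ?E1 ?g1 ?\<beta>1 \<sigma>0" and ?S2 = "\<lambda>\<sigma>. sol ?V2 z E ?g2 ?\<beta>2 \<sigma>"
  let ?w = "\<lambda>v. if free (cut_size E g {v}) (\<beta> v) then 1 else -5 :: real"
  \<comment> \<open>Nothing is deleted, so the merged demand is the same for every orientation. Thus
    \<open>undefined\<close> may stand for any of them, and all the second problems have the same
    weight.\<close>
  have \<beta>2: "merged_demand (V - A) z {} g \<beta> \<rho> = ?\<beta>2" for \<rho>
    by (auto simp: merged_demand_def)
  have less1: "size_of ?V1 z ?E1 ?g1 < n"
    using size_of_collapse[OF D(1,4,5) A'(1) a A(2) D(2)] n by simp
  have L1: "2 powr (weight ?V1 z ?E1 ?g1 ?\<beta>1 / 12) \<le> real (card ?S1)"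
    using IH[OF admissible_collapse[OF adm A'(1) a c] less1] .
  have "size_of (insert z (V - (V - A))) z (E - {}) ?g2 < size_of V z E g"
    by (rule size_of_merge[OF D(1,4,5)]) (use A c D in auto)
  then have less2: "size_of ?V2 z E ?g2 < n" using n unfolding eq by simp
  have S2: "2 powr (weight ?V2 z E ?g2 ?\<beta>2 / 12) \<le> real (card (?S2 \<sigma>))"
    "?S2 \<sigma> \<subseteq> sol V z E g \<beta> \<sigma>0" "\<And>\<tau>. \<tau> \<in> ?S2 \<sigma> \<Longrightarrow> restrict \<tau> ?E1 = \<sigma>" if \<sigma>: "\<sigma> \<in> ?S1" for \<sigma>
  proof -
    note N = net_collapse_sol[OF D(1,4,5) A'(1) a \<sigma>]
    have "admissible feasible5 (insert z (V - (V - A))) z (E - {}) ?g2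
        (merged_demand (V - A) z {} g \<beta> \<sigma>) \<sigma>"
    proof (rule admissible_merge[OF D(1,4,5,6)])
      have "feasible5 (cut_size E g A) (sum \<beta> A)" using D(9) A a by auto
      moreover have "3 dvd sum \<beta> (V - A) + sum \<beta> A" using sum_compl_dvd[OF D(6) A'(2) D(1)] .
      ultimately have "root_feasible (cut_size E g A) (sum \<beta> (V - A))"
        using A(3) unfolding feasible5_def free_def root_feasible_def by presburger
      then show "root_feasible (cut_size (E - {}) g (V - A)) (sum \<beta> (V - A) - net {} g \<sigma> (V - A))"
        using cut_size_compl[OF D(5)] by simp
      show "feasible5 (cut_size (E - {}) g B) (sum \<beta> B - net {} g \<sigma> B)" if "B \<noteq> {}" "B \<subset> V - (V - A)" for B
        using D(9)[of B] that A unfolding eq by auto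
    qed (use A c N D(2) in \<open>auto simp: eq fA\<close>)
    then have "admissible feasible5 ?V2 z E ?g2 ?\<beta>2 \<sigma>" unfolding eq \<beta>2[of \<sigma>] by simp
    then show "2 powr (weight ?V2 z E ?g2 ?\<beta>2 / 12) \<le> real (card (?S2 \<sigma>))"
      using IH less2 by blast
    show "?S2 \<sigma> \<subseteq> sol V z E g \<beta> \<sigma>0"
    proof
      fix \<tau> assume \<tau>: "\<tau> \<in> ?S2 \<sigma>"
      have "glue {} \<sigma> \<tau> \<in> sol V z E g \<beta> \<sigma>0"
        by (rule sol_merge[OF D(1,4,5), where C = "V - A"])
          (use N \<tau> D(2) A' in \<open>auto simp: eq \<beta>2[of \<sigma>]\<close>)
      then show "\<tau> \<in> sol V z E g \<beta> \<sigma>0" by simp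
    qed
    fix \<tau> assume \<tau>: "\<tau> \<in> ?S2 \<sigma>"
    have "\<tau> e = \<sigma> e" if e: "e \<in> ?E1" for e
    proof -
      have "meets ?g2 z e"
        using e D(5) by (auto simp: meets_def relabel_def merge_def outer_def)
      then show ?thesis using \<tau> e by (auto simp: sol_def outer_def)
    qed
    moreover have "\<sigma> \<in> ?E1 \<rightarrow>\<^sub>E UNIV" using \<sigma> by (auto simp: sol_def)
    ultimately show "restrict \<tau> ?E1 = \<sigma>"
      by (auto simp: fun_eq_iff restrict_def PiE_def extensional_def)
  qed
  have fin: "finite ?S1" "finite (sol V z E g \<beta> \<sigma>0)"
    using D(4) by (auto intro!: finite_sol simp: outer_def)
  have w1: "weight ?V1 z ?E1 ?g1 ?\<beta>1 = (\<Sum>v\<in>V - A - {z}. ?w v)"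
  proof -
    have e: "?V1 - {z} = insert a (V - A - {z})" using A' by auto
    have "(\<Sum>v\<in>?V1 - {z}. if free (cut_size ?E1 ?g1 {v}) (?\<beta>1 v) then 1 else -5 :: real) =
      (if free (cut_size ?E1 ?g1 {a}) (?\<beta>1 a) then 1 else -5) +
      (\<Sum>v\<in>V - A - {z}. if free (cut_size ?E1 ?g1 {v}) (?\<beta>1 v) then 1 else -5)"
      unfolding e by (rule sum.insert) (use D a in auto)
    also have "cut_size ?E1 ?g1 {a} = cut_size E g A"
      using cut_size_outer[OF D(5) A'(2) a, of "{a}"] a by (simp add: insert_absorb)
    also have "(\<Sum>v\<in>V - A - {z}. if free (cut_size ?E1 ?g1 {v}) (?\<beta>1 v) then 1 else -5) =
        (\<Sum>v\<in>V - A - {z}. ?w v)"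
    proof (rule sum.cong)
      fix v assume v: "v \<in> V - A - {z}"
      then have "v \<noteq> a" using a by auto
      then show "(if free (cut_size ?E1 ?g1 {v}) (?\<beta>1 v) then 1 else -5) = ?w v"
        using cut_size_outer[OF D(5) A'(2) a, of "{v}"] v by simp
    qed simp
    finally show ?thesis using A(3) by (simp add: weight_def)
  qed
  have w2: "weight ?V2 z E ?g2 ?\<beta>2 = 5 + (\<Sum>v\<in>A. ?w v)"
  proof -
    have e: "?V2 - {z} = A" using A' by auto
    show ?thesis unfolding weight_def e
    proof (intro arg_cong2[of _ _ _ _ "(+)"] sum.cong refl)
      fix v assume v: "v \<in> A"
      have "cut_size E ?g2 {v} = cut_size E g {v}"
        by (rule cut_size_relabel[OF D(5)]) (use v A' in \<open>auto simp: merge_def\<close>)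
      moreover have "?\<beta>2 v = \<beta> v" using v A' by (auto simp: merged_demand_def)
      ultimately show "(if free (cut_size E ?g2 {v}) (?\<beta>2 v) then 1 else -5) = ?w v" by simp
    qed
  qed
  have "(\<Sum>v\<in>V - {z}. ?w v) = (\<Sum>v\<in>V - A - {z}. ?w v) + (\<Sum>v\<in>A. ?w v)"
    using sum.subset_diff[OF A'(1), of ?w] D(1) by (simp add: Diff_eq Int_ac)
  then have w: "weight V z E g \<beta> = weight ?V1 z ?E1 ?g1 ?\<beta>1 + weight ?V2 z E ?g2 ?\<beta>2"
    unfolding w1 w2 by (simp add: weight_def)
  have "2 powr (weight V z E g \<beta> / 12) =
      2 powr (weight ?V1 z ?E1 ?g1 ?\<beta>1 / 12) * 2 powr (weight ?V2 z E ?g2 ?\<beta>2 / 12)"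
    unfolding w add_divide_distrib powr_add ..
  also have "\<dots> \<le> real (card ?S1) * 2 powr (weight ?V2 z E ?g2 ?\<beta>2 / 12)"
    using L1 by (intro mult_right_mono) auto
  also have "\<dots> = (\<Sum>\<sigma>\<in>?S1. 2 powr (weight ?V2 z E ?g2 ?\<beta>2 / 12))" by simp
  also have "\<dots> \<le> (\<Sum>\<sigma>\<in>?S1. real (card (?S2 \<sigma>)))" using S2(1) by (intro sum_mono)
  also have "\<dots> = real (card (\<Union>\<sigma>\<in>?S1. ?S2 \<sigma>))"
  proof -
    have "card (\<Union>\<sigma>\<in>?S1. ?S2 \<sigma>) = (\<Sum>\<sigma>\<in>?S1. card (?S2 \<sigma>))"
      by (rule card_UN_disjoint) (use fin S2(3) D(4) in \<open>auto intro!: finite_sol\<close>)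
    then show ?thesis by simp
  qed
  also have "\<dots> \<le> real (card (sol V z E g \<beta> \<sigma>0))"
    using S2(2) fin by (intro of_nat_mono card_mono) auto
  finally show ?thesis .
qed

lemma inj_on_glue: "inj_on (glue F \<rho>) (sol V z (E - F) g \<beta> \<sigma>0)"
proof (rule inj_onI)
  fix \<sigma> \<tau>
  assume *: "\<sigma> \<in> sol V z (E - F) g \<beta> \<sigma>0" "\<tau> \<in> sol V z (E - F) g \<beta> \<sigma>0"
    "glue F \<rho> \<sigma> = glue F \<rho> \<tau>"
  show "\<sigma> = \<tau>"
  proof
    fix h show "\<sigma> h = \<tau> h"
      using fun_cong[OF *(3), of h] *(1,2)
      by (cases "h \<in> F") (auto simp: glue_def sol_def PiE_def extensional_def)
  qed
qed

lemma count_by_deletion: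
  fixes E :: "'e set"
  assumes IH: "\<And>V (E :: 'e set) g \<beta> \<sigma>0. admissible feasible5 V z E g \<beta> \<sigma>0 \<Longrightarrow> size_of V z E g < n \<Longrightarrow>
      2 powr (weight V z E g \<beta> / 12) \<le> real (card (sol V z E g \<beta> \<sigma>0))"
    and adm: "admissible feasible5 V z E g \<beta> \<sigma>0" and n: "size_of V z E g \<le> n"
    and free: "\<And>A. A \<subset> V - {z} \<Longrightarrow> 2 \<le> card A \<Longrightarrow> free (cut_size E g A) (sum \<beta> A)"
    and e: "e \<in> E" "fst (g e) \<noteq> snd (g e)" "fst (g e) \<noteq> z" "snd (g e) \<noteq> z"
    and x: "free (cut_size E g {fst (g e)}) (\<beta> (fst (g e)))"
    and y: "free (cut_size E g {snd (g e)}) (\<beta> (snd (g e)))"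
  shows "2 powr (weight V z E g \<beta> / 12) \<le> real (card (sol V z E g \<beta> \<sigma>0))"
proof -
  note D = admissibleD[OF adm]
  let ?x = "fst (g e)" and ?y = "snd (g e)"
  have xyV: "?x \<in> V - {z}" "?y \<in> V - {z}" using e D(5) by auto
  define \<rho> where "\<rho> b = \<sigma>0(e := b)" for b
  define s where "s b = (if b then 1 else -1 :: int)" for b
  have net: "net {e} g (\<rho> b) A = s b * (of_bool (?x \<in> A) - of_bool (?y \<in> A))" for A b
    by (simp add: net_def outflow_def \<rho>_def s_def)
  have dgA: "cut_size E g A = cut_size (E - {e}) g A + of_bool ((?x \<in> A) \<noteq> (?y \<in> A))" for A
    using cut_size_insert[of "E - {e}" e g A] e D(4) by (simp add: insert_absorb)
  have root: "\<not> meets g z e" using e by (auto simp: meets_def)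
  have netz: "net E g (\<rho> b) {z} = net E g \<sigma>0 {z}" for b
    by (rule net_cong[OF D(4)]) (use root in \<open>auto simp: crossing_def meets_def \<rho>_def\<close>)
  have eqz: "insert z (V - {z}) = V" using D(2) by auto
  let ?g = "relabel (merge {z} z) g"
  have g: "?g = g" by (auto simp: relabel_def merge_def fun_eq_iff)
  let ?\<beta> = "\<lambda>b. merged_demand {z} z {e} g \<beta> (\<rho> b)"
  have \<beta>: "?\<beta> b v = \<beta> v - s b * (of_bool (?x = v) - of_bool (?y = v))" for b v
    by (auto simp: merged_demand_def net)
  let ?S = "\<lambda>b. sol V z (E - {e}) g (?\<beta> b) (\<rho> b)"
  have \<rho>z: "3 dvd net E g (\<rho> b) {v} - \<beta> v" if "v \<in> {z}" for b v using that netz D(7) by simp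
  have adm': "admissible feasible5 (insert z (V - {z})) z (E - {e}) ?g (?\<beta> b) (\<rho> b)" for b
  proof (rule admissible_merge[OF D(1,4,5,6)])
    show "root_feasible (cut_size (E - {e}) g {z}) (sum \<beta> {z} - net {e} g (\<rho> b) {z})"
      using D(8) dgA[of "{z}"] e net[of b "{z}"] by simp
    show "feasible5 (cut_size (E - {e}) g A) (sum \<beta> A - net {e} g (\<rho> b) A)" if A: "A \<noteq> {}" "A \<subset> V - {z}" for A
    proof (cases "(?x \<in> A) = (?y \<in> A)")
      case True
      then show ?thesis using dgA[of A] net[of b A] D(9)[OF A] by simp
    next
      case False
      have "finite A" using A D finite_subset by blast
      then have "free (cut_size E g A) (sum \<beta> A)" using A(1)
        by (rule singleton_or_card_ge_2) (use False x y free[OF A(2)] in auto)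
      then show ?thesis
        using free_minus1[of "cut_size (E - {e}) g A" "sum \<beta> A"] dgA[of A] net[of b A] False
        by (cases b; cases "?x \<in> A") (auto simp: s_def)
    qed
  qed (use D e \<rho>z in auto)
  have "size_of (insert z (V - {z})) z (E - {e}) ?g < size_of V z E g"
  proof (rule size_of_merge[OF D(1,4,5)])
    have "crossing {e} g {?x} = {e}" using e by (auto simp: crossing_def)
    then have "cut_size {e} g {?x} \<noteq> 0" by (simp add: cut_size_def)
    then show "{z} \<noteq> {z} \<or> (\<exists>v\<in>V - {z}. cut_size {e} g {v} \<noteq> 0)" using xyV by blast
  qed (use D e in auto)
  then have L: "2 powr (weight V z (E - {e}) g (?\<beta> b) / 12) \<le> real (card (?S b))" for b
    using IH[OF adm'[of b]] n unfolding eqz g by simp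
  have w: "weight V z E g \<beta> - 12 \<le> weight V z (E - {e}) g (?\<beta> b)" for b
  proof -
    let ?w = "\<lambda>v. if free (cut_size E g {v}) (\<beta> v) then 1 else -5 :: real"
    let ?w' = "\<lambda>v. if free (cut_size (E - {e}) g {v}) (?\<beta> b v) then 1 else -5 :: real"
    have "?w v - (of_bool (v = ?x) * 6 + of_bool (v = ?y) * 6) \<le> ?w' v" for v
    proof (cases "v = ?x \<or> v = ?y")
      case True
      then have "6 \<le> of_bool (v = ?x) * 6 + of_bool (v = ?y) * (6 :: real)"
        unfolding of_bool_def by argo
      moreover have "?w v \<le> 1" "-5 \<le> ?w' v" by simp_all
      ultimately show ?thesis by linarith
    next
      case False
      then have "cut_size E g {v} = cut_size (E - {e}) g {v}" "?\<beta> b v = \<beta> v"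
        unfolding \<beta> dgA[of "{v}"] by auto
      then have eq: "?w' v = ?w v" by (simp only:)
      have "0 \<le> of_bool (v = ?x) * 6 + of_bool (v = ?y) * (6 :: real)"
      proof -
        have "0 \<le> of_bool b * (6 :: real)" for b by (cases b) simp_all
        then show ?thesis by (intro add_nonneg_nonneg)
      qed
      then show ?thesis unfolding eq by linarith
    qed
    then have "(\<Sum>v\<in>V - {z}. ?w v - (of_bool (v = ?x) * 6 + of_bool (v = ?y) * 6)) \<le> (\<Sum>v\<in>V - {z}. ?w' v)"
      by (rule sum_mono)
    moreover have "(\<Sum>v\<in>V - {z}. of_bool (v = u) * 6 :: real) = 6" if "u \<in> V - {z}" for u
    proof -
      have "(\<Sum>v\<in>V - {z}. of_bool (v = u) * 6 :: real) = (\<Sum>v\<in>V - {z}. if v = u then 6 else 0)"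
        by (rule sum.cong) auto
      then show ?thesis using that D(1) by simp
    qed
    ultimately show ?thesis
      using xyV by (simp add: weight_def sum_subtractf sum.distrib)
  qed
  have half: "2 powr (weight V z E g \<beta> / 12) / 2 \<le> real (card (?S b))" for b
  proof -
    have "2 powr (weight V z E g \<beta> / 12) / 2 = 2 powr ((weight V z E g \<beta> - 12) / 12)"
      by (simp add: diff_divide_distrib powr_diff)
    also have "\<dots> \<le> 2 powr (weight V z (E - {e}) g (?\<beta> b) / 12)"
      using w[of b] by (intro powr_mono) auto
    finally show ?thesis using L[of b] by simp
  qed
  let ?f = "\<lambda>b. glue {e} (\<rho> b)"
  have sub: "?f b ` ?S b \<subseteq> sol V z E g \<beta> \<sigma>0" for b
  proof clarify
    fix \<sigma> assume "\<sigma> \<in> ?S b"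
    then show "?f b \<sigma> \<in> sol V z E g \<beta> \<sigma>0"
      by (intro sol_merge[OF D(1,4,5), where C = "{z}"])
        (use D e \<rho>z root in \<open>auto simp: insert_absorb g \<rho>_def\<close>)
  qed
  have inj: "inj_on (?f b) (?S b)" for b by (rule inj_on_glue)
  have disj: "?f True ` ?S True \<inter> ?f False ` ?S False = {}"
  proof -
    have "?f True \<sigma> \<noteq> ?f False \<tau>" for \<sigma> \<tau>
      by (auto simp: glue_def \<rho>_def fun_eq_iff intro!: exI[of _ e])
    then show ?thesis by blast
  qed
  have fin: "finite (sol V z E g \<beta> \<sigma>0)" using D(4) by (rule finite_sol)
  have "card (?f True ` ?S True \<union> ?f False ` ?S False) = card (?S True) + card (?S False)"
    using disj sub fin inj by (subst card_Un_disjoint) (auto simp: card_image dest: finite_subset)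
  moreover have "card (?f True ` ?S True \<union> ?f False ` ?S False) \<le> card (sol V z E g \<beta> \<sigma>0)"
    using sub fin by (intro card_mono) auto
  ultimately have "real (card (?S True)) + real (card (?S False)) \<le> real (card (sol V z E g \<beta> \<sigma>0))"
    by linarith
  then show ?thesis using half[of True] half[of False] by simp
qed

section \<open>A second solution from three parallel edges\<close>

definition flip :: "'e set \<Rightarrow> ('e \<Rightarrow> bool) \<Rightarrow> 'e \<Rightarrow> bool" where
  "flip F \<sigma> e = (if e \<in> F then \<not> \<sigma> e else \<sigma> e)"

lemma net_flip:
  assumes "finite E" "F \<subseteq> E"
  shows "net E g (flip F \<sigma>) A = net E g \<sigma> A - 2 * net F g \<sigma> A"
proof -
  have "net (E - F) g (flip F \<sigma>) A = net (E - F) g \<sigma> A"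
    by (rule net_cong) (use assms in \<open>auto simp: crossing_def flip_def\<close>)
  moreover have "net F g (flip F \<sigma>) A = net F g (\<lambda>e. \<not> \<sigma> e) A"
    by (rule net_cong) (use assms finite_subset in \<open>auto simp: crossing_def flip_def\<close>)
  moreover have "net F g (\<lambda>e. \<not> \<sigma> e) A = - net F g \<sigma> A" by (rule net_Not)
  ultimately show ?thesis
    using net_diff[OF assms, of g \<sigma> A] net_diff[OF assms, of g "flip F \<sigma>" A] by simp
qed

lemma sol_flip:
  assumes \<sigma>: "\<sigma> \<in> sol V z E g \<beta> \<sigma>0" and E: "finite E" "F \<subseteq> E" "F \<noteq> {}"
    and F: "\<And>e. e \<in> F \<Longrightarrow> \<not> meets g z e" "\<And>v. v \<in> V \<Longrightarrow> 3 dvd net F g \<sigma> {v}"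
  shows "flip F \<sigma> \<in> sol V z E g \<beta> \<sigma>0" "flip F \<sigma> \<noteq> \<sigma>"
proof -
  have "3 dvd net E g (flip F \<sigma>) {v} - \<beta> v" if "v \<in> V" for v
  proof -
    have "3 dvd net E g \<sigma> {v} - \<beta> v" using \<sigma> that by (auto simp: sol_def)
    then have "3 dvd (net E g \<sigma> {v} - \<beta> v) - 2 * net F g \<sigma> {v}"
      using F(2)[OF that] by (rule dvd_diff[OF _ dvd_mult])
    moreover have "net E g (flip F \<sigma>) {v} - \<beta> v = (net E g \<sigma> {v} - \<beta> v) - 2 * net F g \<sigma> {v}"
      unfolding net_flip[OF E(1,2)] by simp
    ultimately show ?thesis by (simp only:)
  qed
  then show "flip F \<sigma> \<in> sol V z E g \<beta> \<sigma>0"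
    using \<sigma> E(2) F(1) by (auto simp: sol_def flip_def PiE_def extensional_def)
  obtain e where "e \<in> F" using E by blast
  then show "flip F \<sigma> \<noteq> \<sigma>" by (auto simp: flip_def fun_eq_iff intro!: exI[of _ e])
qed

text \<open>Of three parallel edges either two run in opposite directions or all three in the same
  one. Their net at \<open>x\<close> is 0 in the first case and 3 or -3 in the second, so reversing
  them preserves every net modulo 3.\<close>

lemma two_sols_if_three_parallel:
  assumes ne: "sol V z E g \<beta> \<sigma>0 \<noteq> {}" and E: "finite E"
    and M: "3 \<le> card (crossing E g {x} \<inter> crossing E g {y})" and xy: "x \<noteq> z" "y \<noteq> z" "x \<noteq> y"
  shows "2 \<le> card (sol V z E g \<beta> \<sigma>0)"
proof -
  let ?M = "crossing E g {x} \<inter> crossing E g {y}"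
  obtain \<sigma> where \<sigma>: "\<sigma> \<in> sol V z E g \<beta> \<sigma>0" using ne by blast
  obtain T where T: "T \<subseteq> ?M" "card T = 3"
    using obtain_subset_with_card_n[OF M] by metis
  then obtain e1 e2 e3 where e: "T = {e1, e2, e3}" "e1 \<noteq> e2" "e1 \<noteq> e3" "e2 \<noteq> e3"
    by (auto simp: card_3_iff)
  have o: "outflow g \<sigma> {x} h = 1 \<or> outflow g \<sigma> {x} h = -1" if "h \<in> T" for h
    using that T by (intro outflow_crossing[of _ E]) auto
  have "\<exists>F\<subseteq>T. F \<noteq> {} \<and> 3 dvd net F g \<sigma> {x}"
  proof -
    let ?o = "outflow g \<sigma> {x}"
    have 2: "net {e1, e2} g \<sigma> {x} = ?o e1 + ?o e2" "net {e1, e3} g \<sigma> {x} = ?o e1 + ?o e3"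
      "net {e2, e3} g \<sigma> {x} = ?o e2 + ?o e3" "net {e1, e2, e3} g \<sigma> {x} = ?o e1 + (?o e2 + ?o e3)"
      using e by (simp_all add: net_def)
    have "3 dvd ?o e1 + ?o e2 \<or> 3 dvd ?o e1 + ?o e3 \<or> 3 dvd ?o e1 + (?o e2 + ?o e3)"
      using o[of e1] o[of e2] o[of e3] e by auto
    then show ?thesis
    proof (elim disjE)
      assume "3 dvd ?o e1 + ?o e2"
      then show ?thesis using 2 e(1) by (intro exI[of _ "{e1, e2}"]) auto
    next
      assume "3 dvd ?o e1 + ?o e3"
      then show ?thesis using 2 e(1) by (intro exI[of _ "{e1, e3}"]) auto
    next
      assume "3 dvd ?o e1 + (?o e2 + ?o e3)"
      then show ?thesis using 2 e(1) by (intro exI[of _ "{e1, e2, e3}"]) auto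
    qed
  qed
  then obtain F where F: "F \<subseteq> T" "F \<noteq> {}" "3 dvd net F g \<sigma> {x}" by blast
  have FM: "F \<subseteq> ?M" using F T by auto
  have "net F g \<sigma> {y} = - net F g \<sigma> {x}"
    unfolding net_def sum_negf[symmetric]
    by (rule sum.cong) (use FM xy in \<open>auto simp: outflow_def crossing_def\<close>)
  moreover have "net F g \<sigma> {v} = 0" if "v \<noteq> x" "v \<noteq> y" for v
    unfolding net_def by (rule sum.neutral) (use FM xy that in \<open>auto simp: outflow_def crossing_def\<close>)
  ultimately have "3 dvd net F g \<sigma> {v}" for v
    using F(3) by (cases "v = x"; cases "v = y") auto
  moreover have "\<not> meets g z h" if "h \<in> F" for h
    using that FM xy by (auto simp: meets_def crossing_def)
  moreover have "F \<subseteq> E" using FM by (auto simp: crossing_def)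
  ultimately have "flip F \<sigma> \<in> sol V z E g \<beta> \<sigma>0" "flip F \<sigma> \<noteq> \<sigma>"
    using sol_flip[OF \<sigma> E _ F(2)] by blast+
  then have "card {\<sigma>, flip F \<sigma>} \<le> card (sol V z E g \<beta> \<sigma>0)"
    using \<sigma> finite_sol[OF E] by (intro card_mono) auto
  then show ?thesis using \<open>flip F \<sigma> \<noteq> \<sigma>\<close> by (metis card_2_iff)
qed

text \<open>For three vertices of which \<open>y\<close> is free and \<open>x\<close> is not,
  \<open>m\<close> counts the edges between \<open>x\<close> and \<open>y\<close>. If
  \<open>m\<close> is less than 3, then \<open>x\<close>, \<open>y\<close> and the root have 5, 6
  and 7 edges; the last two have demand 0 modulo 3, hence also \<open>x\<close>, which is impossible
  as it is feasible but not free.\<close>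

lemma three_parallel_arith:
  assumes "feasible5 dx bx" "\<not> free dx bx" "free dy by" "root_feasible dz bz"
    "dx + dy = dz + 2 * m" "3 dvd bz + bx + by"
  shows "3 \<le> m"
proof (rule ccontr)
  assume "\<not> 3 \<le> m"
  then have le: "dx + dy \<le> dz + 4" using assms(5) by simp
  have x: "dx = 5 \<or> dx = 6" "\<not> 3 dvd bx" using assms(1,2) by (auto simp: feasible5_def free_def)
  have y: "6 \<le> dy" "dy = 6 \<Longrightarrow> 3 dvd by" using assms(3) by (auto simp: free_def)
  have "dz \<le> 7" using root_feasible_le_7[OF assms(4)] .
  then have d: "dx = 5" "dy = 6" "dz = 7" using le x y assms(5) by presburger+
  then have "3 dvd bz" "3 dvd by" using assms(4) y by (auto simp: root_feasible_def)
  then show False using assms(6) x(2) by presburger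
qed

text \<open>\<open>p\<close> is the cut of \<open>x\<close> together with the first of two
  nonadjacent free vertices. If it were 6, then \<open>bx + b1\<close> would be 0 modulo 3, so
  \<open>b1\<close> would not, and \<open>d1\<close> would be at least 7. The degree bound then
  forces \<open>d1 = 7\<close> and \<open>dx = 6\<close>, where \<open>p\<close> is odd.\<close>

lemma two_free_arith:
  assumes "free d1 b1" "free d2 b2" "d1 + d2 \<le> dx + dz" "dx \<le> 6" "\<not> 3 dvd bx" "root_feasible dz bz"
    "free p (bx + b1)" "p + 2 * a = dx + d1"
  shows "7 \<le> p"
proof (rule ccontr)
  assume "\<not> 7 \<le> p"
  then have p: "p = 6" "3 dvd bx + b1" using assms(7) by (auto simp: free_def)
  then have "\<not> 3 dvd b1" using assms(5) by presburger
  then have "7 \<le> d1" "6 \<le> d2" using assms(1,2) by (auto simp: free_def)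
  then have "dx + d1 = 13" using assms(3,4) root_feasible_le_7[OF assms(6)] by linarith
  then show False using assms(8) p by presburger
qed

theorem card_sol_ge:
  fixes E :: "'e set"
  assumes "admissible feasible5 V z E g \<beta> \<sigma>0"
  shows "2 powr (weight V z E g \<beta> / 12) \<le> real (card (sol V z E g \<beta> \<sigma>0))"
  using assms
proof (induction "size_of V z E g" arbitrary: V E g \<beta> \<sigma>0 rule: less_induct)
  case less
  have IH: "2 powr (weight V' z E' g' \<beta>' / 12) \<le> real (card (sol V' z E' g' \<beta>' \<sigma>'))"
    if "admissible feasible5 V' z E' g' \<beta>' \<sigma>'" "size_of V' z E' g' < size_of V z E g"
    for V' and E' :: "'e set" and g' \<beta>' \<sigma>'
    using less.hyps that by blast
  note adm = less.prems
  note D = admissibleD[OF adm]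
  show ?case
  proof (rule ccontr)
    assume none: "\<not> ?case"
    let ?d = "\<lambda>v. cut_size E g {v}"
    have free: "free (cut_size E g A) (sum \<beta> A)" if "A \<subset> V - {z}" "2 \<le> card A" for A
      using count_by_collapse[OF IH adm order_refl that] none by blast
    define U where "U = {v \<in> V - {z}. free (?d v) (\<beta> v)}"
    define S where "S = {v \<in> V - {z}. \<not> free (?d v) (\<beta> v)}"
    have fin: "finite U" "finite S" and US: "U \<union> S = V - {z}" "U \<inter> S = {}"
      using D(1) by (auto simp: U_def S_def)
    have cUS: "card U + card S = card V - 1"
      using card_Un_disjoint[OF fin US(2)] US(1) D by simp
    have VB: "V - {z} \<noteq> {v}" for v
    proof
      assume "V - {z} = {v}"
      then have "card (V - {z}) = 1" by simp
      then show False using D by simp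
    qed
    have ok5v: "feasible5 (?d v) (\<beta> v)" if "v \<in> V - {z}" for v
      using D(9)[of "{v}"] that VB[of v] by auto
    have dS: "?d v \<le> 6" "\<not> 3 dvd \<beta> v" if "v \<in> S" for v
      using that ok5v[of v] by (auto simp: S_def free_def feasible5_def)
    have dU: "6 \<le> ?d v" if "v \<in> U" for v
      using that by (auto simp: U_def free_def)
    have indep: "fst (g e) \<notin> U \<or> snd (g e) \<notin> U" if "e \<in> E" "fst (g e) \<noteq> snd (g e)" for e
      using count_by_deletion[OF IH adm order_refl free that] none by (auto simp: U_def)
    \<comment> \<open>Free vertices are pairwise nonadjacent, so each edge that leaves a vertex of
      \<open>U\<close> ends in \<open>S\<close> or at the root.\<close>
    have degs: "(\<Sum>v\<in>U. ?d v) \<le> (\<Sum>v\<in>S. ?d v) + ?d z"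
    proof -
      have "(\<Sum>v\<in>U. ?d v) = card (\<Union>v\<in>U. crossing E g {v})"
        unfolding cut_size_def
        by (rule card_UN_disjoint[symmetric]) (use fin D(4) indep in \<open>auto simp: crossing_def\<close>)
      also have "\<dots> \<le> card ((\<Union>v\<in>S. crossing E g {v}) \<union> crossing E g {z})"
      proof (rule card_mono)
        show "(\<Union>v\<in>U. crossing E g {v}) \<subseteq> (\<Union>v\<in>S. crossing E g {v}) \<union> crossing E g {z}"
          using indep D(5) US by (fastforce simp: crossing_def)
      qed (use fin D(4) in auto)
      also have "\<dots> \<le> card (\<Union>v\<in>S. crossing E g {v}) + ?d z"
        unfolding cut_size_def by (rule card_Un_le)
      also have "card (\<Union>v\<in>S. crossing E g {v}) \<le> (\<Sum>v\<in>S. ?d v)"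
        unfolding cut_size_def by (rule card_UN_le[OF fin(2)])
      finally show ?thesis by simp
    qed
    moreover have "6 * card U \<le> (\<Sum>v\<in>U. ?d v)"
      using sum_mono[of U "\<lambda>_. 6" ?d] dU by simp
    moreover have "(\<Sum>v\<in>S. ?d v) \<le> 6 * card S"
      using sum_mono[of S ?d "\<lambda>_. 6"] dS by simp
    ultimately have cU: "card U \<le> card S + 1" using root_feasible_le_7[OF D(8)] by linarith
    have weight: "weight V z E g \<beta> = 5 + real (card U) - 5 * real (card S)"
    proof -
      have "(\<Sum>v\<in>V - {z}. if free (?d v) (\<beta> v) then 1 else -5 :: real) =
          (\<Sum>v\<in>U. 1) + (\<Sum>v\<in>S. -5)"
        unfolding US(1)[symmetric] sum.union_disjoint[OF fin US(2)]
        by (intro arg_cong2[of _ _ _ _ "(+)"] sum.cong) (auto simp: U_def S_def)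
      then show ?thesis by (simp add: weight_def)
    qed
    have ne: "sol V z E g \<beta> \<sigma>0 \<noteq> {}" using sol_exists[OF admissible_feasible5_imp_feasible[OF adm]] .
    then have "card (sol V z E g \<beta> \<sigma>0) \<noteq> 0" using finite_sol[OF D(4)] by (simp add: card_gt_0_iff)
    then have N1: "1 \<le> real (card (sol V z E g \<beta> \<sigma>0))" by linarith
    \<comment> \<open>For weight at most 0 a single solution is enough, and it exists. Positive
      weight, the bound on \<open>card U\<close> and the presence of three vertices leave exactly
      one vertex in \<open>S\<close> and one or two in \<open>U\<close>.\<close>
    have "0 < weight V z E g \<beta>"
    proof (rule ccontr)
      assume "\<not> ?thesis"
      then have "2 powr (weight V z E g \<beta> / 12) \<le> 2 powr 0" by (intro powr_mono) auto
      then show False using N1 none by simp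
    qed
    then have "5 * card S < 5 + card U" unfolding weight by linarith
    then have S1: "card S = 1" "card U = 1 \<or> card U = 2" using cU cUS D(3) by linarith+
    then obtain x where x: "S = {x}" using card_1_singletonE by blast
    have xV: "x \<in> V - {z}" using x S_def by auto
    have "card U \<noteq> 1"
    proof
      assume "card U = 1"
      then obtain y where y: "U = {y}" using card_1_singletonE by blast
      have yV: "y \<in> V - {z}" "y \<noteq> x" using y x U_def US by auto
      have B: "V - {z} = {x, y}" using US x y by auto
      have V: "V = {z, x, y}" using D(2) B by auto
      have "sum \<beta> V = \<beta> z + \<beta> x + \<beta> y"
        using xV yV unfolding V by simp
      moreover have "?d x + ?d y = ?d z + 2 * card (crossing E g {x} \<inter> crossing E g {y})"
        using cut_size_Un[OF D(4), of "{x}" "{y}" g] cut_size_compl[OF D(5), of "{z}"] B yV(2)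
        by (simp add: insert_commute)
      ultimately have "3 \<le> card (crossing E g {x} \<inter> crossing E g {y})"
        using ok5v[OF xV] D(6,8) x y S_def U_def
        by (intro three_parallel_arith[of "?d x" "\<beta> x" "?d y" "\<beta> y" "?d z" "\<beta> z"]) auto
      then have "2 \<le> card (sol V z E g \<beta> \<sigma>0)"
        using two_sols_if_three_parallel[OF ne D(4)] xV yV by auto
      moreover have "2 powr (weight V z E g \<beta> / 12) \<le> 2 powr 1"
        unfolding weight S1(1) using \<open>card U = 1\<close> by (intro powr_mono) auto
      ultimately show False using none by simp
    qed
    then have "card U = 2" using S1 by simp
    then obtain y1 y2 where y: "U = {y1, y2}" "y1 \<noteq> y2" by (auto simp: card_2_iff)
    have yV: "y1 \<in> V - {z}" "y2 \<in> V - {z}" "y1 \<noteq> x" "y2 \<noteq> x" using y x U_def US by auto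
    have B: "V - {z} = {x, y1, y2}" using US x y by auto
    have fy: "free (?d y1) (\<beta> y1)" "free (?d y2) (\<beta> y2)" using y U_def by auto
    have dle: "?d y1 + ?d y2 \<le> ?d x + ?d z" using degs x y by simp
    have pair: "cut_size E g {x, v} + 2 * card (crossing E g {x} \<inter> crossing E g {v}) = ?d x + ?d v"
      if "v \<noteq> x" for v
      using cut_size_Un[OF D(4), of "{x}" "{v}" g] that by (simp add: insert_commute)
    \<comment> \<open>Since \<open>y1\<close> and \<open>y2\<close> are not adjacent, the cuts of
      \<open>{x, y1}\<close> and \<open>{x, y2}\<close> add up to the degrees of \<open>x\<close>
      and the root, at most 13, although each of them turns out to be at least 7.\<close>
    have "cut_size E g {x, y1} + ?d y2 = ?d z + 2 * card (crossing E g {x, y1} \<inter> crossing E g {y2})"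
    proof -
      have "{x, y1} \<union> {y2} = V - {z}" using B by auto
      then show ?thesis
        using cut_size_Un[OF D(4), of "{x, y1}" "{y2}" g] cut_size_compl[OF D(5), of "{z}"] y(2) yV by simp
    qed
    moreover have "crossing E g {x, y1} \<inter> crossing E g {y2} = crossing E g {x} \<inter> crossing E g {y2}"
      using indep y yV by (auto simp: crossing_def)
    ultimately have pq: "cut_size E g {x, y1} + cut_size E g {x, y2} = ?d x + ?d z"
      using pair[of y2] yV by simp
    have sub: "{x, y1} \<subset> V - {z}" "{x, y2} \<subset> V - {z}" unfolding B using y(2) yV by auto
    have fp: "free (cut_size E g {x, y1}) (\<beta> x + \<beta> y1)" "free (cut_size E g {x, y2}) (\<beta> x + \<beta> y2)"
      using free[OF sub(1)] free[OF sub(2)] yV by auto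
    have xS: "x \<in> S" using x by simp
    have "7 \<le> cut_size E g {x, y1}"
      by (rule two_free_arith[OF fy dle dS[OF xS] D(8) fp(1) pair]) (use yV in auto)
    moreover have "7 \<le> cut_size E g {x, y2}"
      by (rule two_free_arith[OF fy(2,1) _ dS[OF xS] D(8) fp(2) pair]) (use yV dle in auto)
    ultimately show False using pq dS(1)[OF xS] root_feasible_le_7[OF D(8)] by linarith
  qed
qed

section \<open>Flows of 6-edge-connected graphs\<close>

definition ends :: "('v, 'e) pre_digraph \<Rightarrow> 'e \<Rightarrow> 'v \<times> 'v" where
  "ends G e = (tail G e, head G e)"

lemma z3_conserved_at_iff:
  assumes "finite (arcs G)"
  shows "z3_conserved_at G \<sigma> u \<longleftrightarrow> 3 dvd net (arcs G) (ends G) \<sigma> {u}"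
proof -
  have "int (card {e \<in> arcs G. P e}) = (\<Sum>e\<in>arcs G. of_bool (P e))" for P
    using assms by (simp add: of_bool_def sum.If_cases Int_def)
  then have "int (out_degree (orient G \<sigma>) u) - int (in_degree (orient G \<sigma>) u) =
      net (arcs G) (ends G) \<sigma> {u}"
    unfolding out_degree_def in_degree_def out_arcs_def in_arcs_def net_def
    by (simp add: orient_def sum_subtractf[symmetric]) (auto simp: outflow_def ends_def intro!: sum.cong)
  then show ?thesis by (simp add: z3_conserved_at_def cong_0_iff)
qed

lemma edge_connected_imp_cut_size_ge:
  assumes "fin_digraph G" "edge_connected k G" "A \<noteq> {}" "A \<subset> verts G"
  shows "k \<le> cut_size (arcs G) (ends G) A"
proof (rule ccontr)
  interpret fin_digraph G by fact
  let ?F = "crossing (arcs G) (ends G) A"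
  assume "\<not> ?thesis"
  then have "connected (G\<lparr>arcs := arcs G - ?F\<rparr>)"
    using assms(2) by (auto simp: edge_connected_def cut_size_def crossing_def)
  moreover obtain u v where uv: "u \<in> A" "v \<in> verts G" "v \<notin> A" using assms(3,4) by auto
  ultimately have "(u, v) \<in> rtrancl_on (verts G) ((arcs_ends (G\<lparr>arcs := arcs G - ?F\<rparr>))\<^sup>s)"
    using assms(4) by (auto simp: connected_conv)
  then have "v \<in> A"
    by (induction rule: rtrancl_on_induct)
      (use uv in \<open>auto simp: symcl_def arcs_ends_conv crossing_def ends_def\<close>)
  then show False using uv by simp
qed

lemma card_flows_ge:
  assumes G: "fin_digraph G" and n: "2 \<le> card (verts G)" and ec: "edge_connected 6 G"
  shows "2 powr ((real (card (verts G)) + 5) / 12) \<le> real (card (nz_z3_flows G))"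
proof -
  interpret fin_digraph G by fact
  \<comment> \<open>an additional isolated vertex serves as the root\<close>
  let ?E = "arcs G" and ?V = "insert None (Some ` verts G)"
  define g where "g e = (Some (tail G e), Some (head G e))" for e
  let ?\<beta> = "\<lambda>_. 0 :: int" and ?\<sigma> = "\<lambda>_. True"
  have cut_size: "cut_size ?E g A = cut_size ?E (ends G) {v. Some v \<in> A}" for A
    by (simp add: cut_size_def crossing_def g_def ends_def)
  have net: "net ?E g \<sigma> A = net ?E (ends G) \<sigma> {v. Some v \<in> A}" for \<sigma> A
    by (simp add: net_def outflow_def g_def ends_def)
  have eqV: "?V - {None} = Some ` verts G" by auto
  have dg6: "6 \<le> cut_size ?E g A" if "A \<noteq> {}" "A \<subset> Some ` verts G" for A
    unfolding cut_size
  proof (rule edge_connected_imp_cut_size_ge[OF G ec])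
    show "{v. Some v \<in> A} \<noteq> {}" "{v. Some v \<in> A} \<subset> verts G" using that by auto
  qed
  have root: "cut_size ?E g {None} = 0" "net ?E g \<sigma> {None} = 0" for \<sigma>
    unfolding cut_size net by (simp_all add: cut_size_def crossing_def net_def outflow_def)
  have "admissible feasible5 ?V None ?E g ?\<beta> ?\<sigma>"
    unfolding admissible_def eqV root
  proof (intro conjI allI impI)
    show "3 \<le> card ?V" using n by (simp add: card_image)
    show "feasible5 (cut_size ?E g A) (sum ?\<beta> A)" if "A \<noteq> {}" "A \<subset> Some ` verts G" for A
      using dg6[OF that] by (simp add: feasible5_def)
  qed (auto simp: g_def root_feasible_def)
  then have "2 powr (weight ?V None ?E g ?\<beta> / 12) \<le> real (card (sol ?V None ?E g ?\<beta> ?\<sigma>))"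
    by (rule card_sol_ge)
  moreover have "weight ?V None ?E g ?\<beta> = 5 + real (card (verts G))"
  proof -
    have "free (cut_size ?E g {v}) 0" if "v \<in> Some ` verts G" for v
    proof -
      have "{v} \<noteq> Some ` verts G"
      proof
        assume "{v} = Some ` verts G"
        then have "card (Some ` verts G) = 1" by (metis is_singletonI is_singleton_altdef)
        then show False using n by (simp add: card_image)
      qed
      then have "6 \<le> cut_size ?E g {v}" using that by (intro dg6) auto
      then show ?thesis by (auto simp: free_def)
    qed
    then show ?thesis unfolding weight_def eqV by (simp add: card_image)
  qed
  moreover have "sol ?V None ?E g ?\<beta> ?\<sigma> = nz_z3_flows G"
  proof -
    have "\<not> meets g None e" for e by (simp add: meets_def g_def)
    moreover have "net ?E g \<sigma> {Some v} = net ?E (ends G) \<sigma> {v}" for \<sigma> v unfolding net by simp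
    ultimately show ?thesis
      by (auto simp: sol_def nz_z3_flows_def orientations_def z3_conserved_at_iff root)
  qed
  ultimately show ?thesis by (simp add: add.commute)
qed

section \<open>Flows that extend a prescribed orientation at a vertex\<close>

lemma extending_flows_eq_sol:
  assumes "finite (arcs G)"
  shows "{\<sigma> \<in> nz_z3_flows G. extends_on (incident_arcs G v) \<sigma> \<tau>} =
    sol (verts G) v (arcs G) (ends G) (\<lambda>_. 0) \<tau>"
  using assms
  by (auto simp: sol_def nz_z3_flows_def orientations_def z3_conserved_at_iff extends_on_def
      incident_arcs_def meets_def ends_def)

lemma cut_size_le_degree: "finite (arcs G) \<Longrightarrow> cut_size (arcs G) (ends G) {v} \<le> degree G v"
proof -
  assume fin: "finite (arcs G)"
  have "cut_size (arcs G) (ends G) {v} \<le> card (in_arcs G v \<union> out_arcs G v)"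
    unfolding cut_size_def using fin
    by (intro card_mono) (auto simp: crossing_def ends_def in_arcs_def out_arcs_def)
  also have "\<dots> \<le> degree G v"
    unfolding degree_def in_degree_def out_degree_def by (rule card_Un_le)
  finally show ?thesis .
qed

text \<open>This covers \<open>n = 2\<close>, since \<open>admissible\<close> asks for three
  vertices. All edges but the loops at \<open>w\<close> are prescribed, conservation passes from
  \<open>z\<close> to \<open>w\<close>, and the bound demands only one solution.\<close>

lemma sol_two_vertices:
  assumes "V = {z, w}" "finite E" "\<forall>e\<in>E. fst (g e) \<in> V \<and> snd (g e) \<in> V"
    and "3 dvd net E g \<sigma>0 {z}"
  shows "sol V z E g (\<lambda>_. 0) \<sigma>0 \<noteq> {}"
proof -
  let ?\<sigma> = "restrict \<sigma>0 E"
  have z: "net E g ?\<sigma> {z} = net E g \<sigma>0 {z}"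
    by (rule net_cong) (use assms in \<open>auto simp: crossing_def\<close>)
  have "net E g ?\<sigma> {v} = 0 \<or> net E g ?\<sigma> {v} = - net E g ?\<sigma> {z}" if "v \<in> V - {z}" for v
  proof -
    have "V - {z} = {v}" using that assms(1) by auto
    then show ?thesis using net_compl[OF assms(3), of ?\<sigma> "{z}"] by simp
  qed
  then have "3 dvd net E g ?\<sigma> {v}" if "v \<in> V" for v
    using that assms(4) z by (cases "v = z") force+
  then have "?\<sigma> \<in> sol V z E g (\<lambda>_. 0) \<sigma>0" by (auto simp: sol_def)
  then show ?thesis by blast
qed

lemma card_extending_flows_ge:
  assumes G: "fin_digraph G" and n: "2 \<le> card (verts G)" and ec: "edge_connected 6 G"
    and deg: "degree G z \<le> 7" and z: "z \<in> verts G" and \<tau>: "z3_conserved_at G \<tau> z"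
  shows "2 powr ((real (card (verts G)) - 2) / 12) \<le>
    real (card {\<sigma> \<in> nz_z3_flows G. extends_on (incident_arcs G z) \<sigma> \<tau>})"
proof -
  interpret fin_digraph G by fact
  let ?E = "arcs G" and ?V = "verts G" and ?g = "ends G" and ?\<beta> = "\<lambda>_. 0 :: int"
  have fin: "finite ?E" "finite ?V" by simp_all
  have wf: "\<forall>e\<in>?E. fst (?g e) \<in> ?V \<and> snd (?g e) \<in> ?V" by (simp add: ends_def)
  have netz: "3 dvd net ?E ?g \<tau> {z}" using \<tau> fin by (simp add: z3_conserved_at_iff)
  have dg6: "6 \<le> cut_size ?E ?g A" if "A \<noteq> {}" "A \<subset> ?V" for A
    using edge_connected_imp_cut_size_ge[OF G ec that] .
  have sv: "{v} \<subset> ?V" if "v \<in> ?V" for v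
  proof -
    have "?V \<noteq> {v}" using n by auto
    then show ?thesis using that by auto
  qed
  have dz: "6 \<le> cut_size ?E ?g {z}" "cut_size ?E ?g {z} \<le> 7"
    using dg6[of "{z}"] sv[OF z] cut_size_le_degree[OF fin(1), of z] deg by auto
  have freeA: "free (cut_size ?E ?g A) 0" if "A \<noteq> {}" "A \<subset> ?V" for A
    using dg6[OF that] by (auto simp: free_def)
  show ?thesis unfolding extending_flows_eq_sol[OF fin(1)]
  proof (cases "card ?V = 2")
    case True
    then have "\<exists>w. ?V = {z, w}"
      using z unfolding card_2_iff by (metis insertE insert_commute singletonD)
    then obtain w where w: "?V = {z, w}" by blast
    have "sol ?V z ?E ?g ?\<beta> \<tau> \<noteq> {}" by (rule sol_two_vertices[OF w fin(1) wf netz])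
    then have "0 < card (sol ?V z ?E ?g ?\<beta> \<tau>)" using finite_sol[OF fin(1)] by (simp add: card_gt_0_iff)
    then show "2 powr ((real (card ?V) - 2) / 12) \<le> real (card (sol ?V z ?E ?g ?\<beta> \<tau>))"
      using True by simp
  next
    case False
    then have n3: "3 \<le> card ?V" using n by simp
    show "2 powr ((real (card ?V) - 2) / 12) \<le> real (card (sol ?V z ?E ?g ?\<beta> \<tau>))"
    proof (cases "cut_size ?E ?g {z} = 7")
      case True
      have "admissible feasible5 ?V z ?E ?g ?\<beta> \<tau>"
        unfolding admissible_def
      proof (intro conjI allI impI)
        show "feasible5 (cut_size ?E ?g A) (sum ?\<beta> A)" if "A \<noteq> {}" "A \<subset> ?V - {z}" for A
          using dg6[of A] that by (auto simp: feasible5_def)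
      qed (use n3 z netz wf True in \<open>auto simp: root_feasible_def\<close>)
      then have "2 powr (weight ?V z ?E ?g ?\<beta> / 12) \<le> real (card (sol ?V z ?E ?g ?\<beta> \<tau>))"
        by (rule card_sol_ge)
      moreover have "weight ?V z ?E ?g ?\<beta> = 5 + real (card (?V - {z}))"
        unfolding weight_def using freeA sv by simp
      moreover have "real (card (?V - {z})) = real (card ?V) - 1" using z n3 by simp
      ultimately have "2 powr ((real (card ?V) + 4) / 12) \<le> real (card (sol ?V z ?E ?g ?\<beta> \<tau>))"
        by (simp add: algebra_simps)
      moreover have "2 powr ((real (card ?V) - 2) / 12) \<le> 2 powr ((real (card ?V) + 4) / 12)"
        by (intro powr_mono) auto
      ultimately show ?thesis by linarith
    next
      case False
      \<comment> \<open>Six edges with demand 0 are too many for a root; after the deletion of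
        \<open>e\<close> five remain, which suit every demand.\<close>
      then have dz6: "cut_size ?E ?g {z} = 6" using dz by simp
      then have "crossing ?E ?g {z} \<noteq> {}" by (auto simp: cut_size_def)
      then obtain e where e: "e \<in> crossing ?E ?g {z}" by blast
      define w where "w = other ?g z e"
      have eE: "e \<in> ?E" and w: "w \<in> ?V - {z}"
        using e wf by (auto simp: crossing_def w_def other_def)
      have ends: "(fst (?g e) \<in> A) \<noteq> (snd (?g e) \<in> A) \<longleftrightarrow> (w \<in> A) \<noteq> (z \<in> A)" for A
        using e by (auto simp: crossing_def w_def other_def)
      have dgA: "cut_size ?E ?g A = cut_size (?E - {e}) ?g A + of_bool ((w \<in> A) \<noteq> (z \<in> A))" for A
      proof -
        have "cut_size ?E ?g A = cut_size (?E - {e}) ?g A + of_bool ((fst (?g e) \<in> A) \<noteq> (snd (?g e) \<in> A))"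
          using cut_size_insert[of "?E - {e}" e ?g A] eE fin(1) by (simp add: insert_absorb)
        then show ?thesis unfolding ends .
      qed
      have net1: "net {e} ?g \<tau> A = outflow ?g \<tau> A e" for A by (simp add: net_def)
      have \<tau>z: "3 dvd net ?E ?g \<tau> {v} - ?\<beta> v" if "v \<in> {z}" for v using that netz by simp
      let ?\<beta>' = "merged_demand {z} z {e} ?g ?\<beta> \<tau>"
      have "admissible feasible5 (insert z (?V - {z})) z (?E - {e}) (relabel (merge {z} z) ?g) ?\<beta>' \<tau>"
      proof (rule admissible_merge[OF fin(2,1) wf])
        show "2 \<le> card (?V - {z})" using n3 z by simp
        show "root_feasible (cut_size (?E - {e}) ?g {z}) (sum ?\<beta> {z} - net {e} ?g \<tau> {z})"
          using dgA[of "{z}"] dz6 w by (auto simp: root_feasible_def)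
        show "feasible5 (cut_size (?E - {e}) ?g A) (sum ?\<beta> A - net {e} ?g \<tau> A)"
          if A: "A \<noteq> {}" "A \<subset> ?V - {z}" for A
        proof (cases "w \<in> A")
          case True
          then have "e \<in> crossing ?E ?g A" using ends[of A] A eE by (auto simp: crossing_def)
          then have "net {e} ?g \<tau> A = 1 \<or> net {e} ?g \<tau> A = -1"
            unfolding net1 by (rule outflow_crossing)
          moreover have "free (cut_size (?E - {e}) ?g A + 1) 0"
          proof -
            have "A \<subset> ?V" "z \<notin> A" using A by auto
            then show ?thesis using freeA[OF A(1)] dgA[of A] True by simp
          qed
          ultimately show ?thesis using free_minus1[of "cut_size (?E - {e}) ?g A" 0] by auto
        next
          case False
          moreover have "A \<subset> ?V" "z \<notin> A" using A by auto
          ultimately have "6 \<le> cut_size (?E - {e}) ?g A" using dgA[of A] dg6[OF A(1)] by simp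
          then show ?thesis by (simp add: feasible5_def)
        qed
      qed (use z eE \<tau>z in auto)
      moreover have eqs: "insert z (?V - {z}) = ?V" "relabel (merge {z} z) ?g = ?g"
        using z by (auto simp: relabel_def merge_def fun_eq_iff)
      ultimately have "admissible feasible5 ?V z (?E - {e}) ?g ?\<beta>' \<tau>" by simp
      then have "2 powr (weight ?V z (?E - {e}) ?g ?\<beta>' / 12)
          \<le> real (card (sol ?V z (?E - {e}) ?g ?\<beta>' \<tau>))"
        by (rule card_sol_ge)
      also have "card (sol ?V z (?E - {e}) ?g ?\<beta>' \<tau>) \<le> card (sol ?V z ?E ?g ?\<beta> \<tau>)"
      proof (rule card_inj_on_le[OF inj_on_glue])
        show "glue {e} \<tau> ` sol ?V z (?E - {e}) ?g ?\<beta>' \<tau> \<subseteq> sol ?V z ?E ?g ?\<beta> \<tau>"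
        proof clarify
          fix \<sigma> assume "\<sigma> \<in> sol ?V z (?E - {e}) ?g ?\<beta>' \<tau>"
          then show "glue {e} \<tau> \<sigma> \<in> sol ?V z ?E ?g ?\<beta> \<tau>"
            by (intro sol_merge[OF fin(2,1) wf, where C = "{z}"]) (use z eE \<tau>z eqs in auto)
        qed
      qed (rule finite_sol[OF fin(1)])
      finally have "2 powr (weight ?V z (?E - {e}) ?g ?\<beta>' / 12)
          \<le> real (card (sol ?V z ?E ?g ?\<beta> \<tau>))" by simp
      \<comment> \<open>All vertices other than the root and \<open>w\<close> remain free, and the
        constant 5 pays for \<open>w\<close>.\<close>
      moreover have "real (card ?V) - 2 \<le> weight ?V z (?E - {e}) ?g ?\<beta>'"
      proof -
        let ?w = "\<lambda>v. if free (cut_size (?E - {e}) ?g {v}) (?\<beta>' v) then 1 else -5 :: real"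
        have "?w v = 1" if v: "v \<in> ?V - {z} - {w}" for v
        proof -
          have "cut_size ?E ?g {v} = cut_size (?E - {e}) ?g {v}" using dgA[of "{v}"] v by auto
          moreover have "?\<beta>' v = 0"
            using ends[of "{v}"] v by (auto simp: merged_demand_def net1 outflow_eq_0_iff)
          moreover have "free (cut_size ?E ?g {v}) 0" using sv[of v] v by (intro freeA) auto
          ultimately show ?thesis by simp
        qed
        then have "(\<Sum>v\<in>?V - {z} - {w}. ?w v) = (\<Sum>v\<in>?V - {z} - {w}. 1)" by (rule sum.cong[OF refl])
        moreover have "(\<Sum>v\<in>?V - {z}. ?w v) = ?w w + (\<Sum>v\<in>?V - {z} - {w}. ?w v)"
          by (rule sum.remove) (use w in auto)
        moreover have "-5 \<le> ?w w" by simp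
        moreover have "real (card (?V - {z} - {w})) = real (card ?V) - 2"
          using z w n3 by simp
        ultimately show ?thesis unfolding weight_def by simp
      qed
      then have "2 powr ((real (card ?V) - 2) / 12) \<le> 2 powr (weight ?V z (?E - {e}) ?g ?\<beta>' / 12)"
        by (intro powr_mono) auto
      ultimately show ?thesis by linarith
    qed
  qed
qed

theorem theorem23:
  fixes G :: "('v, 'e) pre_digraph"
  assumes "fin_digraph G"
    and "card (verts G) \<ge> 2"
    and "edge_connected 6 G"
  shows "real (card (nz_z3_flows G)) \<ge> 2 powr ((real (card (verts G)) - 2) / 12) \<and>
    (max_degree G \<le> 7 \<longrightarrow>
      (\<forall>v \<in> verts G. \<forall>\<tau> \<in> orientations (incident_arcs G v). z3_conserved_at G \<tau> v \<longrightarrow>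
         real (card {\<sigma> \<in> nz_z3_flows G. extends_on (incident_arcs G v) \<sigma> \<tau>})
           \<ge> 2 powr ((real (card (verts G)) - 2) / 12)))"
proof (intro conjI impI ballI)
  have "2 powr ((real (card (verts G)) - 2) / 12) \<le> 2 powr ((real (card (verts G)) + 5) / 12)"
    by (intro powr_mono) auto
  then show "real (card (nz_z3_flows G)) \<ge> 2 powr ((real (card (verts G)) - 2) / 12)"
    by (rule order_trans[OF _ card_flows_ge[OF assms]])
next
  fix v \<tau>
  assume "max_degree G \<le> 7" "v \<in> verts G" "z3_conserved_at G \<tau> v"
  moreover have "degree G v \<le> max_degree G"
    unfolding max_degree_def using \<open>v \<in> verts G\<close> fin_digraph.finite_verts[OF assms(1)] by simp
  ultimately show "real (card {\<sigma> \<in> nz_z3_flows G. extends_on (incident_arcs G v) \<sigma> \<tau>})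
           \<ge> 2 powr ((real (card (verts G)) - 2) / 12)"
    by (intro card_extending_flows_ge[OF assms]) auto
qed

end
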